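(* Let $P(\lambda)=\sum_{i=0}^k\lambda^iA_i$ be an $n\times n$ matrix polynomial of degree $k$ with $A_i\in\mathbb{C}^{n\times n}$, let $\lambda_0\in\mathbb{C}$, let $r<kn$ be a positive integer, let $p=\min\{r,k\}$, and let $\Gamma=\{[\gamma_1\ \cdots\ \gamma_r]:\gamma_i>0,\ 1\leqslant i\leqslant r\}$. For $\gamma\in\Gamma$ let $f(\gamma):=\sigma_{(r+1)n-r}(T_\gamma(P,\lambda_0))$, and let $v(\gamma)=\begin{bmatrix}v_0^T&\cdots&v_r^T\end{bmatrix}^T$ and $u(\gamma)=\begin{bmatrix}u_0^T&\cdots&u_r^T\end{bmatrix}^T$ be corresponding right and left singular vectors of $T_\gamma(P,\lambda_0)$, with $v_i,u_i\in\mathbb{C}^n$ (depending on $\gamma$). Let $\Gamma_0\subset\Gamma$ be the collection of all $\gamma\in\Gamma$ for which the vector $v_0$ formed by the first $n$ entries of the right singular vector $v(\gamma)$ is nonzero. Then for $s=2$ or $F$, $$\delta_s(P,\lambda_0,r+1)\leqslant\inf_{\gamma\in\Gamma_0}f(\gamma)\left\|U(\gamma)\,(M(\lambda_0;r)V(\gamma))^\dagger\right\|_s,$$ where $U(\gamma)=\begin{bmatrix}u_0&\cdots&u_r\end{bmatrix}$, $V(\gamma)$ is the $(p+1)n\times(r+1)$ matrix whose $n\times1$ block in block row $i$ and column $j$ ($0\leqslant i\leqslant p$, $0\leqslant j\leqslant r$) is $\left(\prod_{l=j-i+1}^{j}\gamma_l\right)v_{j-i}$ if $j\geqslant i$ (an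 empty product being $1$) and $0$ if $j<i$, and the infimum is taken to be $\infty$ if $\Gamma_0=\emptyset$.
   Context: $\sigma_i(A)$ is the $i$-th singular value of $A$ in decreasing order; $Y^\dagger$ is the Moore–Penrose pseudoinverse; $\|\cdot\|_2$ and $\|\cdot\|_F$ are the spectral and Frobenius norms; $P^i$ is the $i$-th derivative of $P$. Corresponding right and left singular vectors for the singular value $f(\gamma)$ are unit vectors $v,u$ with $T_\gamma(P,\lambda_0)v=f(\gamma)u$ and $T_\gamma(P,\lambda_0)^*u=f(\gamma)v$. $T_\gamma(P,\lambda_0)$ is the $(r+1)n\times(r+1)n$ block lower triangular matrix whose $n\times n$ block in block position $(i,j)$, $1\leqslant i,j\leqslant r+1$, is $\left(\prod_{l=j}^{i-1}\gamma_l\right)\frac{P^{i-j}(\lambda_0)}{(i-j)!}$ if $i\geqslant j$ (an empty product being $1$) and $0$ if $i<j$. $M(\lambda_0;r)=H(\lambda_0)\otimes I_n$, where $H(\lambda_0)$ is the $(k+1)\times(p+1)$ matrix with $(i,j)$ entry $\left.\frac{1}{(j-1)!}\frac{d^{j-1}\lambda^{i-1}}{d\lambda^{j-1}}\right|_{\lambda=\lambda_0}$. For $r\leqslant k$, $$V(\gamma)=\begin{bmatrix}v_0&v_1&\cdots&v_r\\0&\gamma_1v_0&\cdots&\gamma_rv_{r-1}\\0&0&\cdots&\gamma_{r-1}\gamma_rv_{r-2}\\\vdots&\vdots&&\vdots\\0&0&\cdots&\prod_{i=1}^r\gamma_iv_0\end{bmatrix};$$ for $r>k$ only the first $k+1$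 block rows of this array are kept. For $\Delta P(\lambda)=\sum_{i=0}^k\lambda^i\Delta A_i$, put $|||\Delta P|||_F=\left(\sum_{i=0}^k\|\Delta A_i\|_F^2\right)^{1/2}$ and $|||\Delta P|||_2=\|[\Delta A_0\ \cdots\ \Delta A_k]\|_2$. For $s=2$ or $F$, $\delta_s(P,\lambda_0,r+1)$ is the infimum of $|||\Delta P|||_s$ over all $\Delta P(\lambda)=\sum_{i=0}^k\lambda^i\Delta A_i$, $\Delta A_i\in\mathbb{C}^{n\times n}$ (any of which may be zero), such that $P+\Delta P$ has an elementary divisor $(\lambda-\lambda_0)^j$ with $j\geqslant r+1$. Elementary divisors are defined via the Smith form: $P(\lambda)=E(\lambda)D(\lambda)F(\lambda)$ with $E,F$ matrix polynomials with nonzero constant determinants and $D=\mathrm{diag}(d_1,\dots,d_t,0,\dots,0)$, $d_i$ monic, $d_{i-1}\mid d_i$; if $d_i(\lambda)=\prod_j(\lambda-\lambda_{ij})^{c_{ij}}$ with distinct $\lambda_{ij}$ and $c_{ij}\geqslant1$, the factors $(\lambda-\lambda_{ij})^{c_{ij}}$ are the elementary divisors. *)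

theory Defs
  imports
    "Jordan_Normal_Form.Char_Poly"
    "Jordan_Normal_Form.Schur_Decomposition"
    "HOL-Analysis.L2_Norm"
    "HOL-Library.Extended_Real"
begin

section \<open>Norms, singular values and pseudoinverses of complex matrices\<close>

definition vec_norm2 :: "complex vec \<Rightarrow> real" where
  "vec_norm2 v = L2_set (\<lambda>i. cmod (v $ i)) {..<dim_vec v}"

definition frobenius_norm :: "complex mat \<Rightarrow> real" where
  "frobenius_norm A = L2_set (\<lambda>ij. cmod (A $$ ij)) ({..<dim_row A} \<times> {..<dim_col A})"

text \<open>The supremum below is over a nonempty set only if \<open>A\<close> has at least one column;
  all matrices considered here have one.\<close>

definition spectral_norm :: "complex mat \<Rightarrow> real" where
  "spectral_norm A =
     (SUP x \<in> {x \<in> carrier_vec (dim_col A). vec_norm2 x = 1}. vec_norm2 (A *\<^sub>v x))"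

datatype norm_kind = Spectral | Frobenius

fun mat_norm :: "norm_kind \<Rightarrow> complex mat \<Rightarrow> real" where
  "mat_norm Spectral A = spectral_norm A"
| "mat_norm Frobenius A = frobenius_norm A"

text \<open>Square roots of the eigenvalues of \<open>A\<^sup>*A\<close>, with algebraic multiplicity and in decreasing
  order. The eigenvalues are nonnegative reals, so that \<open>Re\<close> loses nothing. An \<open>m \<times> n\<close> matrix
  gets \<open>n\<close> singular values.\<close>

definition singular_values :: "complex mat \<Rightarrow> real list" where
  "singular_values A =
     rev (sorted_list_of_multiset
       (image_mset (\<lambda>z. sqrt (Re z)) (proots (char_poly (mat_adjoint A * A)))))"

text \<open>Numbered from 1.\<close>

definition singular_value :: "nat \<Rightarrow> complex mat \<Rightarrow> real" where
  "singular_value i A = singular_values A ! (i - 1)"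

definition singular_vector_pair ::
  "complex mat \<Rightarrow> real \<Rightarrow> complex vec \<Rightarrow> complex vec \<Rightarrow> bool" where
  "singular_vector_pair A s v u \<longleftrightarrow>
     v \<in> carrier_vec (dim_col A) \<and> u \<in> carrier_vec (dim_row A) \<and>
     vec_norm2 v = 1 \<and> vec_norm2 u = 1 \<and>
     A *\<^sub>v v = complex_of_real s \<cdot>\<^sub>v u \<and>
     mat_adjoint A *\<^sub>v u = complex_of_real s \<cdot>\<^sub>v v"

definition is_pinv :: "complex mat \<Rightarrow> complex mat \<Rightarrow> bool" where
  "is_pinv Y X \<longleftrightarrow>
     X \<in> carrier_mat (dim_col Y) (dim_row Y) \<and>
     Y * X * Y = Y \<and> X * Y * X = X \<and>
     mat_adjoint (Y * X) = Y * X \<and> mat_adjoint (X * Y) = X * Y"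

definition pinv :: "complex mat \<Rightarrow> complex mat" where
  "pinv Y = (THE X. is_pinv Y X)"

definition kronecker :: "'a :: times mat \<Rightarrow> 'a mat \<Rightarrow> 'a mat" where
  "kronecker A B =
     mat (dim_row A * dim_row B) (dim_col A * dim_col B)
       (\<lambda>(i, j). A $$ (i div dim_row B, j div dim_col B) *
                  B $$ (i mod dim_row B, j mod dim_col B))"


section \<open>Matrix polynomials and elementary divisors\<close>

text \<open>The matrix polynomial with coefficients \<open>A 0, \<dots>, A k\<close>; values of \<open>A\<close> beyond \<open>k\<close>
  are irrelevant.\<close>

definition mat_poly :: "nat \<Rightarrow> nat \<Rightarrow> (nat \<Rightarrow> complex mat) \<Rightarrow> complex poly mat" where
  "mat_poly n k A = mat n n (\<lambda>ij. \<Sum>l\<le>k. monom (A l $$ ij) l)"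

text \<open>The value at \<open>a\<close> of the \<open>i\<close>-th derivative.\<close>

definition deriv_at :: "nat \<Rightarrow> complex poly mat \<Rightarrow> complex \<Rightarrow> complex mat" where
  "deriv_at i P a = map_mat (\<lambda>q. poly ((pderiv ^^ i) q) a) P"

text \<open>The list \<open>ds\<close> holds \<open>d\<^sub>1, \<dots>, d\<^sub>t\<close>.\<close>

definition smith_form ::
  "nat \<Rightarrow> complex poly mat \<Rightarrow> complex poly mat \<Rightarrow> complex poly list \<Rightarrow> complex poly mat \<Rightarrow> bool"
where
  "smith_form n Q E ds F \<longleftrightarrow>
     E \<in> carrier_mat n n \<and> F \<in> carrier_mat n n \<and>
     (\<exists>c. c \<noteq> 0 \<and> det E = [:c:]) \<and> (\<exists>c. c \<noteq> 0 \<and> det F = [:c:]) \<and>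
     length ds \<le> n \<and> (\<forall>d \<in> set ds. lead_coeff d = 1) \<and>
     (\<forall>i. Suc i < length ds \<longrightarrow> ds ! i dvd ds ! Suc i) \<and>
     Q = E * mat n n (\<lambda>(i, j). if i = j \<and> i < length ds then ds ! i else 0) * F"

text \<open>The polynomial \<open>(\<lambda> - a)\<^sup>c\<close> is an elementary divisor of the \<open>n \<times> n\<close> matrix polynomial \<open>Q\<close>.
  The exponent of \<open>\<lambda> - a\<close> in the factorization of an invariant polynomial \<open>d\<close> is \<open>order a d\<close>.\<close>

definition elementary_divisor :: "nat \<Rightarrow> complex poly mat \<Rightarrow> complex \<Rightarrow> nat \<Rightarrow> bool" where
  "elementary_divisor n Q a c \<longleftrightarrow>
     c \<ge> 1 \<and> (\<exists>E ds F. smith_form n Q E ds F \<and> (\<exists>d \<in> set ds. order a d = c))"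


section \<open>The distance \<open>\<delta>\<^sub>s\<close>\<close>

text \<open>The \<open>n \<times> (k+1)n\<close> matrix \<open>[D 0 \<dots> D k]\<close>.\<close>

definition block_row :: "nat \<Rightarrow> nat \<Rightarrow> (nat \<Rightarrow> complex mat) \<Rightarrow> complex mat" where
  "block_row n k D = mat n ((k + 1) * n) (\<lambda>(a, b). D (b div n) $$ (a, b mod n))"

fun poly_norm :: "norm_kind \<Rightarrow> nat \<Rightarrow> nat \<Rightarrow> (nat \<Rightarrow> complex mat) \<Rightarrow> real" where
  "poly_norm Spectral n k D = spectral_norm (block_row n k D)"
| "poly_norm Frobenius n k D = sqrt (\<Sum>i\<le>k. (frobenius_norm (D i))\<^sup>2)"

definition delta ::
  "norm_kind \<Rightarrow> nat \<Rightarrow> nat \<Rightarrow> complex poly mat \<Rightarrow> complex \<Rightarrow> nat \<Rightarrow> ereal" where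
  "delta s n k P a m =
     (INF D \<in> {D. (\<forall>i\<le>k. D i \<in> carrier_mat n n) \<and>
                  (\<exists>j\<ge>m. elementary_divisor n (P + mat_poly n k D) a j)}.
        ereal (poly_norm s n k D))"


section \<open>The matrices \<open>T\<^sub>\<gamma>\<close>, \<open>M\<close>, \<open>U\<close> and \<open>V\<close>\<close>

text \<open>The parameters \<open>\<gamma>\<^sub>1, \<dots>, \<gamma>\<^sub>r\<close> are the entries \<open>g $ 0, \<dots>, g $ (r - 1)\<close> of a real vector.
  Blocks are numbered from 0, so that block \<open>(i, j)\<close> of \<open>T\<^sub>\<gamma>\<close> carries the product of
  \<open>\<gamma>\<^sub>l\<close> over \<open>j < l \<le> i\<close>.\<close>

definition Gamma_set :: "nat \<Rightarrow> real vec set" where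
  "Gamma_set r = {g \<in> carrier_vec r. \<forall>i<r. g $ i > 0}"

definition gamma_prod :: "real vec \<Rightarrow> nat \<Rightarrow> nat \<Rightarrow> complex" where
  "gamma_prod g a b = complex_of_real (\<Prod>l = a..b. g $ (l - 1))"

definition T_mat ::
  "nat \<Rightarrow> nat \<Rightarrow> complex poly mat \<Rightarrow> complex \<Rightarrow> real vec \<Rightarrow> complex mat" where
  "T_mat n r P a g =
     mat ((r + 1) * n) ((r + 1) * n) (\<lambda>(x, y).
       let i = x div n; j = y div n in
       if j \<le> i
       then gamma_prod g (j + 1) i * (deriv_at (i - j) P a $$ (x mod n, y mod n) / fact (i - j))
       else 0)"

definition H_mat :: "nat \<Rightarrow> nat \<Rightarrow> complex \<Rightarrow> complex mat" where
  "H_mat k p a =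
     mat (k + 1) (p + 1) (\<lambda>(i, j). poly ((pderiv ^^ j) (monom 1 i)) a / fact j)"

definition M_mat :: "nat \<Rightarrow> nat \<Rightarrow> nat \<Rightarrow> complex \<Rightarrow> complex mat" where
  "M_mat n k p a = kronecker (H_mat k p a) (1\<^sub>m n)"

definition U_mat :: "nat \<Rightarrow> nat \<Rightarrow> complex vec \<Rightarrow> complex mat" where
  "U_mat n r u = mat n (r + 1) (\<lambda>(x, j). u $ (j * n + x))"

definition V_mat :: "nat \<Rightarrow> nat \<Rightarrow> nat \<Rightarrow> real vec \<Rightarrow> complex vec \<Rightarrow> complex mat" where
  "V_mat n r p g v =
     mat ((p + 1) * n) (r + 1) (\<lambda>(x, j).
       let i = x div n in
       if i \<le> j then gamma_prod g (j - i + 1) j * v $ ((j - i) * n + x mod n) else 0)"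

end

theory Submission
  imports Defs
begin

text \<open>Fix \<open>\<gamma>\<close> with \<open>v\<^sub>0 \<noteq> 0\<close>, let \<open>B = [A\<^sub>0 \<dots> A\<^sub>k]\<close> and \<open>Y = M V\<close>. The product \<open>B M\<close> lists the Taylor
coefficients of \<open>P\<close> at \<open>\<lambda>\<^sub>0\<close>, and so the blocks of \<open>T v = f u\<close> are the columns of \<open>B Y = f U\<close>
(\<open>block_row_mult_M_V\<close>, \<open>T_mat_mult_vec\<close>). Let \<open>\<Delta>P\<close> have the coefficient row \<open>- f U Y\<^sup>\<dagger>\<close>. Its norm is
\<open>f \<parallel>U Y\<^sup>\<dagger>\<parallel>\<close>, and \<open>f U Y\<^sup>\<dagger> Y = B Y Y\<^sup>\<dagger> Y = B Y\<close>, so that the coefficient row of \<open>Q = P + \<Delta>P\<close>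
annihilates \<open>Y\<close>. This works for every rank of \<open>Y\<close>, because \<open>f U\<close> lies in the row space of \<open>Y\<close>.
Read backwards, the annihilation says that \<open>x(\<lambda>) = \<Sum>\<^sub>j v\<^sub>j / (\<gamma>\<^sub>1 \<cdots> \<gamma>\<^sub>j) (\<lambda> - \<lambda>\<^sub>0)\<^sup>j\<close> satisfies
\<open>Q x = O((\<lambda> - \<lambda>\<^sub>0)\<^sup>r\<^sup>+\<^sup>1)\<close>, while \<open>x(\<lambda>\<^sub>0) = v\<^sub>0 \<noteq> 0\<close>: a Jordan chain of length \<open>r + 1\<close>
(\<open>jordan_chain_of_null_block_row\<close>).

If \<open>det Q \<noteq> 0\<close>, transporting the chain through a Smith form shows that some invariant polynomial is
divisible by \<open>(\<lambda> - \<lambda>\<^sub>0)\<^sup>r\<^sup>+\<^sup>1\<close> (\<open>elementary_divisor_of_jordan_chain\<close>), and \<open>\<Delta>P\<close> competes in the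
infimum that defines \<open>\<delta>\<^sub>s\<close>.

If \<open>det Q = 0\<close>, the chain may live in the kernel of \<open>Q\<close> and then says nothing about elementary
divisors. But \<open>\<delta>\<^sub>s\<close> is an infimum, and every \<open>n \<times> n\<close> matrix polynomial of degree at most \<open>k\<close> with
vanishing determinant is a limit of matrix polynomials of degree at most \<open>k\<close> that have an elementary
divisor \<open>(\<lambda> - \<lambda>\<^sub>0)\<^sup>c\<close> with \<open>c \<ge> k n \<ge> r + 1\<close> (\<open>singular_matrix_limit_of_elementary_divisor\<close>). The reason
is that the determinant, as a map into the polynomials of degree at most \<open>k n\<close>, is a submersion at
most of its zeros. Its differential at \<open>Q\<close> is \<open>E \<mapsto> tr (adj Q \<cdot> E)\<close>.

\<^item> Where the differential is onto, a contraction argument produces arbitrarily close \<open>Q'\<close> whose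
  determinant is a small multiple of \<open>(\<lambda> - \<lambda>\<^sub>0)\<^sup>k\<^sup>n\<close> and which has a cofactor that does not vanish at
  \<open>\<lambda>\<^sub>0\<close> (\<open>exists_perturbation_with_det\<close>). A column of \<open>adj Q'\<close> is then a Jordan chain of length \<open>k n\<close>.

\<^item> The points where it is onto are dense among the zeros of the determinant. A singular \<open>Q\<close> is a sum of
  \<open>n - 1\<close> products \<open>c\<^sub>l s\<^sub>l\<^sup>T\<close> with \<open>deg c\<^sub>l + deg s\<^sub>l \<le> k\<close> (\<open>singular_factorization\<close>). For each choice of
  degrees there is an explicit model with bidiagonal factors at which the differential is onto. Moving the factors
  of \<open>Q\<close> along the segment to those of the model stays inside the singular matrices, and surjectivity
  fails at only finitely many points of it (\<open>exists_nearby_surjective_point\<close>).\<close>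


section \<open>The Moore--Penrose inverse\<close>

lemma mult_mat_entry:
  assumes "A \<in> carrier_mat m n" "B \<in> carrier_mat n l" "i < m" "j < l"
  shows "(A * B) $$ (i, j) = (\<Sum>k<n. A $$ (i, k) * B $$ (k, j))"
  using assms by (simp add: scalar_prod_def atLeast0LessThan)

lemma mult_mat_vec_entry:
  assumes "A \<in> carrier_mat m n" "v \<in> carrier_vec n" "i < m"
  shows "(A *\<^sub>v v) $ i = (\<Sum>k<n. A $$ (i, k) * v $ k)"
  using assms by (simp add: scalar_prod_def atLeast0LessThan)

lemma dim_mat_adjoint [simp]:
  "dim_row (mat_adjoint A) = dim_col A" "dim_col (mat_adjoint A) = dim_row A"
  by (auto simp: mat_adjoint_def)

lemma mat_adjoint_carrier [simp]: "A \<in> carrier_mat m n \<Longrightarrow> mat_adjoint A \<in> carrier_mat n m"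
  by (intro carrier_matI) auto

lemma mat_adjoint_index [simp]:
  fixes A :: "complex mat"
  assumes "i < dim_col A" "j < dim_row A"
  shows "mat_adjoint A $$ (i, j) = cnj (A $$ (j, i))"
  using assms by (simp add: mat_adjoint_def mat_of_rows_def)

lemma mat_adjoint_adjoint [simp]: "mat_adjoint (mat_adjoint (A :: complex mat)) = A"
  by (rule eq_matI) auto

lemma mat_adjoint_mult:
  fixes A B :: "complex mat"
  assumes "A \<in> carrier_mat m l" "B \<in> carrier_mat l n"
  shows "mat_adjoint (A * B) = mat_adjoint B * mat_adjoint A"
  using assms by (intro eq_matI) (auto simp: scalar_prod_def mult.commute intro!: sum.cong)

lemma adjoint_mult_self_zero:
  fixes A :: "complex mat"
  assumes A: "A \<in> carrier_mat m n" and z: "mat_adjoint A * A = 0\<^sub>m n n"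
  shows "A = 0\<^sub>m m n"
proof (rule eq_matI)
  fix i j assume ij: "i < dim_row (0\<^sub>m m n :: complex mat)" "j < dim_col (0\<^sub>m m n :: complex mat)"
  have "0 = (mat_adjoint A * A) $$ (j, j)" using ij z by simp
  also have "\<dots> = (\<Sum>l<m. cnj (A $$ (l, j)) * A $$ (l, j))"
    using ij A by (auto simp: scalar_prod_def atLeast0LessThan)
  also have "\<dots> = complex_of_real (\<Sum>l<m. (cmod (A $$ (l, j)))\<^sup>2)"
    unfolding of_real_sum
    by (rule sum.cong) (auto simp del: of_real_power simp: complex_norm_square mult.commute)
  finally have "(\<Sum>l<m. (cmod (A $$ (l, j)))\<^sup>2) = 0" by (metis of_real_eq_0_iff)
  then have "(cmod (A $$ (i, j)))\<^sup>2 = 0"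
    using ij by (subst (asm) sum_nonneg_eq_0_iff) auto
  then show "A $$ (i, j) = 0\<^sub>m m n $$ (i, j)" using ij by simp
qed (use A in auto)

text \<open>\<open>A\<^sup>*\<close> is injective on the range of \<open>A\<close>, because \<open>(A B)\<^sup>* (A B) = B\<^sup>* (A\<^sup>* A B)\<close>.\<close>

lemma adjoint_mult_zero_imp:
  fixes A B :: "complex mat"
  assumes A: "A \<in> carrier_mat m n" and B: "B \<in> carrier_mat n l"
    and z: "mat_adjoint A * A * B = 0\<^sub>m n l"
  shows "A * B = 0\<^sub>m m l"
proof (rule adjoint_mult_self_zero)
  show "A * B \<in> carrier_mat m l" using A B by simp
  have "mat_adjoint (A * B) * (A * B) = mat_adjoint B * (mat_adjoint A * A * B)"
    using A B by (simp add: mat_adjoint_mult[OF A B] 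
        assoc_mult_mat[of _ l n _ m _ l] assoc_mult_mat[of _ n m _ n _ l])
  then show "mat_adjoint (A * B) * (A * B) = 0\<^sub>m l l" using z B by simp
qed

lemma minus_eq_zero_imp_eq_mat:
  fixes A :: "'a :: ring mat"
  assumes "A \<in> carrier_mat m n" "B \<in> carrier_mat m n" "A - B = 0\<^sub>m m n"
  shows "A = B"
proof (rule eq_matI)
  fix i j assume "i < dim_row B" "j < dim_col B"
  then have "(A - B) $$ (i, j) = 0" using assms by simp
  then show "A $$ (i, j) = B $$ (i, j)" using \<open>i < _\<close> \<open>j < _\<close> assms(1,2) by simp
qed (use assms in auto)

text \<open>Wedderburn's rank reduction: subtracting from \<open>Y\<close> the outer product of the column and the row through a
nonzero entry, divided by that entry, kills this row and keeps all zero rows. The reduced matrix has the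
form \<open>L Y = Y R\<close>, so that an inner inverse \<open>G\<close> of it yields the inner inverse \<open>R G L + W\<close> of \<open>Y\<close>, where \<open>W\<close>
has a single nonzero entry.\<close>

lemma exists_inner_inverse:
  fixes Y :: "'a :: field mat"
  assumes "Y \<in> carrier_mat m n"
  shows "\<exists>G \<in> carrier_mat n m. Y * G * Y = Y"
  using assms
proof (induction "card {i. i < m \<and> row Y i \<noteq> 0\<^sub>v n}" arbitrary: Y rule: less_induct)
  case less
  note Y = less.prems
  show ?case
  proof (cases "Y = 0\<^sub>m m n")
    case True
    then show ?thesis by (intro bexI[of _ "0\<^sub>m n m"]) auto
  next
    case False
    then obtain a b where ab: "a < m" "b < n" "Y $$ (a, b) \<noteq> 0"
      using Y by (metis carrier_matD eq_matI index_zero_mat)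
    define c where "c = Y $$ (a, b)"
    have c: "c \<noteq> 0" using ab c_def by simp
    define Z where "Z = mat m n (\<lambda>(i, j). Y $$ (i, j) - Y $$ (i, b) * Y $$ (a, j) / c)"
    have Z: "Z \<in> carrier_mat m n" by (simp add: Z_def)
    have sub: "{i. i < m \<and> row Z i \<noteq> 0\<^sub>v n} \<subset> {i. i < m \<and> row Y i \<noteq> 0\<^sub>v n}"
    proof (rule psubsetI)
      show "{i. i < m \<and> row Z i \<noteq> 0\<^sub>v n} \<subseteq> {i. i < m \<and> row Y i \<noteq> 0\<^sub>v n}"
      proof (clarsimp, rule ccontr)
        fix i assume i: "i < m" "row Z i \<noteq> 0\<^sub>v n" and "row Y i = 0\<^sub>v n"
        have "Y $$ (i, j) = 0" if "j < n" for j
        proof -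
          have "row Y i $ j = 0" using \<open>row Y i = 0\<^sub>v n\<close> that by simp
          then show ?thesis using that i Y by simp
        qed
        then have "row Z i = 0\<^sub>v n" using ab by (intro eq_vecI) (auto simp: Z_def i)
        with i show False by simp
      qed
      have "row Z a = 0\<^sub>v n" using ab c by (intro eq_vecI) (auto simp: Z_def c_def)
      moreover have "row Y a \<noteq> 0\<^sub>v n"
      proof
        assume "row Y a = 0\<^sub>v n"
        then have "row Y a $ b = 0" using ab by simp
        then show False using ab Y by simp
      qed
      ultimately show "{i. i < m \<and> row Z i \<noteq> 0\<^sub>v n} \<noteq> {i. i < m \<and> row Y i \<noteq> 0\<^sub>v n}"
        using ab(1) by blast
    qed
    have "card {i. i < m \<and> row Z i \<noteq> 0\<^sub>v n} < card {i. i < m \<and> row Y i \<noteq> 0\<^sub>v n}"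
      by (rule psubset_card_mono[OF _ sub]) simp
    from less.hyps[OF this Z] obtain G where G: "G \<in> carrier_mat n m" and ZGZ: "Z * G * Z = Z"
      by blast
    \<comment> \<open>With \<open>c\<close> the chosen entry: \<open>L = I - Y e\<^sub>b e\<^sub>a\<^sup>T / c\<close> and \<open>R = I - e\<^sub>b e\<^sub>a\<^sup>T Y / c\<close>, so \<open>L Y = Y R = Z\<close>.\<close>
    define L where "L = mat m m (\<lambda>(i, j). (if i = j then 1 else 0) - (if j = a then Y $$ (i, b) / c else 0))"
    define R where "R = mat n n (\<lambda>(i, j). (if i = j then 1 else 0) - (if i = b then Y $$ (a, j) / c else 0))"
    define W where "W = mat n m (\<lambda>(i, j). if i = b \<and> j = a then 1 / c else 0)"
    have car: "L \<in> carrier_mat m m" "R \<in> carrier_mat n n" "W \<in> carrier_mat n m"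
      by (auto simp: L_def R_def W_def)
    have LY: "L * Y = Z"
      using Y ab by (intro eq_matI)
        (auto simp: L_def Z_def scalar_prod_def left_diff_distrib sum_subtractf if_distrib[of "\<lambda>x. x * _"] cong: if_cong)
    have YR: "Y * R = Z"
      using Y ab by (intro eq_matI)
        (auto simp: R_def Z_def scalar_prod_def right_diff_distrib sum_subtractf if_distrib[of "\<lambda>x. _ * x"] cong: if_cong)
    have WY: "W * Y = mat n n (\<lambda>(i, j). if i = b then Y $$ (a, j) / c else 0)"
      using Y ab by (intro eq_matI)
        (auto simp: W_def scalar_prod_def if_distrib[of "\<lambda>x. x * _"] cong: if_cong)
    have YWY: "Y * (W * Y) = mat m n (\<lambda>(i, j). Y $$ (i, b) * Y $$ (a, j) / c)"
      unfolding WY using Y ab by (intro eq_matI)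
        (auto simp: scalar_prod_def if_distrib[of "\<lambda>x. _ * x"] cong: if_cong)
    define G' where "G' = R * G * L + W"
    have G': "G' \<in> carrier_mat n m" using G car by (simp add: G'_def)
    have ZGZ': "Z * (G * Z) = Z" using ZGZ Z G by simp
    have "Y * G' * Y = Y * (G' * Y)" using Y G' by simp
    also have "G' * Y = R * G * L * Y + W * Y"
      unfolding G'_def using Y G car by (intro add_mult_distrib_mat) auto
    also have "R * G * L * Y = R * (G * Z)"
      using Y G car by (simp add: assoc_mult_mat[of R n n _ m Y n] LY)
    also have "Y * (R * (G * Z) + W * Y) = Y * (R * (G * Z)) + Y * (W * Y)"
      using Y G car Z by (intro mult_add_distrib_mat) auto
    also have "Y * (R * (G * Z)) = Y * R * (G * Z)"
      using Y G car Z by (intro assoc_mult_mat[symmetric]) auto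
    also have "\<dots> = Z" by (simp add: YR ZGZ')
    also have "Z + Y * (W * Y) = Y"
      unfolding YWY using Y by (intro eq_matI) (auto simp: Z_def)
    finally show ?thesis using G' by blast
  qed
qed

text \<open>With an inner inverse \<open>G\<close> of \<open>H = Y\<^sup>* Y\<close>, the matrix \<open>X = G Y\<^sup>*\<close> solves the normal equations
\<open>Y\<^sup>* Y X = Y\<^sup>*\<close>, which make \<open>Y X\<close> the orthogonal projection onto the range of \<open>Y\<close>.\<close>

lemma exists_least_squares_inverse:
  fixes Y :: "complex mat"
  assumes Y: "Y \<in> carrier_mat m n"
  shows "\<exists>X \<in> carrier_mat n m. Y * X * Y = Y \<and> mat_adjoint (Y * X) = Y * X"
proof -
  define H where "H = mat_adjoint Y * Y"
  have Ya: "mat_adjoint Y \<in> carrier_mat n m" using Y by simp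
  have H: "H \<in> carrier_mat n n" unfolding H_def by (rule mult_carrier_mat[OF Ya Y])
  have Hh: "mat_adjoint H = H" using Y by (simp add: H_def mat_adjoint_mult[OF Ya Y])
  obtain G where G: "G \<in> carrier_mat n n" and HGH: "H * G * H = H"
    using exists_inner_inverse[OF H] by blast
  have key: "Y * (K * H) = Y" if K: "K \<in> carrier_mat n n" and HKH: "H * K * H = H" for K
  proof -
    have KH: "K * H \<in> carrier_mat n n" by (rule mult_carrier_mat[OF K H])
    have "mat_adjoint Y * Y * (K * H - 1\<^sub>m n) = H * (K * H) - H * 1\<^sub>m n"
      unfolding H_def[symmetric] by (rule mult_minus_distrib_mat[OF H KH one_carrier_mat])
    also have "H * (K * H) = H * K * H" using assoc_mult_mat[OF H K H] by simp
    also have "\<dots> - H * 1\<^sub>m n = 0\<^sub>m n n" unfolding HKH using H by simp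
    finally have "Y * (K * H - 1\<^sub>m n) = 0\<^sub>m m n"
      by (rule adjoint_mult_zero_imp[OF Y minus_carrier_mat[OF one_carrier_mat]])
    then have "Y * (K * H) - Y * 1\<^sub>m n = 0\<^sub>m m n"
      by (simp only: mult_minus_distrib_mat[OF Y KH one_carrier_mat])
    then have "Y * (K * H) - Y = 0\<^sub>m m n" using Y by simp
    then show ?thesis by (rule minus_eq_zero_imp_eq_mat[OF mult_carrier_mat[OF Y KH] Y])
  qed
  define X where "X = G * mat_adjoint Y"
  have X: "X \<in> carrier_mat n m" unfolding X_def by (rule mult_carrier_mat[OF G Ya])
  have XY: "X * Y = G * H" unfolding X_def H_def by (rule assoc_mult_mat[OF G Ya Y])
  have YXY: "Y * X * Y = Y"
    unfolding assoc_mult_mat[OF Y X Y] XY by (rule key[OF G HGH])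
  have Ga: "mat_adjoint G \<in> carrier_mat n n" using G by simp
  have "mat_adjoint (H * G * H) = H * (mat_adjoint G * H)"
    unfolding mat_adjoint_mult[OF mult_carrier_mat[OF H G] H] mat_adjoint_mult[OF H G] Hh ..
  then have "H * mat_adjoint G * H = H" unfolding HGH Hh using assoc_mult_mat[OF H Ga H] by simp
  then have "Y * (mat_adjoint G * H) = Y" by (rule key[OF Ga])
  then have "mat_adjoint Y = mat_adjoint (Y * (mat_adjoint G * H))" by simp
  also have "\<dots> = H * G * mat_adjoint Y"
    unfolding mat_adjoint_mult[OF Y mult_carrier_mat[OF Ga H]] mat_adjoint_mult[OF Ga H] Hh by simp
  finally have YYX: "mat_adjoint Y * (Y * X) = mat_adjoint Y"
    unfolding assoc_mult_mat[OF Ya Y X, symmetric] H_def[symmetric] unfolding X_def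
    using assoc_mult_mat[OF H G Ya] by simp
  have YX: "Y * X \<in> carrier_mat m m" by (rule mult_carrier_mat[OF Y X])
  have Xa: "mat_adjoint X \<in> carrier_mat m n" using X by simp
  have "mat_adjoint (Y * X) * (Y * X) = mat_adjoint X * (mat_adjoint Y * (Y * X))"
    unfolding mat_adjoint_mult[OF Y X] by (rule assoc_mult_mat[OF Xa Ya YX])
  then have e: "mat_adjoint (Y * X) * (Y * X) = mat_adjoint (Y * X)"
    unfolding YYX mat_adjoint_mult[OF Y X] .
  have YXa: "mat_adjoint (Y * X) \<in> carrier_mat m m" using YX by simp
  have "mat_adjoint (mat_adjoint (Y * X) * (Y * X)) = mat_adjoint (Y * X) * (Y * X)"
    unfolding mat_adjoint_mult[OF YXa YX] mat_adjoint_adjoint ..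
  then have "mat_adjoint (Y * X) = Y * X" unfolding e mat_adjoint_adjoint by simp
  then show ?thesis using X YXY by blast
qed

text \<open>Urquhart's formula \<open>Y\<^sup>\<dagger> = B Y A\<close>, where \<open>Y A\<close> is the orthogonal projection onto the range of \<open>Y\<close> and
\<open>B Y\<close> the one onto the row space. The latter is the former for \<open>Y\<^sup>*\<close>.\<close>

lemma is_pinv_exists:
  assumes Y: "Y \<in> carrier_mat m n"
  shows "\<exists>X. is_pinv Y X"
proof -
  obtain A where A: "A \<in> carrier_mat n m" and YAY: "Y * A * Y = Y" and Aa: "mat_adjoint (Y * A) = Y * A"
    using exists_least_squares_inverse[OF Y] by blast
  have Ya: "mat_adjoint Y \<in> carrier_mat n m" using Y by simp
  obtain B' where B': "B' \<in> carrier_mat m n" and YBY': "mat_adjoint Y * B' * mat_adjoint Y = mat_adjoint Y"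
      and Ba: "mat_adjoint (mat_adjoint Y * B') = mat_adjoint Y * B'"
    using exists_least_squares_inverse[OF Ya] by blast
  define B where "B = mat_adjoint B'"
  have B: "B \<in> carrier_mat n m" using B' by (simp add: B_def)
  have B'': "mat_adjoint Y * B' = B * Y"
    using Ba mat_adjoint_mult[OF Ya B'] by (simp add: B_def)
  have BY: "mat_adjoint (B * Y) = B * Y"
    using Ba unfolding B'' .
  have "B * Y * mat_adjoint Y = mat_adjoint Y" using YBY' unfolding B'' .
  then have "mat_adjoint (B * Y * mat_adjoint Y) = Y" by simp
  then have YBY: "Y * (B * Y) = Y"
    unfolding mat_adjoint_mult[OF mult_carrier_mat[OF B Y] Ya] BY mat_adjoint_adjoint .
  have BYc: "B * Y \<in> carrier_mat n n" by (rule mult_carrier_mat[OF B Y])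
  define X where "X = B * Y * A"
  have X: "X \<in> carrier_mat n m" unfolding X_def by (rule mult_carrier_mat[OF BYc A])
  have YX: "Y * X = Y * A"
    unfolding X_def assoc_mult_mat[OF Y BYc A, symmetric] YBY ..
  have XY: "X * Y = B * Y"
  proof -
    have "X * Y = B * Y * (A * Y)" unfolding X_def by (rule assoc_mult_mat[OF BYc A Y])
    also have "\<dots> = B * (Y * (A * Y))" by (rule assoc_mult_mat[OF B Y mult_carrier_mat[OF A Y]])
    also have "Y * (A * Y) = Y" using assoc_mult_mat[OF Y A Y] YAY by simp
    finally show ?thesis .
  qed
  have XYX: "X * Y * X = X"
  proof -
    have "X * Y * X = B * (Y * X)" unfolding XY by (rule assoc_mult_mat[OF B Y X])
    also have "\<dots> = X" unfolding YX unfolding X_def by (rule assoc_mult_mat[OF B Y A, symmetric])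
    finally show ?thesis .
  qed
  have "Y * X * Y = Y" "mat_adjoint (Y * X) = Y * X" "mat_adjoint (X * Y) = X * Y"
    using YAY Aa BY by (simp_all only: YX XY)
  then have "is_pinv Y X" using X Y XYX by (simp add: is_pinv_def)
  then show ?thesis by blast
qed

lemma is_pinv_unique:
  assumes 1: "is_pinv Y X" and 2: "is_pinv Y Z"
  shows "X = Z"
proof -
  define m n where "m = dim_row Y" and "n = dim_col Y"
  have Y: "Y \<in> carrier_mat m n" by (simp add: m_def n_def)
  have X: "X \<in> carrier_mat n m" and Z: "Z \<in> carrier_mat n m"
    using 1 2 by (auto simp: is_pinv_def m_def n_def)
  note e1 = 1[unfolded is_pinv_def] and e2 = 2[unfolded is_pinv_def]
  have car: "Y * X \<in> carrier_mat m m" "Y * Z \<in> carrier_mat m m"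
     "X * Y \<in> carrier_mat n n" "Z * Y \<in> carrier_mat n n" using X Y Z by auto
  have "Y * X = Y * Z * Y * X" using e2 by simp
  also have "\<dots> = Y * Z * (Y * X)" by (rule assoc_mult_mat[OF car(2) Y X])
  finally have "Y * X = Y * Z * (Y * X)" .
  then have "mat_adjoint (Y * X) = mat_adjoint (Y * X) * mat_adjoint (Y * Z)"
    using mat_adjoint_mult[OF car(2) car(1)] by metis
  then have "Y * X = Y * X * (Y * Z)" using e1 e2 by simp
  also have "\<dots> = Y * X * Y * Z" by (rule assoc_mult_mat[OF car(1) Y Z, symmetric])
  also have "\<dots> = Y * Z" using e1 by simp
  finally have YXZ: "Y * X = Y * Z" .
  have "X * Y = X * (Y * (Z * Y))"
    using e2 unfolding assoc_mult_mat[OF Y Z Y, symmetric] by simp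
  also have "\<dots> = X * Y * (Z * Y)" by (rule assoc_mult_mat[OF X Y car(4), symmetric])
  finally have "X * Y = X * Y * (Z * Y)" .
  then have "mat_adjoint (X * Y) = mat_adjoint (Z * Y) * mat_adjoint (X * Y)"
    using mat_adjoint_mult[OF car(3) car(4)] by metis
  then have "X * Y = Z * Y * (X * Y)" using e1 e2 by simp
  also have "\<dots> = Z * (Y * (X * Y))" by (rule assoc_mult_mat[OF Z Y car(3)])
  also have "\<dots> = Z * Y"
    using e1 unfolding assoc_mult_mat[OF Y X Y, symmetric] by simp
  finally have XYZ: "X * Y = Z * Y" .
  have "X = X * Y * X" using e1 by simp
  also have "\<dots> = Z * (Y * X)" unfolding XYZ by (rule assoc_mult_mat[OF Z Y X])
  also have "\<dots> = Z * Y * Z" unfolding YXZ by (rule assoc_mult_mat[OF Z Y Z, symmetric])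
  also have "\<dots> = Z" using e2 by simp
  finally show ?thesis .
qed

lemma is_pinv_pinv: "is_pinv Y (pinv Y)"
proof -
  have "\<exists>X. is_pinv Y X" by (rule is_pinv_exists[of Y "dim_row Y" "dim_col Y"]) simp
  then have "\<exists>!X. is_pinv Y X" using is_pinv_unique[of Y] by blast
  then show ?thesis unfolding pinv_def by (rule theI')
qed

lemma pinv_carrier: "Y \<in> carrier_mat m n \<Longrightarrow> pinv Y \<in> carrier_mat n m"
  using is_pinv_pinv[of Y] by (auto simp: is_pinv_def)

lemma mult_pinv_mult: "Y * pinv Y * Y = Y"
  using is_pinv_pinv[of Y] by (auto simp: is_pinv_def)


section \<open>The Smith form\<close>

definition unimodular :: "nat \<Rightarrow> complex poly mat \<Rightarrow> bool" where
  "unimodular n P \<longleftrightarrow> P \<in> carrier_mat n n \<and> (\<exists>c. c \<noteq> 0 \<and> det P = [:c:])"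

definition unimodular_equiv :: "nat \<Rightarrow> complex poly mat \<Rightarrow> complex poly mat \<Rightarrow> bool" where
  "unimodular_equiv n A B \<longleftrightarrow>
     B \<in> carrier_mat n n \<and> (\<exists>P R. unimodular n P \<and> unimodular n R \<and> A = P * B * R)"

lemma unimodular_one: "unimodular n (1\<^sub>m n)"
  by (auto simp: unimodular_def one_pCons intro!: exI[of _ 1])

lemma unimodular_mult: "unimodular n P \<Longrightarrow> unimodular n R \<Longrightarrow> unimodular n (P * R)"
  by (fastforce simp: unimodular_def det_mult)

lemma unimodular_unit_det: "P \<in> carrier_mat n n \<Longrightarrow> det P = 1 \<Longrightarrow> unimodular n P"
  by (auto simp: unimodular_def one_pCons)

lemma unimodular_equiv_refl: "A \<in> carrier_mat n n \<Longrightarrow> unimodular_equiv n A A"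
  unfolding unimodular_equiv_def using unimodular_one[of n]
  by (metis left_mult_one_mat right_mult_one_mat)

lemma unimodular_equiv_trans:
  assumes "unimodular_equiv n A B" "unimodular_equiv n B C"
  shows "unimodular_equiv n A C"
proof -
  obtain P R P' R' where *: "unimodular n P" "unimodular n R" "A = P * B * R"
    "unimodular n P'" "unimodular n R'" "B = P' * C * R'" "C \<in> carrier_mat n n"
    using assms unfolding unimodular_equiv_def by blast
  then have car: "P \<in> carrier_mat n n" "R \<in> carrier_mat n n" "P' \<in> carrier_mat n n" "R' \<in> carrier_mat n n"
    by (auto simp: unimodular_def)
  have "A = (P * P') * C * (R' * R)"
    using car * by (simp add: assoc_mult_mat[of _ n n _ n _ n])
  then show ?thesis using * unimodular_mult unfolding unimodular_equiv_def by blast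
qed

lemma unimodular_equiv_left:
  assumes "unimodular n P" "B \<in> carrier_mat n n" "A = P * B"
  shows "unimodular_equiv n A B"
  unfolding unimodular_equiv_def using assms unimodular_one[of n]
  by (metis right_mult_one_mat mult_carrier_mat unimodular_def)

lemma unimodular_equiv_right:
  assumes "unimodular n R" "B \<in> carrier_mat n n" "A = B * R"
  shows "unimodular_equiv n A B"
  unfolding unimodular_equiv_def using assms unimodular_one[of n]
  by (metis left_mult_one_mat)

lemma unimodular_equiv_addrow:
  assumes B: "B \<in> carrier_mat n n" and kl: "k < n" "l < n" "k \<noteq> l"
  shows "unimodular_equiv n B (addrow c k l B)"
proof (rule unimodular_equiv_left)
  show "unimodular n (addrow_mat n (- c) k l)"
    by (rule unimodular_unit_det) (use kl in \<open>auto simp: det_addrow_mat\<close>)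
  show c: "addrow c k l B \<in> carrier_mat n n" using B by simp
  have "B = addrow (- c) k l (addrow c k l B)"
    using B kl by (intro eq_matI) auto
  also have "\<dots> = addrow_mat n (- c) k l * addrow c k l B"
    by (rule addrow_mat[OF c]) (use kl in auto)
  finally show "B = addrow_mat n (- c) k l * addrow c k l B" .
qed

lemma unimodular_equiv_addcol:
  assumes B: "B \<in> carrier_mat n n" and kl: "k < n" "l < n" "k \<noteq> l"
  shows "unimodular_equiv n B (addcol c k l B)"
proof (rule unimodular_equiv_right)
  show "unimodular n (addrow_mat n (- c) l k)"
    by (rule unimodular_unit_det) (use kl in \<open>auto simp: det_addrow_mat\<close>)
  show c: "addcol c k l B \<in> carrier_mat n n" by (rule carrier_matI) (use B in simp_all)
  have "B = addcol (- c) k l (addcol c k l B)"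
    using B kl by (intro eq_matI) auto
  also have "\<dots> = addcol c k l B * addrow_mat n (- c) l k"
    by (rule addcol_mat[OF c]) (use kl in auto)
  finally show "B = addcol c k l B * addrow_mat n (- c) l k" .
qed

lemma unimodular_equiv_swaprows:
  assumes B: "B \<in> carrier_mat n n" and kl: "k < n" "l < n"
  shows "unimodular_equiv n B (swaprows k l B)"
proof (cases "k = l")
  case True
  then have "swaprows k l B = B" using B by (intro eq_matI) auto
  then show ?thesis using unimodular_equiv_refl[OF B] by simp
next
  case False
  show ?thesis
  proof (rule unimodular_equiv_left)
    show "unimodular n (swaprows_mat n k l)"
      using kl False by (auto simp: unimodular_def det_swaprows_mat one_pCons intro!: exI[of _ "-1"])
    show c: "swaprows k l B \<in> carrier_mat n n" using B by simp
    have "B = swaprows k l (swaprows k l B)"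
      using B kl by (intro eq_matI) auto
    also have "\<dots> = swaprows_mat n k l * swaprows k l B"
      by (rule swaprows_mat[OF c kl])
    finally show "B = swaprows_mat n k l * swaprows k l B" .
  qed
qed

lemma unimodular_equiv_swapcols:
  assumes B: "B \<in> carrier_mat n n" and kl: "k < n" "l < n"
  shows "unimodular_equiv n B (swapcols k l B)"
proof (cases "k = l")
  case True
  then have "swapcols k l B = B" using B by (intro eq_matI) auto
  then show ?thesis using unimodular_equiv_refl[OF B] by simp
next
  case False
  show ?thesis
  proof (rule unimodular_equiv_right)
    show "unimodular n (swaprows_mat n k l)"
      using kl False by (auto simp: unimodular_def det_swaprows_mat one_pCons intro!: exI[of _ "-1"])
    show c: "swapcols k l B \<in> carrier_mat n n" using B by simp
    have "B = swapcols k l (swapcols k l B)"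
      using B kl by (intro eq_matI) auto
    also have "\<dots> = swapcols k l B * swaprows_mat n k l"
      by (rule swapcols_mat[OF c kl])
    finally show "B = swapcols k l B * swaprows_mat n k l" .
  qed
qed

text \<open>A pivot that divides its row and its column splits off as a direct summand. The quotients form a lower and
an upper unitriangular factor.\<close>

lemma unimodular_equiv_clear:
  assumes B: "B \<in> carrier_mat (Suc n) (Suc n)" and d: "d = B $$ (0, 0)"
    and col: "\<And>i. i < Suc n \<Longrightarrow> d dvd B $$ (i, 0)"
    and row: "\<And>j. j < Suc n \<Longrightarrow> d dvd B $$ (0, j)"
    and C_def: "C = mat (Suc n) (Suc n) (\<lambda>(i, j). if i = 0 \<and> j = 0 then d else
       if i = 0 \<or> j = 0 then 0 else B $$ (i, j) - (B $$ (i, 0) div d) * B $$ (0, j))"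
    and d0: "d \<noteq> 0"
  shows "unimodular_equiv (Suc n) B C"
proof -
  define L where "L = mat (Suc n) (Suc n) (\<lambda>(i, j). if i = j then 1 else
     if j = 0 then B $$ (i, 0) div d else 0)"
  define R where "R = mat (Suc n) (Suc n) (\<lambda>(i, j). if i = j then 1 else
     if i = 0 then B $$ (0, j) div d else 0)"
  have car: "L \<in> carrier_mat (Suc n) (Suc n)" "R \<in> carrier_mat (Suc n) (Suc n)"
      "C \<in> carrier_mat (Suc n) (Suc n)"
    by (auto simp: L_def R_def C_def)
  have "det L = prod_list (diag_mat L)"
    by (rule det_lower_triangular[OF _ car(1)]) (auto simp: L_def)
  also have "\<dots> = 1" unfolding prod_list_diag_prod using car by (intro prod.neutral) (auto simp: L_def)
  finally have detL: "det L = 1" .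
  have "upper_triangular R" by (auto simp: R_def upper_triangular_def)
  from det_upper_triangular[OF this car(2)] have "det R = prod_list (diag_mat R)" .
  also have "\<dots> = 1" unfolding prod_list_diag_prod using car by (intro prod.neutral) (auto simp: R_def)
  finally have detR: "det R = 1" .
  have L1: "(\<Sum>l<Suc n. L $$ (i, l) * f l) = f i + (if i = 0 then 0 else (B $$ (i, 0) div d) * f 0)"
    if "i < Suc n" for i and f :: "nat \<Rightarrow> complex poly"
  proof -
    have "(\<Sum>l<Suc n. L $$ (i, l) * f l) =
       (\<Sum>l<Suc n. (if l = i then f i else 0) + (if l = 0 then (if i = 0 then 0 else (B $$ (i, 0) div d) * f 0) else 0))"
      using that by (intro sum.cong) (auto simp: L_def)
    also have "\<dots> = f i + (if i = 0 then 0 else (B $$ (i, 0) div d) * f 0)"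
      using that by (simp add: sum.distrib)
    finally show ?thesis .
  qed
  have R1: "(\<Sum>l<Suc n. f l * R $$ (l, j)) = f j + (if j = 0 then 0 else f 0 * (B $$ (0, j) div d))"
    if "j < Suc n" for j and f :: "nat \<Rightarrow> complex poly"
  proof -
    have "(\<Sum>l<Suc n. f l * R $$ (l, j)) =
       (\<Sum>l<Suc n. (if l = j then f j else 0) + (if l = 0 then (if j = 0 then 0 else f 0 * (B $$ (0, j) div d)) else 0))"
      using that by (intro sum.cong) (auto simp: R_def)
    also have "\<dots> = f j + (if j = 0 then 0 else f 0 * (B $$ (0, j) div d))"
      using that by (simp add: sum.distrib)
    finally show ?thesis .
  qed
  have LC: "(L * C) $$ (i, j) = C $$ (i, j) + (if i = 0 then 0 else (B $$ (i, 0) div d) * C $$ (0, j))"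
    if "i < Suc n" "j < Suc n" for i j
    unfolding mult_mat_entry[OF car(1) car(3) that] by (rule L1[OF that(1)])
  have "L * C * R = B"
  proof (rule eq_matI)
    fix i j assume ij: "i < dim_row B" "j < dim_col B"
    then have ij': "i < Suc n" "j < Suc n" using B by auto
    have "(L * C * R) $$ (i, j) = (\<Sum>l<Suc n. (L * C) $$ (i, l) * R $$ (l, j))"
      by (rule mult_mat_entry[OF mult_carrier_mat[OF car(1) car(3)] car(2) ij'])
    also have "\<dots> = (L * C) $$ (i, j) + (if j = 0 then 0 else (L * C) $$ (i, 0) * (B $$ (0, j) div d))"
      by (rule R1[OF ij'(2)])
    also have "\<dots> = B $$ (i, j)"
      unfolding LC[OF ij'] LC[OF ij'(1) zero_less_Suc]
      using ij' col[OF ij'(1)] row[OF ij'(2)] d0 by (auto simp: C_def d algebra_simps)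
    finally show "(L * C * R) $$ (i, j) = B $$ (i, j)" .
  qed (use B car in auto)
  then show ?thesis unfolding unimodular_equiv_def
    using car unimodular_unit_det[OF car(1) detL] unimodular_unit_det[OF car(2) detR] by metis
qed

text \<open>Take an entry of least degree among all nonzero entries of all equivalent matrices. Division with
remainder shows that it divides its row and column, so that these can be cleared. Adding another row to
the pivot row then keeps the pivot and puts an arbitrary entry into its row. Hence the pivot divides
every entry.\<close>

lemma unimodular_equiv_pivot:
  assumes A: "A \<in> carrier_mat (Suc n) (Suc n)" and nz: "A \<noteq> 0\<^sub>m (Suc n) (Suc n)"
  shows "\<exists>C. unimodular_equiv (Suc n) A C \<and> C $$ (0, 0) \<noteq> 0 \<and>
     (\<forall>i < Suc n. \<forall>j < Suc n. C $$ (0, 0) dvd C $$ (i, j)) \<and>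
     (\<forall>i < n. C $$ (Suc i, 0) = 0 \<and> C $$ (0, Suc i) = 0)"
proof -
  let ?N = "Suc n"
  define S where "S = (\<lambda>(B, i, j). unimodular_equiv ?N A B \<and> i < ?N \<and> j < ?N \<and> B $$ (i, j) \<noteq> 0)"
  obtain i0 j0 where "i0 < ?N" "j0 < ?N" "A $$ (i0, j0) \<noteq> 0"
    using A nz by (metis carrier_matD eq_matI index_zero_mat)
  then have "S (A, i0, j0)" using unimodular_equiv_refl[OF A] by (auto simp: S_def)
  then obtain x where x: "S x" "\<And>y. S y \<Longrightarrow> degree (fst x $$ snd x) \<le> degree (fst y $$ snd y)"
    using ex_has_least_nat[of S _ "\<lambda>y. degree (fst y $$ snd y)"] by metis
  obtain B i j where xB: "x = (B, i, j)" by (cases x) auto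
  define \<delta> where "\<delta> = degree (B $$ (i, j))"
  have AB: "unimodular_equiv ?N A B" and ij: "i < ?N" "j < ?N" and Bij: "B $$ (i, j) \<noteq> 0"
    using x(1) by (auto simp: S_def xB)
  have minimal: "\<delta> \<le> degree (B' $$ (i', j'))"
    if "unimodular_equiv ?N A B'" "i' < ?N" "j' < ?N" "B' $$ (i', j') \<noteq> 0" for B' i' j'
    using x(2)[of "(B', i', j')"] that by (simp add: xB \<delta>_def S_def)
  have colrow: "(\<forall>i'<?N. B' $$ (0, 0) dvd B' $$ (i', 0)) \<and> (\<forall>j'<?N. B' $$ (0, 0) dvd B' $$ (0, j'))"
    if AB': "unimodular_equiv ?N A B'" and nz': "B' $$ (0, 0) \<noteq> 0" and deg: "degree (B' $$ (0, 0)) = \<delta>" for B'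
  proof -
    have B': "B' \<in> carrier_mat ?N ?N" using AB' by (simp add: unimodular_equiv_def)
    have small: "B' $$ (0, 0) dvd y"
      if E: "\<And>q. \<exists>i'<?N. \<exists>j'<?N. \<exists>D. unimodular_equiv ?N B' D \<and> D $$ (i', j') = y - q * B' $$ (0, 0)" for y
    proof (rule ccontr)
      assume "\<not> B' $$ (0, 0) dvd y"
      then have m: "y mod B' $$ (0, 0) \<noteq> 0" by (simp add: dvd_eq_mod_eq_0)
      obtain i' j' D where D: "i' < ?N" "j' < ?N" "unimodular_equiv ?N B' D"
          "D $$ (i', j') = y - (y div B' $$ (0, 0)) * B' $$ (0, 0)"
        using E by blast
      then have "D $$ (i', j') = y mod B' $$ (0, 0)" by (simp add: minus_div_mult_eq_mod)
      then have "\<delta> \<le> degree (y mod B' $$ (0, 0))"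
        using minimal[OF unimodular_equiv_trans[OF AB' D(3)] D(1,2)] m by simp
      moreover have "degree (y mod B' $$ (0, 0)) < \<delta>"
        using degree_mod_less[OF nz', of y] m deg by simp
      ultimately show False by simp
    qed
    have "B' $$ (0, 0) dvd B' $$ (i', 0)" if i': "i' < ?N" for i'
    proof (cases "i' = 0")
      case False
      show ?thesis
      proof (rule small)
        fix q
        have "addrow (- q) i' 0 B' $$ (i', 0) = B' $$ (i', 0) - q * B' $$ (0, 0)"
          using B' i' False by simp
        then show "\<exists>i''<?N. \<exists>j'<?N. \<exists>D. unimodular_equiv ?N B' D \<and> D $$ (i'', j') = B' $$ (i', 0) - q * B' $$ (0, 0)"
          using unimodular_equiv_addrow[OF B' i', of 0 "- q"] i' False by blast
      qed
    qed simp
    moreover have "B' $$ (0, 0) dvd B' $$ (0, j')" if j': "j' < ?N" for j'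
    proof (cases "j' = 0")
      case False
      show ?thesis
      proof (rule small)
        fix q
        have "addcol (- q) j' 0 B' $$ (0, j') = B' $$ (0, j') - q * B' $$ (0, 0)"
          using B' j' False by simp
        then show "\<exists>i''<?N. \<exists>j''<?N. \<exists>D. unimodular_equiv ?N B' D \<and> D $$ (i'', j'') = B' $$ (0, j') - q * B' $$ (0, 0)"
          using unimodular_equiv_addcol[OF B' j', of 0 "- q"] j' False by blast
      qed
    qed simp
    ultimately show ?thesis by blast
  qed
  have B: "B \<in> carrier_mat ?N ?N" using AB by (simp add: unimodular_equiv_def)
  define B1 where "B1 = swapcols 0 j (swaprows 0 i B)"
  have "unimodular_equiv ?N B (swaprows 0 i B)" using unimodular_equiv_swaprows[OF B _ ij(1)] by simp
  moreover have "unimodular_equiv ?N (swaprows 0 i B) B1"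
    unfolding B1_def using B ij by (intro unimodular_equiv_swapcols) auto
  ultimately have AB1: "unimodular_equiv ?N A B1" using AB unimodular_equiv_trans by blast
  then have B1: "B1 \<in> carrier_mat ?N ?N" by (simp add: unimodular_equiv_def)
  have B100: "B1 $$ (0, 0) = B $$ (i, j)" using B ij by (auto simp: B1_def)
  define d where "d = B1 $$ (0, 0)"
  have d0: "d \<noteq> 0" and degd: "degree d = \<delta>" using Bij by (auto simp: d_def B100 \<delta>_def)
  define C where "C = mat ?N ?N (\<lambda>(i, j). if i = 0 \<and> j = 0 then d else
       if i = 0 \<or> j = 0 then 0 else B1 $$ (i, j) - (B1 $$ (i, 0) div d) * B1 $$ (0, j))"
  have "unimodular_equiv ?N B1 C"
    by (rule unimodular_equiv_clear[OF B1 d_def _ _ C_def d0])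
      (use colrow[OF AB1] d0 degd in \<open>auto simp: d_def\<close>)
  then have AC: "unimodular_equiv ?N A C" using AB1 unimodular_equiv_trans by blast
  have C: "C \<in> carrier_mat ?N ?N" by (simp add: C_def)
  have C00: "C $$ (0, 0) = d" by (simp add: C_def)
  have zero: "C $$ (Suc i, 0) = 0" "C $$ (0, Suc i) = 0" if "i < n" for i
    using that by (auto simp: C_def)
  have "C $$ (0, 0) dvd C $$ (i', j')" if ij': "i' < ?N" "j' < ?N" for i' j'
  proof (cases "i' = 0 \<or> j' = 0")
    case True
    then show ?thesis using that by (auto simp: C_def)
  next
    case False
    \<comment> \<open>Column \<open>0\<close> of \<open>C\<close> is already cleared, so this keeps the pivot in place.\<close>
    let ?D = "addrow 1 0 i' C"
    have AD: "unimodular_equiv ?N A ?D"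
      using unimodular_equiv_trans[OF AC unimodular_equiv_addrow[OF C, of 0 i' 1]] ij' False by simp
    have "i' = Suc (i' - 1)" using False by simp
    then have z: "C $$ (i', 0) = 0" "C $$ (0, j') = 0"
      using zero(1)[of "i' - 1"] zero(2)[of "j' - 1"] ij' False by auto
    then have D00: "?D $$ (0, 0) = d" using C C00 by simp
    have "?D $$ (0, j') = C $$ (i', j')" using C ij' z by simp
    then show ?thesis using colrow[OF AD] d0 degd ij' unfolding D00 C00 by metis
  qed
  then show ?thesis using AC d0 zero C00 by (intro exI[of _ C]) auto
qed

lemma four_block_diag_mult:
  fixes A :: "'a :: comm_ring_1 mat"
  assumes "A1 \<in> carrier_mat 1 1" "A \<in> carrier_mat n n" "B1 \<in> carrier_mat 1 1" "B \<in> carrier_mat n n"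
  shows "four_block_mat A1 (0\<^sub>m 1 n) (0\<^sub>m n 1) A * four_block_mat B1 (0\<^sub>m 1 n) (0\<^sub>m n 1) B =
    four_block_mat (A1 * B1) (0\<^sub>m 1 n) (0\<^sub>m n 1) (A * B)"
  using assms
  by (subst mult_four_block_mat[of _ 1 1 _ n _ n _ _ 1 _ n]) auto

text \<open>Splitting off the pivot leaves a matrix of which the pivot \<open>d\<close> divides all entries. Dividing by \<open>d\<close> before
the recursive step makes the divisibility chain automatic: the invariant polynomials are \<open>d\<close> and \<open>d\<close>
times those of the quotient.\<close>

lemma smith_form_exists:
  assumes "Q \<in> carrier_mat n n"
  shows "\<exists>E ds F. smith_form n Q E ds F"
  using assms
proof (induction n arbitrary: Q)
  case 0
  then show ?case
    by (intro exI[of _ "1\<^sub>m 0"] exI[of _ "[]"]) (auto simp: smith_form_def one_pCons intro!: exI[of _ 1])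
next
  case (Suc n)
  let ?N = "Suc n"
  show ?case
  proof (cases "Q = 0\<^sub>m ?N ?N")
    case True
    have "1\<^sub>m ?N * mat ?N ?N (\<lambda>(i, j). if i = j \<and> i < length [] then [] ! i else 0) * 1\<^sub>m ?N = Q"
      unfolding True by (simp, intro eq_matI) auto
    then show ?thesis
      by (intro exI[of _ "1\<^sub>m ?N"] exI[of _ "[]"]) (auto simp: smith_form_def one_pCons intro!: exI[of _ 1])
  next
    case False
    obtain C where QC: "unimodular_equiv ?N Q C" and c0: "C $$ (0, 0) \<noteq> 0"
      and dv: "\<And>i j. i < ?N \<Longrightarrow> j < ?N \<Longrightarrow> C $$ (0, 0) dvd C $$ (i, j)"
      and z: "\<And>i. i < n \<Longrightarrow> C $$ (Suc i, 0) = 0 \<and> C $$ (0, Suc i) = 0"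
      using unimodular_equiv_pivot[OF Suc.prems False] by blast
    obtain P R where PR: "unimodular ?N P" "unimodular ?N R" and Q: "Q = P * C * R"
        and C: "C \<in> carrier_mat ?N ?N"
      using QC by (auto simp: unimodular_equiv_def)
    define d where "d = C $$ (0, 0)"
    \<comment> \<open>The leading coefficient moves into the left factor, to make the pivot monic.\<close>
    define \<kappa> where "\<kappa> = lead_coeff d"
    define d' where "d' = smult (inverse \<kappa>) d"
    have \<kappa>: "\<kappa> \<noteq> 0" using c0 by (simp add: \<kappa>_def d_def)
    have d': "lead_coeff d' = 1" and dd': "d = [:\<kappa>:] * d'" using \<kappa> by (auto simp: d'_def \<kappa>_def)
    define B where "B = mat n n (\<lambda>(i, j). C $$ (Suc i, Suc j) div d)"
    have B: "B \<in> carrier_mat n n" by (simp add: B_def)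
    obtain E ds F where "smith_form n B E ds F" using Suc.IH[OF B] by blast
    then have E: "E \<in> carrier_mat n n" and F: "F \<in> carrier_mat n n"
      and dE: "\<exists>c. c \<noteq> 0 \<and> det E = [:c:]" and dF: "\<exists>c. c \<noteq> 0 \<and> det F = [:c:]"
      and len: "length ds \<le> n" and monic: "\<And>e. e \<in> set ds \<Longrightarrow> lead_coeff e = 1"
      and chain: "\<And>i. Suc i < length ds \<Longrightarrow> ds ! i dvd ds ! Suc i"
      and Beq: "B = E * mat n n (\<lambda>(i, j). if i = j \<and> i < length ds then ds ! i else 0) * F"
      by (auto simp: smith_form_def)
    define D where "D = mat n n (\<lambda>(i, j). if i = j \<and> i < length ds then ds ! i else 0)"
    have D: "D \<in> carrier_mat n n" by (simp add: D_def)
    define ds' where "ds' = d' # map ((*) d') ds"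
    define D' where "D' = mat ?N ?N (\<lambda>(i, j). if i = j \<and> i < length ds' then ds' ! i else 0)"
    define fb where "fb = (\<lambda>X :: complex poly mat. four_block_mat (1\<^sub>m 1) (0\<^sub>m 1 n) (0\<^sub>m n 1) X)"
    have fb: "X \<in> carrier_mat n n \<Longrightarrow> fb X \<in> carrier_mat ?N ?N" for X
      unfolding fb_def using four_block_carrier_mat[of "1\<^sub>m 1" 1 1 X n n] by simp
    have det_fb: "X \<in> carrier_mat n n \<Longrightarrow> det (fb X) = det X" for X
      unfolding fb_def by (subst det_four_block_mat_lower_left_zero[of _ 1 _ n]) auto
    have D'_eq: "D' = four_block_mat (mat 1 1 (\<lambda>_. d')) (0\<^sub>m 1 n) (0\<^sub>m n 1) (d' \<cdot>\<^sub>m D)"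
      by (rule eq_matI) (auto simp: D'_def D_def ds'_def nth_Cons' four_block_mat_def Let_def)
    have C_eq: "C = [:\<kappa>:] \<cdot>\<^sub>m four_block_mat (mat 1 1 (\<lambda>_. d')) (0\<^sub>m 1 n) (0\<^sub>m n 1) (d' \<cdot>\<^sub>m B)"
    proof (rule eq_matI)
      fix i j assume "i < dim_row ([:\<kappa>:] \<cdot>\<^sub>m four_block_mat (mat 1 1 (\<lambda>_. d')) (0\<^sub>m 1 n) (0\<^sub>m n 1) (d' \<cdot>\<^sub>m B))"
        "j < dim_col ([:\<kappa>:] \<cdot>\<^sub>m four_block_mat (mat 1 1 (\<lambda>_. d')) (0\<^sub>m 1 n) (0\<^sub>m n 1) (d' \<cdot>\<^sub>m B))"
      then have ij: "i < ?N" "j < ?N" by (auto simp: B_def)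
      show "C $$ (i, j) = ([:\<kappa>:] \<cdot>\<^sub>m four_block_mat (mat 1 1 (\<lambda>_. d')) (0\<^sub>m 1 n) (0\<^sub>m n 1) (d' \<cdot>\<^sub>m B)) $$ (i, j)"
      proof (cases "i = 0 \<or> j = 0")
        case True
        then show ?thesis using ij z[of "i - 1"] z[of "j - 1"] dd'
          by (cases i; cases j) (auto simp: d_def B_def)
      next
        case False
        then have "C $$ (i, j) = d * (C $$ (i, j) div d)" using dv[OF ij] by (simp add: d_def)
        then have "C $$ (i, j) = [:\<kappa>:] * (d' * (C $$ (i, j) div d))" unfolding dd' by (simp add: mult.assoc)
        then show ?thesis using False ij by (cases i; cases j) (auto simp: B_def)
      qed
    qed (use C in \<open>auto simp: B_def\<close>)
    have "four_block_mat (mat 1 1 (\<lambda>_. d')) (0\<^sub>m 1 n) (0\<^sub>m n 1) (d' \<cdot>\<^sub>m B) = fb E * D' * fb F"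
    proof -
      have "fb E * D' = four_block_mat (mat 1 1 (\<lambda>_. d')) (0\<^sub>m 1 n) (0\<^sub>m n 1) (E * (d' \<cdot>\<^sub>m D))"
        unfolding fb_def D'_eq using E D
        by (subst four_block_diag_mult) auto
      also have "\<dots> * fb F = four_block_mat (mat 1 1 (\<lambda>_. d')) (0\<^sub>m 1 n) (0\<^sub>m n 1) (E * (d' \<cdot>\<^sub>m D) * F)"
        unfolding fb_def using E D F
        by (subst four_block_diag_mult) auto
      also have "E * (d' \<cdot>\<^sub>m D) * F = d' \<cdot>\<^sub>m B"
        using E D F by (simp add: Beq D_def[symmetric] mult_smult_distrib[of E n n D] mult_smult_assoc_mat[of _ n n])
      finally show ?thesis by simp
    qed
    then have Ceq: "C = [:\<kappa>:] \<cdot>\<^sub>m (fb E * D' * fb F)" using C_eq by simp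
    have D': "D' \<in> carrier_mat ?N ?N" by (simp add: D'_def)
    have P: "P \<in> carrier_mat ?N ?N" and R: "R \<in> carrier_mat ?N ?N" using PR by (auto simp: unimodular_def)
    define E' where "E' = [:\<kappa>:] \<cdot>\<^sub>m (P * fb E)"
    define F' where "F' = fb F * R"
    have E'F': "E' \<in> carrier_mat ?N ?N" "F' \<in> carrier_mat ?N ?N"
      using P R fb[OF E] fb[OF F] by (auto simp: E'_def F'_def)
    have "Q = E' * D' * F'"
      unfolding Q Ceq E'_def F'_def using P R fb[OF E] fb[OF F] D'
      by (simp add: mult_smult_distrib[of P ?N ?N _ ?N] mult_smult_assoc_mat[of _ ?N ?N _ ?N] 
           assoc_mult_mat[of _ ?N ?N _ ?N _ ?N])
    moreover have "\<exists>c. c \<noteq> 0 \<and> det E' = [:c:]"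
    proof -
      obtain c1 c2 where c: "c1 \<noteq> 0" "det P = [:c1:]" "c2 \<noteq> 0" "det E = [:c2:]"
        using PR dE by (auto simp: unimodular_def)
      have "det E' = [:\<kappa>:] ^ ?N * ([:c1:] * [:c2:])"
        unfolding E'_def using P fb[OF E] c by (simp add: det_mult[OF P fb[OF E]] det_fb[OF E] carrier_matD(2)[OF fb[OF E]] del: power_Suc)
      also have "\<dots> = [:\<kappa> ^ ?N * (c1 * c2):]" by (simp add: pCons_one poly_const_pow)
      finally show ?thesis using c \<kappa> by (intro exI[of _ "\<kappa> ^ ?N * (c1 * c2)"]) auto
    qed
    moreover have "\<exists>c. c \<noteq> 0 \<and> det F' = [:c:]"
      unfolding F'_def using PR(2) dF R fb[OF F] by (fastforce simp: det_mult[OF fb[OF F] R] det_fb[OF F] unimodular_def)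
    moreover have "lead_coeff e = 1" if "e \<in> set ds'" for e
      using that d' monic by (auto simp: ds'_def lead_coeff_mult)
    moreover have "ds' ! i dvd ds' ! Suc i" if "Suc i < length ds'" for i
      using that chain by (cases i) (auto simp: ds'_def)
    ultimately have "smith_form ?N Q E' ds' F'"
      unfolding smith_form_def using E'F' len by (auto simp: ds'_def D'_def)
    then show ?thesis by blast
  qed
qed

lemma smith_form_det_zero_iff:
  assumes "smith_form n Q E ds F"
  shows "det Q = 0 \<longleftrightarrow> length ds < n"
proof -
  define D where "D = mat n n (\<lambda>(i, j). if i = j \<and> i < length ds then ds ! i else 0)"
  obtain e f where E: "E \<in> carrier_mat n n" and F: "F \<in> carrier_mat n n"
    and e: "e \<noteq> 0" "det E = [:e:]" and f: "f \<noteq> 0" "det F = [:f:]"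
    and len: "length ds \<le> n" and monic: "\<And>d. d \<in> set ds \<Longrightarrow> lead_coeff d = 1"
    and Q: "Q = E * D * F"
    using assms unfolding smith_form_def D_def by blast
  have D: "D \<in> carrier_mat n n" by (simp add: D_def)
  have "upper_triangular D" by (auto simp: D_def upper_triangular_def)
  from det_upper_triangular[OF this D]
  have detD: "det D = (\<Prod>i = 0..<n. D $$ (i, i))" unfolding prod_list_diag_prod using D by simp
  have diag: "D $$ (i, i) = 0 \<longleftrightarrow> length ds \<le> i" if i: "i < n" for i
  proof (cases "i < length ds")
    case True
    then have "ds ! i \<noteq> 0" using monic[of "ds ! i"] by auto
    then show ?thesis using True i by (simp add: D_def)
  qed (use i in \<open>simp add: D_def\<close>)
  have "det Q = 0 \<longleftrightarrow> det D = 0"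
    unfolding Q det_mult[OF mult_carrier_mat[OF E D] F] det_mult[OF E D] using e f by simp
  also have "\<dots> \<longleftrightarrow> (\<exists>i<n. length ds \<le> i)" unfolding detD using diag by auto
  also have "\<dots> \<longleftrightarrow> length ds < n" by auto
  finally show ?thesis .
qed


section \<open>Jordan chains and elementary divisors\<close>

lemma smult_one_mult_vec:
  assumes "X \<in> carrier_vec n"
  shows "(c \<cdot>\<^sub>m 1\<^sub>m n) *\<^sub>v X = (c :: 'a :: comm_ring_1) \<cdot>\<^sub>v X"
  using assms by (intro eq_vecI)
    (auto simp: scalar_prod_def if_distrib[of "\<lambda>x. x * _"] if_distrib[of "\<lambda>x. _ * x"] cong: if_cong)

text \<open>Let \<open>Q = E D F\<close> be a Smith form and \<open>y = F x\<close>. Multiplying with the adjugates of \<open>E\<close> and \<open>F\<close>, whose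
determinants are nonzero constants, shows that \<open>(\<lambda> - a)\<^sup>m\<close> divides \<open>D y\<close> and that \<open>y(a) \<noteq> 0\<close>. An index
\<open>i\<close> with \<open>y\<^sub>i(a) \<noteq> 0\<close> then gives \<open>(\<lambda> - a)\<^sup>m dvd d\<^sub>i\<close>. As \<open>det Q\<close> is nonzero, \<open>d\<^sub>i\<close> is a genuine
invariant polynomial and not one of the zeros.\<close>

lemma elementary_divisor_of_jordan_chain:
  fixes Q :: "complex poly mat" and x :: "nat \<Rightarrow> complex poly"
  assumes Q: "Q \<in> carrier_mat n n" and det: "det Q \<noteq> 0" and m: "m \<ge> 1"
    and chain: "\<And>i. i < n \<Longrightarrow> [:- a, 1:] ^ m dvd (\<Sum>j<n. Q $$ (i, j) * x j)"
    and start: "j < n" "poly (x j) a \<noteq> 0"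
  shows "\<exists>c\<ge>m. elementary_divisor n Q a c"
proof -
  obtain E ds F where smith: "smith_form n Q E ds F" using smith_form_exists[OF Q] by blast
  define D where "D = mat n n (\<lambda>(i, j). if i = j \<and> i < length ds then ds ! i else 0)"
  obtain e f where E: "E \<in> carrier_mat n n" and F: "F \<in> carrier_mat n n"
    and e: "e \<noteq> 0" "det E = [:e:]" and f: "f \<noteq> 0" "det F = [:f:]"
    and len: "length ds \<le> n" and monic: "\<And>d. d \<in> set ds \<Longrightarrow> lead_coeff d = 1"
    and Qeq: "Q = E * D * F"
    using smith unfolding smith_form_def D_def by blast
  have D: "D \<in> carrier_mat n n" by (simp add: D_def)
  have len_eq: "length ds = n" using smith_form_det_zero_iff[OF smith] det len by simp
  define X where "X = vec n x"
  have X: "X \<in> carrier_vec n" by (simp add: X_def)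
  define Y where "Y = F *\<^sub>v X"
  have Y: "Y \<in> carrier_vec n" unfolding Y_def by (rule mult_mat_vec_carrier[OF F X])
  have "\<exists>i<n. poly (Y $ i) a \<noteq> 0"
  proof (rule ccontr)
    assume "\<not> ?thesis"
    then have z: "\<And>i. i < n \<Longrightarrow> poly (Y $ i) a = 0" by blast
    note adj = adj_mat[OF F]
    have "adj_mat F *\<^sub>v Y = (adj_mat F * F) *\<^sub>v X"
      unfolding Y_def by (rule assoc_mult_mat_vec[symmetric, OF adj(1) F X])
    also have "\<dots> = [:f:] \<cdot>\<^sub>v X" unfolding adj(3) f(2) by (rule smult_one_mult_vec[OF X])
    finally have "(adj_mat F *\<^sub>v Y) $ j = [:f:] * x j" using start(1) by (simp add: X_def)
    moreover have "(adj_mat F *\<^sub>v Y) $ j = (\<Sum>i = 0..<n. adj_mat F $$ (j, i) * Y $ i)"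
      using adj(1) Y start(1) by (simp add: scalar_prod_def)
    ultimately have "[:f:] * x j = (\<Sum>i = 0..<n. adj_mat F $$ (j, i) * Y $ i)" by simp
    then have "poly ([:f:] * x j) a = poly (\<Sum>i = 0..<n. adj_mat F $$ (j, i) * Y $ i) a" by simp
    also have "\<dots> = 0" using z by (simp add: poly_sum)
    finally show False using f start by simp
  qed
  then obtain i where i: "i < n" "poly (Y $ i) a \<noteq> 0" by blast
  note adj = adj_mat[OF E]
  have QX: "Q *\<^sub>v X \<in> carrier_vec n" by (rule mult_mat_vec_carrier[OF Q X])
  have DY: "D *\<^sub>v Y \<in> carrier_vec n" by (rule mult_mat_vec_carrier[OF D Y])
  have "Q *\<^sub>v X = E *\<^sub>v (D *\<^sub>v Y)"
    unfolding Qeq Y_def assoc_mult_mat_vec[OF mult_carrier_mat[OF E D] F X]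
    by (rule assoc_mult_mat_vec[OF E D mult_mat_vec_carrier[OF F X]])
  then have "adj_mat E *\<^sub>v (Q *\<^sub>v X) = (adj_mat E * E) *\<^sub>v (D *\<^sub>v Y)"
    using assoc_mult_mat_vec[symmetric, OF adj(1) E DY] by simp
  also have "\<dots> = [:e:] \<cdot>\<^sub>v (D *\<^sub>v Y)"
    unfolding adj(3) e(2) by (rule smult_one_mult_vec[OF DY])
  finally have "[:e:] * (D *\<^sub>v Y) $ i = (adj_mat E *\<^sub>v (Q *\<^sub>v X)) $ i"
    by (simp only: index_smult_vec(1)[OF i(1)[folded carrier_vecD[OF DY]]])
  also have "\<dots> = (\<Sum>l<n. adj_mat E $$ (i, l) * (Q *\<^sub>v X) $ l)"
    by (rule mult_mat_vec_entry[OF adj(1) QX i(1)])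
  also have "[:- a, 1:] ^ m dvd \<dots>"
  proof (intro dvd_sum dvd_mult)
    fix l assume "l \<in> {..<n}"
    then have l: "l < n" by simp
    have "(Q *\<^sub>v X) $ l = (\<Sum>j<n. Q $$ (l, j) * x j)"
      unfolding mult_mat_vec_entry[OF Q X l] by (rule sum.cong) (auto simp: X_def)
    then show "[:- a, 1:] ^ m dvd (Q *\<^sub>v X) $ l" using chain[OF l] by simp
  qed
  finally have "[:- a, 1:] ^ m dvd (D *\<^sub>v Y) $ i" using e(1) by (simp add: dvd_smult_iff)
  also have "(D *\<^sub>v Y) $ i = (\<Sum>l<n. if l = i then ds ! i * Y $ i else 0)"
    unfolding mult_mat_vec_entry[OF D Y i(1)] by (rule sum.cong) (use i len_eq in \<open>auto simp: D_def\<close>)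
  also have "\<dots> = ds ! i * Y $ i" using i by simp
  finally have dv: "[:- a, 1:] ^ m dvd ds ! i * Y $ i" .
  have mem: "ds ! i \<in> set ds" using i len_eq by simp
  then have nz: "ds ! i \<noteq> 0" using monic[OF mem] by auto
  have Ynz: "Y $ i \<noteq> 0" using i by auto
  have "m \<le> order a (ds ! i * Y $ i)" using dv nz Ynz by (simp add: order_divides)
  also have "\<dots> = order a (ds ! i)" using nz Ynz i by (simp add: order_mult order_0I)
  finally have "order a (ds ! i) \<ge> m" .
  then show ?thesis unfolding elementary_divisor_def using smith mem m
    by (intro exI[of _ "order a (ds ! i)"]) auto
qed


section \<open>Determinants depending on parameters, and an inverse function theorem\<close>

text \<open>Determinants and cofactors are polynomial expressions in the entries. Whatever holds for the coefficients
of the entries and is inherited by sums and products holds for their coefficients too. This is applied to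
polynomial functions of a line parameter and to functions that are strictly differentiable at the origin.\<close>

definition function_algebra :: "('x \<Rightarrow> complex) set \<Rightarrow> bool" where
  "function_algebra \<F> \<longleftrightarrow> (\<forall>c. (\<lambda>_. c) \<in> \<F>) \<and>
     (\<forall>f\<in>\<F>. \<forall>g\<in>\<F>. (\<lambda>x. f x + g x) \<in> \<F> \<and> (\<lambda>x. f x * g x) \<in> \<F>)"

definition coeffs_in :: "('x \<Rightarrow> complex) set \<Rightarrow> ('x \<Rightarrow> complex poly) \<Rightarrow> bool" where
  "coeffs_in \<F> q \<longleftrightarrow> (\<forall>m. (\<lambda>x. coeff (q x) m) \<in> \<F>)"

lemma function_algebra_const: "function_algebra \<F> \<Longrightarrow> (\<lambda>_. c) \<in> \<F>"
  by (simp add: function_algebra_def)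

lemma function_algebra_add: "function_algebra \<F> \<Longrightarrow> f \<in> \<F> \<Longrightarrow> g \<in> \<F> \<Longrightarrow> (\<lambda>x. f x + g x) \<in> \<F>"
  by (simp add: function_algebra_def)

lemma function_algebra_mult: "function_algebra \<F> \<Longrightarrow> f \<in> \<F> \<Longrightarrow> g \<in> \<F> \<Longrightarrow> (\<lambda>x. f x * g x) \<in> \<F>"
  by (simp add: function_algebra_def)

lemma function_algebra_sum:
  assumes "function_algebra \<F>" "\<And>i. i \<in> I \<Longrightarrow> f i \<in> \<F>"
  shows "(\<lambda>x. \<Sum>i\<in>I. f i x) \<in> \<F>"
  using assms by (induction I rule: infinite_finite_induct) (auto simp: function_algebra_def)

lemma function_algebra_prod:
  assumes "function_algebra \<F>" "\<And>i. i \<in> I \<Longrightarrow> f i \<in> \<F>"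
  shows "(\<lambda>x. \<Prod>i\<in>I. f i x) \<in> \<F>"
  using assms by (induction I rule: infinite_finite_induct) (auto simp: function_algebra_def)

lemma function_algebra_det:
  assumes F: "function_algebra \<F>" and car: "\<And>x. A x \<in> carrier_mat n n"
    and entries: "\<And>i j. i < n \<Longrightarrow> j < n \<Longrightarrow> (\<lambda>x. A x $$ (i, j)) \<in> \<F>"
  shows "(\<lambda>x. det (A x)) \<in> \<F>"
  unfolding det_def'[OF car]
proof (rule function_algebra_sum[OF F])
  fix p assume p: "p \<in> {p. p permutes {0..<n}}"
  have "(\<lambda>x. \<Prod>i = 0..<n. A x $$ (i, p i)) \<in> \<F>"
  proof (rule function_algebra_prod[OF F])
    fix i assume "i \<in> {0..<n}"
    then show "(\<lambda>x. A x $$ (i, p i)) \<in> \<F>"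
      using p by (intro entries) (auto dest: permutes_in_image)
  qed
  then show "(\<lambda>x. signof p * (\<Prod>i = 0..<n. A x $$ (i, p i))) \<in> \<F>"
    by (intro function_algebra_mult[OF F] function_algebra_const[OF F])
qed

lemma coeffs_in_const: "function_algebra \<F> \<Longrightarrow> coeffs_in \<F> (\<lambda>_. c)"
  by (auto simp: coeffs_in_def function_algebra_def)

lemma coeffs_in_add: "function_algebra \<F> \<Longrightarrow> coeffs_in \<F> p \<Longrightarrow> coeffs_in \<F> q \<Longrightarrow> coeffs_in \<F> (\<lambda>x. p x + q x)"
  by (auto simp: coeffs_in_def function_algebra_def)

lemma coeffs_in_mult:
  assumes "function_algebra \<F>" "coeffs_in \<F> p" "coeffs_in \<F> q"
  shows "coeffs_in \<F> (\<lambda>x. p x * q x)"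
  unfolding coeffs_in_def coeff_mult
  using assms by (intro allI function_algebra_sum) (auto simp: coeffs_in_def function_algebra_def)

lemma coeffs_in_sum:
  assumes "function_algebra \<F>" "\<And>i. i \<in> I \<Longrightarrow> coeffs_in \<F> (f i)"
  shows "coeffs_in \<F> (\<lambda>x. \<Sum>i\<in>I. f i x)"
  using assms by (induction I rule: infinite_finite_induct) (auto intro: coeffs_in_const coeffs_in_add)

lemma coeffs_in_prod:
  assumes "function_algebra \<F>" "\<And>i. i \<in> I \<Longrightarrow> coeffs_in \<F> (f i)"
  shows "coeffs_in \<F> (\<lambda>x. \<Prod>i\<in>I. f i x)"
  using assms by (induction I rule: infinite_finite_induct) (auto intro: coeffs_in_const coeffs_in_mult)

lemma coeffs_in_det:
  assumes F: "function_algebra \<F>" and car: "\<And>x. A x \<in> carrier_mat n n"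
    and entries: "\<And>i j. i < n \<Longrightarrow> j < n \<Longrightarrow> coeffs_in \<F> (\<lambda>x. A x $$ (i, j))"
  shows "coeffs_in \<F> (\<lambda>x. det (A x))"
  unfolding det_def'[OF car]
proof (intro coeffs_in_sum[OF F] coeffs_in_mult[OF F] coeffs_in_const[OF F] coeffs_in_prod[OF F])
  fix p i assume "p \<in> {p. p permutes {0..<n}}" "i \<in> {0..<n}"
  then show "coeffs_in \<F> (\<lambda>x. A x $$ (i, p i))"
    by (intro entries) (auto simp: permutes_def dest: permutes_in_image)
qed

lemma coeffs_in_cofactor:
  assumes F: "function_algebra \<F>" and car: "\<And>x. A x \<in> carrier_mat n n"
    and entries: "\<And>i j. i < n \<Longrightarrow> j < n \<Longrightarrow> coeffs_in \<F> (\<lambda>x. A x $$ (i, j))"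
    and rs: "r < n" "s < n"
  shows "coeffs_in \<F> (\<lambda>x. cofactor (A x) r s)"
  unfolding cofactor_def
proof (intro coeffs_in_mult[OF F] coeffs_in_const[OF F] coeffs_in_det[OF F])
  show "mat_delete (A x) r s \<in> carrier_mat (n - 1) (n - 1)" for x
    using car by (rule mat_delete_carrier)
  fix i j assume ij: "i < n - 1" "j < n - 1"
  have "(\<lambda>x. mat_delete (A x) r s $$ (i, j)) =
    (\<lambda>x. A x $$ (if i < r then i else Suc i, if j < s then j else Suc j))"
    using ij carrier_matD[OF car] by (auto simp: mat_delete_def)
  then show "coeffs_in \<F> (\<lambda>x. mat_delete (A x) r s $$ (i, j))"
    using ij entries by simp
qed

lemma poly_in_of_coeffs_in:
  assumes F: "function_algebra \<F>" and c: "coeffs_in \<F> q" and d: "\<And>x. degree (q x) \<le> d"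
  shows "(\<lambda>x. poly (q x) a) \<in> \<F>"
proof -
  have "poly (q x) a = (\<Sum>m\<le>d. coeff (q x) m * a ^ m)" for x
    by (rule poly_altdef[THEN trans]) (use d[of x] in \<open>auto intro!: sum.mono_neutral_left intro: le_degree\<close>)
  moreover have "(\<lambda>x. \<Sum>m\<le>d. coeff (q x) m * a ^ m) \<in> \<F>"
    using F c by (intro function_algebra_sum) (auto simp: function_algebra_def coeffs_in_def)
  ultimately show ?thesis by simp
qed

text \<open>The determinant is affine in each entry, and its slope is the cofactor.\<close>

lemma det_add_diagonal_entry:
  fixes A :: "'a :: comm_ring_1 mat"
  assumes A: "A \<in> carrier_mat n n" and B: "B \<in> carrier_mat n n" and r: "r < n"
    and eq: "\<And>i j. i < n \<Longrightarrow> j < n \<Longrightarrow> B $$ (i, j) = A $$ (i, j) + (if i = r \<and> j = r then c else 0)"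
  shows "det B = det A + c * cofactor A r r"
proof -
  have cof: "cofactor B i r = cofactor A i r" if "i < n" for i
  proof -
    have "mat_delete B i r = mat_delete A i r"
      using A B eq by (intro eq_matI) (auto simp: mat_delete_def)
    then show ?thesis by (simp add: cofactor_def)
  qed
  have "det B = (\<Sum>i<n. B $$ (i, r) * cofactor B i r)" by (rule laplace_expansion_column[OF B r])
  also have "\<dots> = (\<Sum>i<n. A $$ (i, r) * cofactor A i r + (if i = r then c * cofactor A r r else 0))"
    using eq r cof by (intro sum.cong) (auto simp: algebra_simps)
  also have "\<dots> = (\<Sum>i<n. A $$ (i, r) * cofactor A i r) + c * cofactor A r r"
    using r by (simp add: sum.distrib)
  also have "(\<Sum>i<n. A $$ (i, r) * cofactor A i r) = det A" by (rule laplace_expansion_column[OF A r, symmetric])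
  finally show ?thesis .
qed

text \<open>The filter of pairs \<open>(w, w')\<close> whose coordinates with index at most \<open>N\<close> tend to \<open>0\<close>. Points of
\<open>\<complex>\<^sup>N\<^sup>+\<^sup>1\<close> are encoded as functions on the naturals, so that \<open>N\<close> can vary.\<close>

definition small_pairs :: "nat \<Rightarrow> ((nat \<Rightarrow> complex) \<times> (nat \<Rightarrow> complex)) filter" where
  "small_pairs N = (INF \<rho>\<in>{0<..}. principal {(w, w'). \<forall>m\<le>N. cmod (w m) \<le> \<rho> \<and> cmod (w' m) \<le> \<rho>})"

lemma eventually_small_pairs:
  "eventually P (small_pairs N) \<longleftrightarrow>
     (\<exists>\<rho>>0. \<forall>w w'. (\<forall>m\<le>N. cmod (w m) \<le> \<rho> \<and> cmod (w' m) \<le> \<rho>) \<longrightarrow> P (w, w'))"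
proof -
  have "eventually P (small_pairs N) \<longleftrightarrow>
     (\<exists>\<rho>\<in>{0<..}. eventually P (principal {(w, w'). \<forall>m\<le>N. cmod (w m) \<le> \<rho> \<and> cmod (w' m) \<le> \<rho>}))"
    unfolding small_pairs_def
  proof (rule eventually_INF_base)
    fix a b :: real assume "a \<in> {0<..}" "b \<in> {0<..}"
    then show "\<exists>x\<in>{0<..}. principal {(w, w'). \<forall>m\<le>N. cmod (w m) \<le> x \<and> cmod (w' m) \<le> x}
         \<le> inf (principal {(w, w'). \<forall>m\<le>N. cmod (w m) \<le> a \<and> cmod (w' m) \<le> a})
               (principal {(w, w'). \<forall>m\<le>N. cmod (w m) \<le> b \<and> cmod (w' m) \<le> b})"
      by (intro bexI[of _ "min a b"]) auto
  qed auto
  then show ?thesis by (auto simp: eventually_principal)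
qed

text \<open>Strict differentiability at the origin, in Hadamard's form: the difference of two values is a combination
of the coordinate differences with coefficients that converge as both points tend to the origin. In this
form the product rule only uses limits of products. The first conjunct is continuity at the origin.\<close>

definition strictly_differentiable :: "nat \<Rightarrow> ((nat \<Rightarrow> complex) \<Rightarrow> complex) set" where
  "strictly_differentiable N = {h.
     (\<exists>c. ((\<lambda>(w, w'). h w) \<longlongrightarrow> c) (small_pairs N) \<and> ((\<lambda>(w, w'). h w') \<longlongrightarrow> c) (small_pairs N)) \<and>
     (\<exists>g L. (\<forall>w w'. h w - h w' = (\<Sum>m\<le>N. (w m - w' m) * g m w w')) \<and>
            (\<forall>m\<le>N. ((\<lambda>(w, w'). g m w w') \<longlongrightarrow> L m) (small_pairs N)))}"

lemma function_algebra_strictly_differentiable: "function_algebra (strictly_differentiable N)"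
  unfolding function_algebra_def
proof (intro conjI allI ballI)
  show "(\<lambda>_. c) \<in> strictly_differentiable N" for c
    unfolding strictly_differentiable_def
    by (auto simp: split_def intro!: exI[of _ "\<lambda>_ _ _. 0"] exI[of _ "\<lambda>_. 0"] exI[of _ c])
  fix h h' :: "(nat \<Rightarrow> complex) \<Rightarrow> complex"
  assume "h \<in> strictly_differentiable N" "h' \<in> strictly_differentiable N"
  then obtain c g L c' g' L'
    where c: "((\<lambda>(w, w'). h w) \<longlongrightarrow> c) (small_pairs N)" "((\<lambda>(w, w'). h w') \<longlongrightarrow> c) (small_pairs N)"
      and g: "\<And>w w'. h w - h w' = (\<Sum>m\<le>N. (w m - w' m) * g m w w')"
      and L: "\<And>m. m \<le> N \<Longrightarrow> ((\<lambda>(w, w'). g m w w') \<longlongrightarrow> L m) (small_pairs N)"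
      and c': "((\<lambda>(w, w'). h' w) \<longlongrightarrow> c') (small_pairs N)" "((\<lambda>(w, w'). h' w') \<longlongrightarrow> c') (small_pairs N)"
      and g': "\<And>w w'. h' w - h' w' = (\<Sum>m\<le>N. (w m - w' m) * g' m w w')"
      and L': "\<And>m. m \<le> N \<Longrightarrow> ((\<lambda>(w, w'). g' m w w') \<longlongrightarrow> L' m) (small_pairs N)"
    unfolding strictly_differentiable_def by blast
  have "(h w + h' w) - (h w' + h' w') = (\<Sum>m\<le>N. (w m - w' m) * (g m w w' + g' m w w'))" for w w'
  proof -
    have "(h w + h' w) - (h w' + h' w') = (\<Sum>m\<le>N. (w m - w' m) * g m w w') + (\<Sum>m\<le>N. (w m - w' m) * g' m w w')"
      unfolding g[symmetric] g'[symmetric] by simp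
    then show ?thesis by (simp only: distrib_left sum.distrib)
  qed
  moreover have "((\<lambda>(w, w'). g m w w' + g' m w w') \<longlongrightarrow> L m + L' m) (small_pairs N)" if "m \<le> N" for m
    using tendsto_add[OF L[OF that] L'[OF that]] by (simp add: case_prod_beta')
  moreover have "((\<lambda>(w, w'). h w + h' w) \<longlongrightarrow> c + c') (small_pairs N)"
    "((\<lambda>(w, w'). h w' + h' w') \<longlongrightarrow> c + c') (small_pairs N)"
    using tendsto_add[OF c(1) c'(1)] tendsto_add[OF c(2) c'(2)] by (simp_all add: case_prod_beta')
  ultimately show "(\<lambda>x. h x + h' x) \<in> strictly_differentiable N"
    unfolding strictly_differentiable_def mem_Collect_eq
    by (intro conjI exI[of _ "c + c'"] exI[of _ "\<lambda>m w w'. g m w w' + g' m w w'"] exI[of _ "\<lambda>m. L m + L' m"]) auto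
  have "h w * h' w - h w' * h' w' = (\<Sum>m\<le>N. (w m - w' m) * (g m w w' * h' w + h w' * g' m w w'))" for w w'
  proof -
    have "h w * h' w - h w' * h' w' = (h w - h w') * h' w + h w' * (h' w - h' w')"
      by (simp add: algebra_simps)
    also have "\<dots> = (\<Sum>m\<le>N. (w m - w' m) * (g m w w' * h' w)) + (\<Sum>m\<le>N. (w m - w' m) * (h w' * g' m w w'))"
      unfolding g g' sum_distrib_left sum_distrib_right by (simp add: mult_ac)
    finally show ?thesis by (simp only: distrib_left sum.distrib)
  qed
  moreover have "((\<lambda>(w, w'). g m w w' * h' w + h w' * g' m w w') \<longlongrightarrow> L m * c' + c * L' m) (small_pairs N)"
    if "m \<le> N" for m
    using tendsto_add[OF tendsto_mult[OF L[OF that] c'(1)] tendsto_mult[OF c(2) L'[OF that]]]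
    by (simp add: case_prod_beta')
  moreover have "((\<lambda>(w, w'). h w * h' w) \<longlongrightarrow> c * c') (small_pairs N)"
    "((\<lambda>(w, w'). h w' * h' w') \<longlongrightarrow> c * c') (small_pairs N)"
    using tendsto_mult[OF c(1) c'(1)] tendsto_mult[OF c(2) c'(2)] by (simp_all add: case_prod_beta')
  ultimately show "(\<lambda>x. h x * h' x) \<in> strictly_differentiable N"
    unfolding strictly_differentiable_def mem_Collect_eq
    by (intro conjI exI[of _ "c * c'"] exI[of _ "\<lambda>m w w'. g m w w' * h' w + h w' * g' m w w'"]
        exI[of _ "\<lambda>m. L m * c' + c * L' m"]) auto
qed

lemma tendsto_small_pairs_coordinate:
  assumes "m \<le> N"
  shows "((\<lambda>(w, w'). w m) \<longlongrightarrow> 0) (small_pairs N)" "((\<lambda>(w, w'). w' m) \<longlongrightarrow> 0) (small_pairs N)"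
proof -
  have "eventually (\<lambda>(w, w'). cmod (w m) < e \<and> cmod (w' m) < e) (small_pairs N)" if "e > 0" for e
    unfolding eventually_small_pairs using that assms by (intro exI[of _ "e / 2"]) force
  then show "((\<lambda>(w, w'). w m) \<longlongrightarrow> 0) (small_pairs N)" "((\<lambda>(w, w'). w' m) \<longlongrightarrow> 0) (small_pairs N)"
    unfolding tendsto_iff dist_norm split_def diff_zero by (blast intro: eventually_mono)+
qed

lemma coordinate_strictly_differentiable:
  assumes "m \<le> N"
  shows "(\<lambda>w. w m) \<in> strictly_differentiable N"
proof -
  have "w m - w' m = (\<Sum>l\<le>N. (w l - w' l) * (if l = m then 1 else 0))" for w w' :: "nat \<Rightarrow> complex"
    using assms by (simp add: if_distrib[of "\<lambda>x. _ * x"] cong: if_cong)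
  then show ?thesis
    unfolding strictly_differentiable_def mem_Collect_eq using tendsto_small_pairs_coordinate[OF assms]
    by (intro conjI exI[of _ 0] exI[of _ "\<lambda>l _ _. if l = m then 1 else 0"] exI[of _ "\<lambda>l. if l = m then 1 else 0"])
       (auto simp: split_def)
qed

text \<open>The inverse function theorem for a map with invertible Jacobian \<open>J\<close> at the origin, \<open>K\<close> being its inverse.
The simplified Newton map \<open>w \<mapsto> w - K (h(w) - y)\<close> has derivative \<open>0\<close> at the origin and is therefore a
contraction with factor \<open>1/2\<close> on a small ball, uniformly in \<open>y\<close>.\<close>

lemma strictly_differentiable_local_inverse:
  fixes h :: "nat \<Rightarrow> (nat \<Rightarrow> complex) \<Rightarrow> complex"
    and g :: "nat \<Rightarrow> nat \<Rightarrow> (nat \<Rightarrow> complex) \<Rightarrow> (nat \<Rightarrow> complex) \<Rightarrow> complex"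
    and J K :: "nat \<Rightarrow> nat \<Rightarrow> complex"
  assumes g: "\<And>p w w'. p \<le> N \<Longrightarrow> h p w - h p w' = (\<Sum>m\<le>N. (w m - w' m) * g p m w w')"
    and lim: "\<And>p m. p \<le> N \<Longrightarrow> m \<le> N \<Longrightarrow> ((\<lambda>(w, w'). g p m w w') \<longlongrightarrow> J p m) (small_pairs N)"
    and h0: "\<And>p. p \<le> N \<Longrightarrow> h p (\<lambda>_. 0) = 0"
    and KJ: "\<And>p q. p \<le> N \<Longrightarrow> q \<le> N \<Longrightarrow> (\<Sum>m\<le>N. K p m * J m q) = (if p = q then 1 else 0)"
    and JK: "\<And>p q. p \<le> N \<Longrightarrow> q \<le> N \<Longrightarrow> (\<Sum>m\<le>N. J p m * K m q) = (if p = q then 1 else 0)"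
    and \<epsilon>: "\<epsilon> > 0"
  shows "\<exists>\<delta>>0. \<forall>y. (\<forall>p\<le>N. cmod (y p) \<le> \<delta>) \<longrightarrow> (\<exists>w. (\<forall>m\<le>N. cmod (w m) \<le> \<epsilon>) \<and> (\<forall>p\<le>N. h p w = y p))"
proof -
  \<comment> \<open>Coefficients of size \<open>\<eta>\<close> in each of the \<open>N + 1\<close> coordinates add up to the contraction factor \<open>1/2\<close>.\<close>
  define \<eta> where "\<eta> = 1 / (2 * real (Suc N))"
  have \<eta>: "\<eta> > 0" by (simp add: \<eta>_def)
  have ev: "eventually (\<lambda>(w, w'). cmod ((\<Sum>q\<le>N. K p q * g q m w w') - (if p = m then 1 else 0)) < \<eta>) (small_pairs N)"
    if pm: "p \<le> N" "m \<le> N" for p m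
  proof -
    have "((\<lambda>z. \<Sum>q\<le>N. K p q * (case z of (w, w') \<Rightarrow> g q m w w')) \<longlongrightarrow> (\<Sum>q\<le>N. K p q * J q m)) (small_pairs N)"
      by (intro tendsto_sum tendsto_mult[OF tendsto_const] lim pm) simp
    then have "((\<lambda>z. \<Sum>q\<le>N. K p q * (case z of (w, w') \<Rightarrow> g q m w w')) \<longlongrightarrow> (if p = m then 1 else 0)) (small_pairs N)"
      using KJ[OF pm] by simp
    from tendstoD[OF this \<eta>] show ?thesis by (simp add: dist_norm case_prod_beta')
  qed
  have "eventually (\<lambda>z. \<forall>p\<in>{..N}. \<forall>m\<in>{..N}. case z of (w, w') \<Rightarrow>
      cmod ((\<Sum>q\<le>N. K p q * g q m w w') - (if p = m then 1 else 0)) < \<eta>) (small_pairs N)"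
    by (intro eventually_ball_finite finite_atMost ballI, rule ev) simp_all
  then obtain \<rho> where \<rho>: "\<rho> > 0"
    and close': "\<forall>w w'. (\<forall>m\<le>N. cmod (w m) \<le> \<rho> \<and> cmod (w' m) \<le> \<rho>) \<longrightarrow> (\<forall>p\<in>{..N}. \<forall>m\<in>{..N}.
        cmod ((\<Sum>q\<le>N. K p q * g q m w w') - (if p = m then 1 else 0)) < \<eta>)"
    unfolding eventually_small_pairs prod.case by blast
  have close: "cmod ((\<Sum>q\<le>N. K p q * g q m w w') - (if p = m then 1 else 0)) < \<eta>"
    if "\<And>m. m \<le> N \<Longrightarrow> cmod (w m) \<le> \<rho> \<and> cmod (w' m) \<le> \<rho>" "p \<le> N" "m \<le> N" for w w' p m
    using close' that by simp
  define R where "R = min \<rho> \<epsilon>"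
  have R: "R > 0" "R \<le> \<rho>" "R \<le> \<epsilon>" using \<rho> \<epsilon> by (auto simp: R_def)
  define B where "B = (\<Sum>p\<le>N. \<Sum>q\<le>N. cmod (K p q)) + 1"
  have B: "B \<ge> 1" unfolding B_def by (simp add: sum_nonneg)
  have row: "(\<Sum>q\<le>N. cmod (K p q)) \<le> B" if "p \<le> N" for p
  proof -
    have "(\<Sum>q\<le>N. cmod (K p q)) \<le> (\<Sum>p\<le>N. \<Sum>q\<le>N. cmod (K p q))"
      by (rule member_le_sum[of p]) (use that in \<open>auto intro: sum_nonneg\<close>)
    then show ?thesis by (simp add: B_def)
  qed
  show ?thesis
  \<comment> \<open>For such \<open>y\<close> the first Newton step \<open>K y\<close> has coordinates at most \<open>R / 2\<close>, which leaves room for the remaining steps.\<close>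
  proof (intro exI[of _ "R / (2 * B)"] conjI allI impI)
    show "R / (2 * B) > 0" using R B by simp
    fix y :: "nat \<Rightarrow> complex" assume y: "\<forall>p\<le>N. cmod (y p) \<le> R / (2 * B)"
    define \<Phi> where "\<Phi> = (\<lambda>w p. w p - (\<Sum>q\<le>N. K p q * (h q w - y q)))"
    have contr: "cmod (\<Phi> w p - \<Phi> w' p) \<le> \<eta> * (\<Sum>m\<le>N. cmod (w m - w' m))"
      if p: "p \<le> N" and w: "\<And>m. m \<le> N \<Longrightarrow> cmod (w m) \<le> R" and w': "\<And>m. m \<le> N \<Longrightarrow> cmod (w' m) \<le> R" for p w w'
    proof -
      have "\<Phi> w p - \<Phi> w' p = (w p - w' p) - (\<Sum>q\<le>N. K p q * (h q w - h q w'))"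
        by (simp add: \<Phi>_def algebra_simps sum_subtractf[symmetric] sum.distrib[symmetric])
      also have "(\<Sum>q\<le>N. K p q * (h q w - h q w')) = (\<Sum>q\<le>N. \<Sum>m\<le>N. (w m - w' m) * (K p q * g q m w w'))"
        by (intro sum.cong refl) (simp add: g sum_distrib_left mult_ac)
      also have "\<dots> = (\<Sum>m\<le>N. (w m - w' m) * (\<Sum>q\<le>N. K p q * g q m w w'))"
        by (subst sum.swap) (simp add: sum_distrib_left)
      also have "w p - w' p = (\<Sum>m\<le>N. (w m - w' m) * (if p = m then 1 else 0))"
        using p by (simp add: if_distrib[of "\<lambda>x. _ * x"] cong: if_cong)
      finally have "\<Phi> w p - \<Phi> w' p =
          (\<Sum>m\<le>N. - ((w m - w' m) * ((\<Sum>q\<le>N. K p q * g q m w w') - (if p = m then 1 else 0))))"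
        unfolding sum_subtractf[symmetric] right_diff_distrib[symmetric] sum_negf[symmetric]
        by (simp add: sum_subtractf right_diff_distrib)
      also have "cmod \<dots> \<le> (\<Sum>m\<le>N. cmod (w m - w' m) * \<eta>)"
      proof (rule sum_norm_le)
        fix m assume "m \<in> {..N}"
        then have "cmod ((\<Sum>q\<le>N. K p q * g q m w w') - (if p = m then 1 else 0)) < \<eta>"
          using close[of w w' p m] w w' R p by force
        then show "cmod (- ((w m - w' m) * ((\<Sum>q\<le>N. K p q * g q m w w') - (if p = m then 1 else 0))))
            \<le> cmod (w m - w' m) * \<eta>"
          by (auto simp: norm_mult intro!: mult_left_mono)
      qed
      also have "\<dots> = \<eta> * (\<Sum>m\<le>N. cmod (w m - w' m))" by (simp add: sum_distrib_right[symmetric])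
      finally show ?thesis .
    qed
    define s where "s = rec_nat (\<lambda>_. 0) (\<lambda>_. \<Phi>)"
    have s0: "s 0 = (\<lambda>_. 0)" and sS: "s (Suc i) = \<Phi> (s i)" for i by (simp_all add: s_def)
    have inv: "(\<forall>p\<le>N. cmod (s i p) \<le> R * (1 - 1 / 2 ^ i)) \<and> (\<forall>p\<le>N. cmod (s (Suc i) p - s i p) \<le> R / 2 ^ Suc i)" for i
    proof (induction i)
      case 0
      have "cmod (s (Suc 0) p - s 0 p) \<le> R / 2" if p: "p \<le> N" for p
      proof -
        have "s (Suc 0) p - s 0 p = (\<Sum>q\<le>N. K p q * y q)"
          using h0 by (simp add: sS s0 \<Phi>_def sum_negf)
        also have "cmod \<dots> \<le> (\<Sum>q\<le>N. cmod (K p q) * (R / (2 * B)))"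
          using y by (intro sum_norm_le) (simp only: norm_mult mult_left_mono norm_ge_zero atMost_iff)
        also have "\<dots> = (\<Sum>q\<le>N. cmod (K p q)) * (R / (2 * B))" by (rule sum_distrib_right[symmetric])
        also have "\<dots> \<le> B * (R / (2 * B))" using row[OF p] R B by (intro mult_right_mono) auto
        also have "\<dots> = R / 2" using B by simp
        finally show ?thesis .
      qed
      then show ?case by (simp add: s0)
    next
      case (Suc i)
      have b: "cmod (s (Suc i) p) \<le> R * (1 - 1 / 2 ^ Suc i)" if p: "p \<le> N" for p
      proof -
        have "cmod (s (Suc i) p) \<le> cmod (s i p) + cmod (s (Suc i) p - s i p)"
          by (metis norm_triangle_sub)
        also have "\<dots> \<le> R * (1 - 1 / 2 ^ i) + R / 2 ^ Suc i" using Suc.IH p by (intro add_mono) auto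
        also have "\<dots> = R * (1 - 1 / 2 ^ Suc i)" by (simp add: field_simps)
        finally show ?thesis .
      qed
      have le: "R * (1 - 1 / 2 ^ j) \<le> R" for j :: nat using R by (simp add: field_simps)
      have "cmod (s (Suc (Suc i)) p - s (Suc i) p) \<le> R / 2 ^ Suc (Suc i)" if p: "p \<le> N" for p
      proof -
        have "cmod (\<Phi> (s (Suc i)) p - \<Phi> (s i) p) \<le> \<eta> * (\<Sum>m\<le>N. cmod (s (Suc i) m - s i m))"
          using b Suc.IH le by (intro contr p) (meson order_trans)+
        also have "\<dots> \<le> \<eta> * (\<Sum>m\<le>N. R / 2 ^ Suc i)"
          using Suc.IH \<eta> by (intro mult_left_mono sum_mono) auto
        also have "\<dots> = (\<eta> * real (Suc N)) * (R / 2 ^ Suc i)" by simp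
        also have "\<eta> * real (Suc N) = 1 / 2" unfolding \<eta>_def by (simp only: times_divide_eq_left) simp
        also have "1 / 2 * (R / 2 ^ Suc i) = R / 2 ^ Suc (Suc i)" by simp
        finally show ?thesis by (simp only: sS)
      qed
      then show ?case using b by blast
    qed
    have bound: "cmod (s i p) \<le> R" if "p \<le> N" for i p
    proof -
      have "cmod (s i p) \<le> R * (1 - 1 / 2 ^ i)" using inv that by blast
      also have "\<dots> \<le> R" using R by (simp add: field_simps)
      finally show ?thesis .
    qed
    have "convergent (\<lambda>i. s i p)" if p: "p \<le> N" for p
    proof -
      have "summable (\<lambda>i. s (Suc i) p - s i p)"
      proof (rule summable_comparison_test)
        show "\<exists>M. \<forall>i\<ge>M. cmod (s (Suc i) p - s i p) \<le> R * (1 / 2) ^ Suc i"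
          using inv p by (auto simp: power_divide)
        show "summable (\<lambda>i. R * (1 / 2) ^ Suc i :: real)"
          unfolding power_Suc by (intro summable_mult summable_geometric) simp
      qed
      then have "convergent (\<lambda>i. \<Sum>j<i. s (Suc j) p - s j p)" by (simp add: summable_iff_convergent)
      also have "(\<lambda>i. \<Sum>j<i. s (Suc j) p - s j p) = (\<lambda>i. s i p)"
        by (subst sum_lessThan_telescope) (simp add: s0)
      finally show ?thesis .
    qed
    then obtain w where w: "\<And>p. p \<le> N \<Longrightarrow> (\<lambda>i. s i p) \<longlonglongrightarrow> w p"
      unfolding convergent_def by metis
    have wR: "cmod (w p) \<le> R" if "p \<le> N" for p
      using tendsto_norm[OF w[OF that]] bound[OF that] by (intro LIMSEQ_le_const2) auto
    have fix_pt: "\<Phi> w p = w p" if p: "p \<le> N" for p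
    proof (rule LIMSEQ_unique)
      show "(\<lambda>i. s (Suc i) p) \<longlonglongrightarrow> w p" using w[OF p] by (rule LIMSEQ_Suc)
      have "(\<lambda>i. \<eta> * (\<Sum>m\<le>N. cmod (s i m - w m))) \<longlonglongrightarrow> \<eta> * (\<Sum>m\<le>N. cmod (w m - w m))"
        using w by (intro tendsto_intros) auto
      then have "(\<lambda>i. \<eta> * (\<Sum>m\<le>N. cmod (s i m - w m))) \<longlonglongrightarrow> 0" by simp
      then have "(\<lambda>i. \<Phi> (s i) p - \<Phi> w p) \<longlonglongrightarrow> 0"
        by (rule tendsto_0_le[where K = 1]) (auto intro!: always_eventually contr[THEN order_trans] p bound wR)
      then show "(\<lambda>i. s (Suc i) p) \<longlonglongrightarrow> \<Phi> w p" unfolding sS by (simp add: LIM_zero_iff)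
    qed
    have z: "(\<Sum>q\<le>N. K p q * (h q w - y q)) = 0" if "p \<le> N" for p
      using fix_pt[OF that] by (simp add: \<Phi>_def)
    have "h p w = y p" if p: "p \<le> N" for p
    proof -
      have "0 = (\<Sum>m\<le>N. J p m * (\<Sum>q\<le>N. K m q * (h q w - y q)))" using z by simp
      also have "\<dots> = (\<Sum>q\<le>N. (\<Sum>m\<le>N. J p m * K m q) * (h q w - y q))"
        by (simp add: sum_distrib_left sum_distrib_right mult.assoc) (rule sum.swap)
      also have "\<dots> = (\<Sum>q\<le>N. (if p = q then 1 else 0) * (h q w - y q))" using JK p by simp
      also have "\<dots> = h p w - y p" using p by (simp add: if_distrib[of "\<lambda>x. x * _"] cong: if_cong)
      finally show ?thesis by simp
    qed
    then show "\<exists>w. (\<forall>m\<le>N. cmod (w m) \<le> \<epsilon>) \<and> (\<forall>p\<le>N. h p w = y p)"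
      using wR R by (intro exI[of _ w]) force
  qed
qed


section \<open>Prescribing the determinant near a singular matrix\<close>

text \<open>The limit in the definition is the value at the origin, because all neighbourhoods in the filter contain
the pair of two origins.\<close>

lemma strictly_differentiable_nonzero_near:
  assumes h: "h \<in> strictly_differentiable N" and nz: "h (\<lambda>_. 0) \<noteq> 0"
  shows "\<exists>\<rho>>0. \<forall>w. (\<forall>m\<le>N. cmod (w m) \<le> \<rho>) \<longrightarrow> h w \<noteq> 0"
proof -
  obtain c where c: "((\<lambda>(w, w'). h w) \<longlongrightarrow> c) (small_pairs N)"
    using h unfolding strictly_differentiable_def by blast
  have near: "\<exists>\<rho>>0. \<forall>w. (\<forall>m\<le>N. cmod (w m) \<le> \<rho>) \<longrightarrow> dist (h w) c < e" if e: "e > 0" for e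
  proof -
    obtain \<rho> where "\<rho> > 0" "\<forall>w w'. (\<forall>m\<le>N. cmod (w m) \<le> \<rho> \<and> cmod (w' m) \<le> \<rho>) \<longrightarrow> dist (h w) c < e"
      using tendstoD[OF c e] unfolding eventually_small_pairs prod.case by blast
    then show ?thesis by (intro exI[of _ \<rho>] conjI allI impI) auto
  qed
  have "dist (h (\<lambda>_. 0)) c < e" if e: "e > 0" for e
  proof -
    obtain \<rho> where \<rho>: "\<rho> > 0" "\<forall>w. (\<forall>m\<le>N. cmod (w m) \<le> \<rho>) \<longrightarrow> dist (h w) c < e"
      using near[OF e] by blast
    show ?thesis by (rule \<rho>(2)[THEN spec, THEN mp]) (use \<rho>(1) in simp)
  qed
  then have c0: "c = h (\<lambda>_. 0)" by (metis dist_pos_lt less_irrefl)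
  then obtain \<rho> where "\<rho> > 0" "\<forall>w. (\<forall>m\<le>N. cmod (w m) \<le> \<rho>) \<longrightarrow> dist (h w) c < cmod c"
    using near[of "cmod c"] nz by auto
  then show ?thesis by (intro exI[of _ \<rho>]) auto
qed

text \<open>The limits in Hadamard's form are the partial derivatives. On functions that are affine along the
coordinate axis they can be read off there.\<close>

lemma difference_quotient_limit:
  assumes g: "\<And>w w'. h w - h w' = (\<Sum>m\<le>N. (w m - w' m) * g m w w')"
    and lim: "((\<lambda>(w, w'). g m w w') \<longlongrightarrow> L) (small_pairs N)" and m: "m \<le> N"
    and axis: "\<And>s. h (\<lambda>l. if l = m then s else 0) = h (\<lambda>_. 0) + s * J"
  shows "L = J"
proof -
  define ax where "ax = (\<lambda>s l. if l = m then s else 0 :: complex)"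
  have gJ: "g m (ax s) (\<lambda>_. 0) = J" if "s \<noteq> 0" for s
  proof -
    have "s * J = h (ax s) - h (\<lambda>_. 0)" using axis[of s] by (simp add: ax_def)
    also have "\<dots> = (\<Sum>l\<le>N. (ax s l - 0) * g l (ax s) (\<lambda>_. 0))" by (rule g)
    also have "\<dots> = (\<Sum>l\<le>N. if l = m then s * g m (ax s) (\<lambda>_. 0) else 0)"
      by (intro sum.cong) (auto simp: ax_def)
    also have "\<dots> = s * g m (ax s) (\<lambda>_. 0)" using m by simp
    finally show ?thesis using that by simp
  qed
  have "dist L J < e" if e: "e > 0" for e
  proof -
    obtain \<rho> where \<rho>: "\<rho> > 0" "\<forall>w w'. (\<forall>m\<le>N. cmod (w m) \<le> \<rho> \<and> cmod (w' m) \<le> \<rho>) \<longrightarrow> dist (g m w w') L < e"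
      using tendstoD[OF lim e] unfolding eventually_small_pairs prod.case by blast
    have "dist (g m (ax (of_real \<rho>)) (\<lambda>_. 0)) L < e"
      by (rule \<rho>(2)[THEN spec, THEN spec, THEN mp]) (use \<rho>(1) in \<open>simp add: ax_def\<close>)
    then show ?thesis using gJ[of "of_real \<rho>"] \<rho>(1) by (simp add: dist_commute)
  qed
  then show ?thesis by (metis dist_pos_lt less_irrefl)
qed

text \<open>The \<open>k n + 1\<close> directions \<open>\<lambda>\<^sup>e E\<^sub>i\<^sub>i\<close> along which the determinant is varied. At the model matrix below,
the \<open>i\<close>-th diagonal cofactor is \<open>\<lambda>\<^sup>k\<^sup>(\<^sup>n\<^sup>-\<^sup>1\<^sup>-\<^sup>i\<^sup>)\<close>, and the direction with number \<open>m\<close> changes the determinant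
there by \<open>\<lambda>\<^sup>m\<close> to first order. Writing \<open>m = k (n - 1 - i) + e\<close> with \<open>e < k\<close> fixes \<open>i\<close> and \<open>e\<close> unless
\<open>m = k n\<close>, which needs \<open>i = 0\<close> and \<open>e = k\<close>.\<close>

definition entry_index :: "nat \<Rightarrow> nat \<Rightarrow> nat \<Rightarrow> nat" where
  "entry_index n k m = (if m = k * n then 0 else n - 1 - m div k)"

definition entry_exponent :: "nat \<Rightarrow> nat \<Rightarrow> nat \<Rightarrow> nat" where
  "entry_exponent n k m = (if m = k * n then k else m mod k)"

lemma entry_index_exponent:
  assumes "m \<le> k * n" "n > 0" "k > 0"
  shows "entry_index n k m < n" "entry_exponent n k m \<le> k"
    "k * (n - 1 - entry_index n k m) + entry_exponent n k m = m"
proof -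
  show 1: "entry_index n k m < n" using assms by (auto simp: entry_index_def)
  show "entry_exponent n k m \<le> k" using assms by (auto simp: entry_exponent_def intro: less_imp_le)
  show "k * (n - 1 - entry_index n k m) + entry_exponent n k m = m"
  proof (cases "m = k * n")
    case True
    then show ?thesis using assms by (cases n) (auto simp: entry_index_def entry_exponent_def)
  next
    case False
    then have "m div k < n" using assms by (simp add: less_mult_imp_div_less mult.commute)
    then have "n - 1 - (n - 1 - m div k) = m div k" by simp
    then show ?thesis using False by (simp add: entry_index_def entry_exponent_def)
  qed
qed

definition perturb_diagonal :: "nat \<Rightarrow> nat \<Rightarrow> complex poly mat \<Rightarrow> (nat \<Rightarrow> complex) \<Rightarrow> complex poly mat" where
  "perturb_diagonal n k Q w = mat n n (\<lambda>(i, j). Q $$ (i, j) +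
     (if i = j then \<Sum>m\<le>k * n. if entry_index n k m = i then monom (w m) (entry_exponent n k m) else 0 else 0))"

text \<open>Column \<open>m\<close> holds the coefficients of the first-order change of the determinant in direction \<open>m\<close>.\<close>

definition det_jacobian :: "nat \<Rightarrow> nat \<Rightarrow> complex poly mat \<Rightarrow> complex mat" where
  "det_jacobian n k Q = mat (Suc (k * n)) (Suc (k * n)) (\<lambda>(p, m).
     coeff (monom 1 (entry_exponent n k m) * cofactor Q (entry_index n k m) (entry_index n k m)) p)"

lemma perturb_diagonal_carrier: "perturb_diagonal n k Q w \<in> carrier_mat n n"
  by (simp add: perturb_diagonal_def)

lemma degree_cofactor_le:
  fixes Q :: "complex poly mat"
  assumes Q: "Q \<in> carrier_mat n n" and deg: "\<And>i j. i < n \<Longrightarrow> j < n \<Longrightarrow> degree (Q $$ (i, j)) \<le> k"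
    and rs: "r < n" "s < n"
  shows "degree (cofactor Q r s) \<le> k * (n - 1)"
proof -
  have "degree (det (mat_delete Q r s)) \<le> k * (n - 1)"
    by (rule degree_det_le[OF _ mat_delete_carrier[OF Q]]) (use Q deg rs in \<open>auto simp: mat_delete_def\<close>)
  moreover have "degree ((- 1 :: complex poly) ^ (r + s)) = 0"
    by (cases "even (r + s)") auto
  ultimately show ?thesis
    unfolding cofactor_def using degree_mult_le[of "(- 1) ^ (r + s)" "det (mat_delete Q r s)"] by simp
qed

lemma degree_perturb_diagonal_le:
  assumes nk: "n > 0" "k > 0"
    and deg: "\<And>i j. i < n \<Longrightarrow> j < n \<Longrightarrow> degree (Q $$ (i, j)) \<le> k" and ij: "i < n" "j < n"
  shows "degree (perturb_diagonal n k Q w $$ (i, j)) \<le> k"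
proof -
  have "degree (\<Sum>m\<le>k * n. if entry_index n k m = i then monom (w m) (entry_exponent n k m) else 0) \<le> k"
    using entry_index_exponent(2)[OF _ nk]
    by (intro degree_sum_le) (auto intro: order_trans[OF degree_monom_le])
  then show ?thesis using deg ij by (auto simp: perturb_diagonal_def intro: degree_add_le)
qed

lemma coeffs_in_perturb_diagonal:
  assumes "i < n" "j < n"
  shows "coeffs_in (strictly_differentiable (k * n)) (\<lambda>w. perturb_diagonal n k Q w $$ (i, j))"
proof -
  note F = function_algebra_strictly_differentiable[of "k * n"]
  have m: "coeffs_in (strictly_differentiable (k * n)) (\<lambda>w. if entry_index n k m = i then monom (w m) l else 0)"
    if "m \<le> k * n" for m l
  proof (cases "entry_index n k m = i")
    case True
    have "(\<lambda>w. if l = q then w m else 0) \<in> strictly_differentiable (k * n)" for q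
      using coordinate_strictly_differentiable[OF that] F by (cases "l = q") (auto simp: function_algebra_def)
    then show ?thesis using True by (simp add: coeffs_in_def)
  next
    case False
    then show ?thesis using coeffs_in_const[OF F, of 0] by simp
  qed
  have "coeffs_in (strictly_differentiable (k * n)) (\<lambda>w. if i = j then
      \<Sum>m\<le>k * n. if entry_index n k m = i then monom (w m) (entry_exponent n k m) else 0 else 0)"
  proof (cases "i = j")
    case True
    have "coeffs_in (strictly_differentiable (k * n)) (\<lambda>w.
      \<Sum>m\<le>k * n. if entry_index n k m = i then monom (w m) (entry_exponent n k m) else 0)"
      by (rule coeffs_in_sum[OF F], rule m) simp
    then show ?thesis using True by simp
  next
    case False
    then show ?thesis using coeffs_in_const[OF F, of 0] by simp
  qed
  from coeffs_in_add[OF F coeffs_in_const[OF F, of "Q $$ (i, j)"] this]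
  show ?thesis using assms by (simp add: perturb_diagonal_def)
qed

lemma perturb_diagonal_zero:
  assumes "Q \<in> carrier_mat n n"
  shows "perturb_diagonal n k Q (\<lambda>_. 0) = Q"
  using assms by (intro eq_matI) (auto simp: perturb_diagonal_def)

lemma det_perturb_diagonal_axis:
  assumes Q: "Q \<in> carrier_mat n n" and m: "m \<le> k * n" and nk: "n > 0" "k > 0"
  shows "det (perturb_diagonal n k Q (\<lambda>l. if l = m then s else 0)) =
    det Q + monom s (entry_exponent n k m) * cofactor Q (entry_index n k m) (entry_index n k m)"
proof (rule det_add_diagonal_entry[OF Q perturb_diagonal_carrier entry_index_exponent(1)[OF m nk]])
  fix i j assume ij: "i < n" "j < n"
  have "(\<Sum>l\<le>k * n. if entry_index n k l = i then monom (if l = m then s else 0) (entry_exponent n k l) else 0) =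
    (\<Sum>l\<le>k * n. if l = m then (if entry_index n k m = i then monom s (entry_exponent n k m) else 0) else 0)"
    by (intro sum.cong) auto
  also have "\<dots> = (if entry_index n k m = i then monom s (entry_exponent n k m) else 0)" using m by simp
  finally show "perturb_diagonal n k Q (\<lambda>l. if l = m then s else 0) $$ (i, j) =
    Q $$ (i, j) + (if i = entry_index n k m \<and> j = entry_index n k m then monom s (entry_exponent n k m) else 0)"
    using ij by (auto simp: perturb_diagonal_def)
qed

text \<open>If the Jacobian is invertible at a singular \<open>Q\<close>, the equation \<open>det Q' = c \<tau>\<close> has a solution \<open>Q'\<close> close to
\<open>Q\<close> for all small \<open>c\<close>. A diagonal cofactor of \<open>Q\<close> does not vanish at \<open>a\<close>: otherwise the functional
\<open>q \<mapsto> q(a)\<close> would vanish on all columns of the Jacobian. By continuity the cofactor of \<open>Q'\<close> does not vanish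
there either.\<close>

lemma exists_perturbation_with_det:
  assumes Q: "Q \<in> carrier_mat n n" and nk: "n > 0" "k > 0"
    and deg: "\<And>i j. i < n \<Longrightarrow> j < n \<Longrightarrow> degree (Q $$ (i, j)) \<le> k"
    and sing: "det Q = 0" and jac: "det (det_jacobian n k Q) \<noteq> 0"
    and \<tau>: "degree \<tau> \<le> k * n" and \<epsilon>: "\<epsilon> > 0"
  shows "\<exists>w c i. (\<forall>m\<le>k * n. cmod (w m) \<le> \<epsilon>) \<and> c \<noteq> 0 \<and> det (perturb_diagonal n k Q w) = smult c \<tau> \<and>
     i < n \<and> poly (cofactor (perturb_diagonal n k Q w) i i) a \<noteq> 0"
proof -
  define N where "N = k * n"
  define J where "J = (\<lambda>p m. det_jacobian n k Q $$ (p, m))"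
  note F = function_algebra_strictly_differentiable[of N]
  have Jc: "det_jacobian n k Q \<in> carrier_mat (Suc N) (Suc N)" by (simp add: det_jacobian_def N_def)
  note adj = adj_mat[OF Jc]
  define K where "K = (\<lambda>p m. adj_mat (det_jacobian n k Q) $$ (p, m) / det (det_jacobian n k Q))"
  have KJ: "(\<Sum>m\<le>N. K p m * J m q) = (if p = q then 1 else 0)"
    and JK: "(\<Sum>m\<le>N. J p m * K m q) = (if p = q then 1 else 0)" if "p \<le> N" "q \<le> N" for p q
  proof -
    have pq: "p < Suc N" "q < Suc N" using that by auto
    have "(\<Sum>m<Suc N. adj_mat (det_jacobian n k Q) $$ (p, m) * J m q) = det (det_jacobian n k Q) * (if p = q then 1 else 0)"
      unfolding J_def mult_mat_entry[OF adj(1) Jc pq, symmetric] adj(3) using pq by simp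
    then show "(\<Sum>m\<le>N. K p m * J m q) = (if p = q then 1 else 0)"
      using jac unfolding K_def lessThan_Suc_atMost times_divide_eq_left sum_divide_distrib[symmetric] by simp
    have "(\<Sum>m<Suc N. J p m * adj_mat (det_jacobian n k Q) $$ (m, q)) = det (det_jacobian n k Q) * (if p = q then 1 else 0)"
      unfolding J_def mult_mat_entry[OF Jc adj(1) pq, symmetric] adj(2) using pq by simp
    then show "(\<Sum>m\<le>N. J p m * K m q) = (if p = q then 1 else 0)"
      using jac unfolding K_def lessThan_Suc_atMost times_divide_eq_right sum_divide_distrib[symmetric] by simp
  qed
  define h where "h = (\<lambda>p w. coeff (det (perturb_diagonal n k Q w)) p)"
  have "coeffs_in (strictly_differentiable N) (\<lambda>w. det (perturb_diagonal n k Q w))"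
    unfolding N_def
    by (rule coeffs_in_det[OF function_algebra_strictly_differentiable perturb_diagonal_carrier coeffs_in_perturb_diagonal])
  then have hp: "h p \<in> strictly_differentiable N" for p by (simp add: coeffs_in_def h_def)
  let ?lim = "\<lambda>g L. \<forall>m\<le>N. ((\<lambda>(w, w'). g m w w') \<longlongrightarrow> L m) (small_pairs N)"
  let ?diff = "\<lambda>p g. \<forall>w w'. h p w - h p w' = (\<Sum>m\<le>N. (w m - w' m) * g m w w')"
  have "\<exists>g L. ?diff p g \<and> ?lim g L" for p
    using hp[of p] unfolding strictly_differentiable_def mem_Collect_eq by (rule conjunct2)
  then have "\<exists>g. \<forall>p. \<exists>L. ?diff p (g p) \<and> ?lim (g p) L" by (intro choice allI)
  then obtain g where gL: "\<forall>p. \<exists>L. ?diff p (g p) \<and> ?lim (g p) L" ..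
  have g: "h p w - h p w' = (\<Sum>m\<le>N. (w m - w' m) * g p m w w')" for p w w'
    using gL[THEN spec, of p] by (elim exE conjE) (erule allE, erule allE)
  have "\<forall>p. \<exists>L. ?lim (g p) L"
    using gL by (intro allI) (drule spec, elim exE conjE, rule exI)
  from choice[OF this] obtain L where L': "\<forall>p. ?lim (g p) (L p)" ..
  have L: "((\<lambda>(w, w'). g p m w w') \<longlongrightarrow> L p m) (small_pairs N)" if "m \<le> N" for p m
    by (rule L'[THEN spec, THEN spec, THEN mp, OF that])
  have LJ: "L p m = J p m" if pm: "p \<le> N" "m \<le> N" for p m
  proof (rule difference_quotient_limit[OF g L[OF pm(2)] pm(2)])
    fix s
    have "monom s l * q = smult s (monom 1 l * q)" for l and q :: "complex poly"
      by (metis mult_smult_left smult_monom mult.right_neutral)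
    then show "h p (\<lambda>l. if l = m then s else 0) = h p (\<lambda>_. 0) + s * J p m"
      using pm unfolding h_def det_perturb_diagonal_axis[OF Q pm(2)[unfolded N_def] nk] perturb_diagonal_zero[OF Q]
      by (simp add: J_def det_jacobian_def N_def)
  qed
  have h0: "h p (\<lambda>_. 0) = 0" for p by (simp add: h_def perturb_diagonal_zero[OF Q] sing)
  obtain i where i: "i < n" "poly (cofactor Q i i) a \<noteq> 0"
  proof (rule ccontr)
    assume "\<not> thesis"
    then have z: "\<And>i. i < n \<Longrightarrow> poly (cofactor Q i i) a = 0" using that by blast
    have "(\<Sum>p\<le>N. a ^ p * J p m) = 0" if m: "m \<le> N" for m
    proof -
      define q where "q = monom 1 (entry_exponent n k m) * cofactor Q (entry_index n k m) (entry_index n k m)"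
      note ie = entry_index_exponent[OF m[unfolded N_def] nk]
      have "degree q \<le> entry_exponent n k m + k * (n - 1)"
        unfolding q_def using degree_cofactor_le[OF Q deg ie(1) ie(1)]
        by (intro order_trans[OF degree_mult_le] add_mono degree_monom_le)
      also have "\<dots> \<le> N" using ie(2) nk by (cases n) (auto simp: N_def)
      finally have dq: "degree q \<le> N" .
      have "poly q a = (\<Sum>p\<le>N. coeff q p * a ^ p)"
        by (rule poly_altdef[THEN trans]) (use dq in \<open>auto intro!: sum.mono_neutral_left intro: le_degree\<close>)
      also have "\<dots> = (\<Sum>p\<le>N. a ^ p * J p m)"
        using m by (intro sum.cong) (auto simp: J_def det_jacobian_def N_def q_def)
      finally show ?thesis using z[OF ie(1)] by (simp add: q_def)
    qed
    then have "0 = (\<Sum>m\<le>N. (\<Sum>p\<le>N. a ^ p * J p m) * K m 0)" by simp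
    also have "\<dots> = (\<Sum>p\<le>N. a ^ p * (\<Sum>m\<le>N. J p m * K m 0))"
      unfolding sum_distrib_left sum_distrib_right by (subst sum.swap) (simp add: mult.assoc)
    also have "\<dots> = (\<Sum>p\<le>N. if p = 0 then 1 else 0)" using JK by (intro sum.cong) auto
    also have "\<dots> = 1" by simp
    finally show False by simp
  qed
  define H where "H = (\<lambda>w. poly (cofactor (perturb_diagonal n k Q w) i i) a)"
  have "H \<in> strictly_differentiable N"
    unfolding H_def
  proof (rule poly_in_of_coeffs_in[OF F])
    show "coeffs_in (strictly_differentiable N) (\<lambda>w. cofactor (perturb_diagonal n k Q w) i i)"
      unfolding N_def using i(1)
      by (intro coeffs_in_cofactor[OF function_algebra_strictly_differentiable perturb_diagonal_carrier coeffs_in_perturb_diagonal])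
    show "degree (cofactor (perturb_diagonal n k Q w) i i) \<le> k * (n - 1)" for w
      by (rule degree_cofactor_le[OF perturb_diagonal_carrier degree_perturb_diagonal_le[OF nk deg] i(1) i(1)])
  qed
  moreover have "H (\<lambda>_. 0) \<noteq> 0" using i by (simp add: H_def perturb_diagonal_zero[OF Q])
  ultimately obtain \<rho> where \<rho>: "\<rho> > 0" "\<And>w. (\<forall>m\<le>N. cmod (w m) \<le> \<rho>) \<Longrightarrow> H w \<noteq> 0"
    using strictly_differentiable_nonzero_near by blast
  \<comment> \<open>\<open>\<epsilon>\<close> controls the size of the perturbation, \<open>\<rho>\<close> protects the cofactor.\<close>
  define \<epsilon>' where "\<epsilon>' = min \<epsilon> \<rho>"
  have \<epsilon>': "\<epsilon>' > 0" using \<epsilon> \<rho> by (simp add: \<epsilon>'_def)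
  have "\<exists>\<delta>>0. \<forall>y. (\<forall>p\<le>N. cmod (y p) \<le> \<delta>) \<longrightarrow> (\<exists>w. (\<forall>m\<le>N. cmod (w m) \<le> \<epsilon>') \<and> (\<forall>p\<le>N. h p w = y p))"
  proof (rule strictly_differentiable_local_inverse[OF g _ h0 KJ JK \<epsilon>'])
    show "((\<lambda>(w, w'). g p m w w') \<longlongrightarrow> J p m) (small_pairs N)" if "p \<le> N" "m \<le> N" for p m
      using L[of m p] LJ that by simp
  qed
  then obtain \<delta> where \<delta>: "\<delta> > 0"
    "\<And>y. (\<forall>p\<le>N. cmod (y p) \<le> \<delta>) \<Longrightarrow> (\<exists>w. (\<forall>m\<le>N. cmod (w m) \<le> \<epsilon>') \<and> (\<forall>p\<le>N. h p w = y p))"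
    by blast
  define B where "B = (\<Sum>p\<le>N. cmod (coeff \<tau> p)) + 1"
  have B: "B > 0" unfolding B_def by (simp add: add_nonneg_pos sum_nonneg)
  let ?c = "complex_of_real (\<delta> / B)"
  have "cmod (?c * coeff \<tau> p) \<le> \<delta>" if "p \<le> N" for p
  proof -
    have "cmod (coeff \<tau> p) \<le> (\<Sum>p\<le>N. cmod (coeff \<tau> p))"
      by (rule member_le_sum) (use that in auto)
    then have "cmod (coeff \<tau> p) \<le> B" by (simp add: B_def)
    then have "\<delta> / B * cmod (coeff \<tau> p) \<le> \<delta> / B * B" using \<delta> B by (intro mult_left_mono) auto
    then show ?thesis using \<delta> B by (simp add: norm_mult norm_divide)
  qed
  then obtain w where w: "\<And>m. m \<le> N \<Longrightarrow> cmod (w m) \<le> \<epsilon>'"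
      and hw: "\<And>p. p \<le> N \<Longrightarrow> h p w = ?c * coeff \<tau> p"
    using \<delta>(2)[of "\<lambda>p. ?c * coeff \<tau> p"] by blast
  have "det (perturb_diagonal n k Q w) = smult (?c) \<tau>"
  proof (rule poly_eqI)
    fix p
    have "degree (det (perturb_diagonal n k Q w)) \<le> k * n"
      by (rule degree_det_le[OF degree_perturb_diagonal_le[OF nk deg] perturb_diagonal_carrier])
    then show "coeff (det (perturb_diagonal n k Q w)) p = coeff (smult (?c) \<tau>) p"
      using hw[of p] \<tau> by (cases "p \<le> N") (auto simp: h_def N_def coeff_eq_0)
  qed
  moreover have "poly (cofactor (perturb_diagonal n k Q w) i i) a \<noteq> 0"
    using \<rho>(2)[of w] w by (fastforce simp: H_def \<epsilon>'_def)
  moreover have "\<forall>m\<le>k * n. cmod (w m) \<le> \<epsilon>" using w by (fastforce simp: \<epsilon>'_def N_def)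
  ultimately show ?thesis using i \<delta> B
    by (intro exI[of _ w] exI[of _ "?c"] exI[of _ i]) auto
qed


section \<open>A singular model matrix with surjective differential\<close>

text \<open>Entry \<open>i\<close> of the vector \<open>e\<^sub>l - \<lambda>\<^sup>e\<^sup>(\<^sup>l\<^sup>) e\<^sub>l\<^sub>+\<^sub>1\<close>.\<close>

definition bidiag :: "(nat \<Rightarrow> nat) \<Rightarrow> nat \<Rightarrow> nat \<Rightarrow> complex poly" where
  "bidiag e l i = (if i = l then 1 else if i = Suc l then - monom 1 (e l) else 0)"

definition model_matrix :: "nat \<Rightarrow> (nat \<Rightarrow> nat) \<Rightarrow> (nat \<Rightarrow> nat) \<Rightarrow> complex poly mat" where
  "model_matrix n b a = mat n n (\<lambda>(i, j). \<Sum>l<n - 1. bidiag b l i * bidiag a l j)"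

lemma bidiag_combination_zero:
  assumes z: "\<And>i. i < Suc q \<Longrightarrow> (\<Sum>l<q. u l * bidiag e l i) = 0"
  shows "l < q \<Longrightarrow> u l = 0"
proof (induction l)
  case 0
  have "(\<Sum>l<q. u l * bidiag e l 0) = (\<Sum>l<q. if l = 0 then u 0 else 0)"
    by (intro sum.cong) (auto simp: bidiag_def)
  then show ?case using z[of 0] 0 by simp
next
  case (Suc l)
  have "(\<Sum>m<q. u m * bidiag e m (Suc l)) = (\<Sum>m<q. if m = Suc l then u (Suc l) else 0)"
    using Suc by (intro sum.cong) (auto simp: bidiag_def)
  then show ?case using z[of "Suc l"] Suc.prems by simp
qed

lemma sum_bidiag:
  assumes "l < q"
  shows "(\<Sum>j<Suc q. bidiag e l j * x j) = x l - monom 1 (e l) * x (Suc l)"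
proof -
  have "(\<Sum>j<Suc q. bidiag e l j * x j) =
     (\<Sum>j<Suc q. (if j = l then x l else 0) + (if j = Suc l then - monom 1 (e l) * x (Suc l) else 0))"
    by (intro sum.cong) (auto simp: bidiag_def)
  also have "\<dots> = x l - monom 1 (e l) * x (Suc l)"
    using assms unfolding sum.distrib by simp
  finally show ?thesis .
qed

text \<open>The vectors \<open>e\<^sub>l - \<lambda>\<^sup>b\<^sup>(\<^sup>l\<^sup>) e\<^sub>l\<^sub>+\<^sub>1\<close> are linearly independent, so a kernel vector is orthogonal to all the
vectors \<open>e\<^sub>l - \<lambda>\<^sup>a\<^sup>(\<^sup>l\<^sup>) e\<^sub>l\<^sub>+\<^sub>1\<close>.\<close>

lemma model_matrix_kernel:
  assumes z: "\<And>i. i < Suc q \<Longrightarrow> (\<Sum>j<Suc q. model_matrix (Suc q) b a $$ (i, j) * x j) = 0" and l: "l < q"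
  shows "x l = monom 1 (a l) * x (Suc l)"
proof -
  have "(\<Sum>j<Suc q. bidiag a l j * x j) = 0"
  proof (rule bidiag_combination_zero[OF _ l])
    fix i assume i: "i < Suc q"
    have "(\<Sum>l<q. (\<Sum>j<Suc q. bidiag a l j * x j) * bidiag b l i) =
        (\<Sum>j<Suc q. (\<Sum>l<q. bidiag b l i * bidiag a l j) * x j)"
      unfolding sum_distrib_right by (subst sum.swap) (simp add: mult_ac del: sum.lessThan_Suc)
    also have "\<dots> = 0"
      using z[OF i] i by (simp add: model_matrix_def del: sum.lessThan_Suc)
    finally show "(\<Sum>l<q. (\<Sum>j<Suc q. bidiag a l j * x j) * bidiag b l i) = 0" .
  qed
  then show ?thesis unfolding sum_bidiag[OF l] by simp
qed

lemma model_matrix_transpose_index: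
  "i < n \<Longrightarrow> j < n \<Longrightarrow> model_matrix n b a $$ (i, j) = model_matrix n a b $$ (j, i)"
  by (simp add: model_matrix_def mult.commute)

lemma det_sum_rank_one_zero:
  fixes c s :: "nat \<Rightarrow> nat \<Rightarrow> 'a :: idom"
  assumes "n > 0"
  shows "det (mat n n (\<lambda>(i, j). \<Sum>l<n - 1. c l i * s l j)) = 0"
proof -
  define C where "C = mat n n (\<lambda>(i, l). if l < n - 1 then c l i else 0)"
  define S where "S = mat n n (\<lambda>(l, j). s l j)"
  have CS: "C \<in> carrier_mat n n" "S \<in> carrier_mat n n" by (auto simp: C_def S_def)
  have "mat n n (\<lambda>(i, j). \<Sum>l<n - 1. c l i * s l j) = C * S"
  proof (rule eq_matI)
    fix i j assume "i < dim_row (C * S)" "j < dim_col (C * S)"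
    then have ij: "i < n" "j < n" using CS by auto
    have "(C * S) $$ (i, j) = (\<Sum>l<n. C $$ (i, l) * S $$ (l, j))" by (rule mult_mat_entry[OF CS ij])
    also have "\<dots> = (\<Sum>l<n. if l < n - 1 then c l i * s l j else 0)"
      using ij by (intro sum.cong) (auto simp: C_def S_def)
    also have "\<dots> = (\<Sum>l<n - 1. c l i * s l j)"
      using assms by (intro sum.mono_neutral_cong_right) auto
    finally show "mat n n (\<lambda>(i, j). \<Sum>l<n - 1. c l i * s l j) $$ (i, j) = (C * S) $$ (i, j)" using ij by simp
  qed (use CS in auto)
  moreover have "det C = 0"
  proof -
    have "n - 1 < n" using assms by simp
    from laplace_expansion_column[OF CS(1) this] show ?thesis
      using assms by (simp add: C_def)
  qed
  ultimately show ?thesis using det_mult[OF CS] by simp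
qed

text \<open>The rows and columns of the adjugate \<open>W\<close> lie in the kernels of the model matrix, which are spanned by
vectors of monomials. Passing from the diagonal entry \<open>l + 1\<close> of \<open>W\<close> to \<open>l\<close> multiplies it by
\<open>\<lambda>\<^sup>a\<^sup>(\<^sup>l\<^sup>) \<lambda>\<^sup>b\<^sup>(\<^sup>l\<^sup>) = \<lambda>\<^sup>k\<close>. The last one is \<open>1\<close>, since adding \<open>1\<close> to the last diagonal entry completes the
model matrix to a product of two unitriangular matrices.\<close>

lemma cofactor_model_matrix:
  assumes ab: "\<And>l. l < q \<Longrightarrow> a l + b l = k" and i: "i \<le> q"
  shows "cofactor (model_matrix (Suc q) b a) i i = monom 1 (k * (q - i))"
proof -
  define Q where "Q = model_matrix (Suc q) b a"
  have Q: "Q \<in> carrier_mat (Suc q) (Suc q)" by (simp add: Q_def model_matrix_def)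
  have detQ: "det Q = 0"
    unfolding Q_def model_matrix_def by (rule det_sum_rank_one_zero) simp
  define W where "W = adj_mat Q"
  note adj = adj_mat[OF Q]
  have W: "W \<in> carrier_mat (Suc q) (Suc q)" unfolding W_def by (rule adj(1))
  have QW: "(\<Sum>m<Suc q. Q $$ (i, m) * W $$ (m, j)) = 0" if "i < Suc q" "j < Suc q" for i j
    unfolding mult_mat_entry[OF Q W that, symmetric] unfolding W_def adj(2) detQ using that by simp
  have WQ: "(\<Sum>m<Suc q. W $$ (i, m) * Q $$ (m, j)) = 0" if "i < Suc q" "j < Suc q" for i j
    unfolding mult_mat_entry[OF W Q that, symmetric] unfolding W_def adj(3) detQ using that by simp
  have right: "W $$ (l, j) = monom 1 (a l) * W $$ (Suc l, j)" if l: "l < q" and j: "j < Suc q" for l j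
    by (rule model_matrix_kernel[of q b a "\<lambda>m. W $$ (m, j)", OF _ l]) (rule QW[unfolded Q_def], use j in auto)
  have left: "W $$ (i, l) = monom 1 (b l) * W $$ (i, Suc l)" if l: "l < q" and i: "i < Suc q" for l i
  proof (rule model_matrix_kernel[of q a b "\<lambda>m. W $$ (i, m)", OF _ l])
    fix j assume j: "j < Suc q"
    have "(\<Sum>m<Suc q. model_matrix (Suc q) a b $$ (j, m) * W $$ (i, m)) = (\<Sum>m<Suc q. W $$ (i, m) * Q $$ (m, j))"
      unfolding Q_def using j
      by (intro sum.cong refl) (simp add: model_matrix_transpose_index[of j "Suc q" _ a b] mult.commute)
    then show "(\<Sum>m<Suc q. model_matrix (Suc q) a b $$ (j, m) * W $$ (i, m)) = 0" using WQ[OF i j] by simp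
  qed
  define C where "C = mat (Suc q) (Suc q) (\<lambda>(i, l). bidiag b l i)"
  define S where "S = mat (Suc q) (Suc q) (\<lambda>(l, j). bidiag a l j)"
  have CS: "C \<in> carrier_mat (Suc q) (Suc q)" "S \<in> carrier_mat (Suc q) (Suc q)" by (auto simp: C_def S_def)
  have "det C = prod_list (diag_mat C)"
    by (rule det_lower_triangular[OF _ CS(1)]) (auto simp: C_def bidiag_def)
  also have "\<dots> = 1" unfolding prod_list_diag_prod using CS by (intro prod.neutral) (auto simp: C_def bidiag_def)
  finally have detC: "det C = 1" .
  have "upper_triangular S" by (auto simp: S_def bidiag_def upper_triangular_def)
  from det_upper_triangular[OF this CS(2)] have "det S = prod_list (diag_mat S)" .
  also have "\<dots> = 1" unfolding prod_list_diag_prod using CS by (intro prod.neutral) (auto simp: S_def bidiag_def)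
  finally have detS: "det S = 1" .
  have "det (C * S) = det Q + 1 * cofactor Q q q"
  proof (rule det_add_diagonal_entry[OF Q mult_carrier_mat[OF CS]])
    fix i j assume ij: "i < Suc q" "j < Suc q"
    have "(C * S) $$ (i, j) = (\<Sum>l<Suc q. C $$ (i, l) * S $$ (l, j))" by (rule mult_mat_entry[OF CS ij])
    also have "\<dots> = (\<Sum>l<Suc q. bidiag b l i * bidiag a l j)"
      using ij by (intro sum.cong) (auto simp: C_def S_def)
    also have "\<dots> = Q $$ (i, j) + bidiag b q i * bidiag a q j" using ij by (simp add: Q_def model_matrix_def)
    also have "bidiag b q i * bidiag a q j = (if i = q \<and> j = q then 1 else 0)"
      using ij by (auto simp: bidiag_def)
    finally show "(C * S) $$ (i, j) = Q $$ (i, j) + (if i = q \<and> j = q then 1 else 0)" .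
  qed simp
  then have Wqq: "cofactor Q q q = 1" by (simp add: det_mult[OF CS] detC detS detQ)
  have cofW: "cofactor Q j j = W $$ (j, j)" if "j \<le> q" for j
    using that Q by (simp add: W_def adj_mat_def)
  have "W $$ (q - m, q - m) = monom 1 (k * m)" if "m \<le> q" for m
    using that
  proof (induction m)
    case 0
    then show ?case using Wqq cofW[of q] by (simp add: monom_0)
  next
    case (Suc m)
    define l where "l = q - Suc m"
    have l: "l < q" "Suc l = q - m" using Suc.prems by (auto simp: l_def)
    have "W $$ (l, l) = monom 1 (a l) * (monom 1 (b l) * W $$ (Suc l, Suc l))"
      using right[of l l] left[of l "Suc l"] l by simp
    also have "\<dots> = monom 1 (a l + b l + k * m)"
      unfolding l(2) using Suc by (simp add: mult_monom add.assoc)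
    also have "a l + b l + k * m = k * Suc m" using ab[OF l(1)] by simp
    finally show ?case by (simp add: l_def)
  qed
  from this[of "q - i"] show ?thesis using i cofW[OF i] by (simp add: Q_def)
qed

text \<open>At the model matrix the chosen directions move the determinant along the monomials: the Jacobian is the
identity.\<close>

lemma det_jacobian_model_matrix:
  assumes n: "n > 0" and k: "k > 0" and ab: "\<And>l. l < n - 1 \<Longrightarrow> a l + b l = k"
  shows "det (det_jacobian n k (model_matrix n b a)) = 1"
proof -
  obtain q where q: "n = Suc q" using n by (cases n) auto
  have "det_jacobian n k (model_matrix n b a) = 1\<^sub>m (Suc (k * n))"
  proof (rule eq_matI)
    fix p m assume "p < dim_row (1\<^sub>m (Suc (k * n)))" "m < dim_col (1\<^sub>m (Suc (k * n)))"
    then have pm: "p \<le> k * n" "m \<le> k * n" by auto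
    note ie = entry_index_exponent[OF pm(2) n k]
    have "cofactor (model_matrix n b a) (entry_index n k m) (entry_index n k m)
       = monom 1 (k * (n - 1 - entry_index n k m))"
      using cofactor_model_matrix[of q a b k "entry_index n k m"] ab ie(1) by (simp add: q)
    then have "monom 1 (entry_exponent n k m) * cofactor (model_matrix n b a) (entry_index n k m) (entry_index n k m)
       = monom 1 m"
      using ie(3) by (simp add: mult_monom add.commute)
    then show "det_jacobian n k (model_matrix n b a) $$ (p, m) = 1\<^sub>m (Suc (k * n)) $$ (p, m)"
      using pm by (auto simp: det_jacobian_def)
  qed (auto simp: det_jacobian_def)
  then show ?thesis by simp
qed

definition poly_functions :: "(complex \<Rightarrow> complex) set" where
  "poly_functions = range poly"

lemma function_algebra_poly_functions: "function_algebra poly_functions"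
proof -
  have "(\<lambda>_. c) = poly [:c:]" for c :: complex by auto
  moreover have "(\<lambda>x. poly p x + poly q x) = poly (p + q)" "(\<lambda>x. poly p x * poly q x) = poly (p * q)"
    for p q :: "complex poly" by auto
  ultimately show ?thesis unfolding function_algebra_def poly_functions_def by blast
qed

lemma poly_function_tendsto: "f \<in> poly_functions \<Longrightarrow> (f \<longlongrightarrow> f t) (at t)"
  unfolding poly_functions_def by (auto intro: tendsto_intros)

lemma poly_function_nonzero_near:
  assumes "f \<in> poly_functions" "f t0 \<noteq> 0"
  shows "eventually (\<lambda>t. f t \<noteq> 0) (at t)"
proof -
  obtain p where p: "f = poly p" using assms(1) by (auto simp: poly_functions_def)
  then have "p \<noteq> 0" using assms(2) by auto
  then have "finite ({x. poly p x = 0} - {t})" using poly_roots_finite[of p] by simp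
  then have "open (- ({x. poly p x = 0} - {t}))" by (intro open_Compl finite_imp_closed)
  then show ?thesis unfolding eventually_at_topological p
    by (intro exI[of _ "- ({x. poly p x = 0} - {t})"]) auto
qed

text \<open>Join the factors of \<open>Q\<close> to those of the model matrix by a segment. All products along it have rank at most
\<open>n - 1\<close> and degree at most \<open>k\<close>. The determinant of the Jacobian is a polynomial in the parameter that is
\<open>1\<close> at the end of the segment, so it does not vanish for small nonzero parameters.\<close>

lemma exists_nearby_surjective_point:
  fixes c s :: "nat \<Rightarrow> nat \<Rightarrow> complex poly"
  assumes n: "n > 0" and k: "k > 0" and a: "\<And>l. l < n - 1 \<Longrightarrow> a l \<le> k"
    and s: "\<And>l j. l < n - 1 \<Longrightarrow> j < n \<Longrightarrow> degree (s l j) \<le> a l"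
    and c: "\<And>l i. l < n - 1 \<Longrightarrow> i < n \<Longrightarrow> degree (c l i) \<le> k - a l"
    and Q: "Q = mat n n (\<lambda>(i, j). \<Sum>l<n - 1. c l i * s l j)" and \<epsilon>: "\<epsilon> > 0"
  shows "\<exists>R \<in> carrier_mat n n. (\<forall>i<n. \<forall>j<n. degree (R $$ (i, j)) \<le> k \<and>
       (\<forall>m\<le>k. cmod (coeff (R $$ (i, j) - Q $$ (i, j)) m) < \<epsilon>)) \<and> det R = 0 \<and> det (det_jacobian n k R) \<noteq> 0"
proof -
  define b where "b = (\<lambda>l. k - a l)"
  define ct where "ct = (\<lambda>t l i. smult (1 - t) (c l i) + smult t (bidiag b l i))"
  define st where "st = (\<lambda>t l j. smult (1 - t) (s l j) + smult t (bidiag a l j))"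
  define R where "R = (\<lambda>t. mat n n (\<lambda>(i, j). \<Sum>l<n - 1. ct t l i * st t l j))"
  have R: "R t \<in> carrier_mat n n" for t by (simp add: R_def)
  have R0: "R 0 = Q" by (simp add: R_def Q ct_def st_def)
  have R1: "R 1 = model_matrix n b a" by (simp add: R_def ct_def st_def model_matrix_def)
  have degb: "degree (bidiag e l i) \<le> e l" for e l i
    by (auto simp: bidiag_def degree_monom_le)
  have deg: "degree (R t $$ (i, j)) \<le> k" if ij: "i < n" "j < n" for t i j
  proof -
    have "degree (ct t l i * st t l j) \<le> k" if l: "l < n - 1" for l
    proof -
      have "degree (ct t l i) \<le> k - a l" unfolding ct_def
        using c[OF l ij(1)] degb[of b l i] by (auto intro!: degree_add_le order_trans[OF degree_smult_le] simp: b_def)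
      moreover have "degree (st t l j) \<le> a l" unfolding st_def
        using s[OF l ij(2)] degb[of a l j] by (auto intro!: degree_add_le order_trans[OF degree_smult_le])
      ultimately show ?thesis using degree_mult_le[of "ct t l i" "st t l j"] a[OF l] by linarith
    qed
    then show ?thesis unfolding R_def using ij by (auto intro!: degree_sum_le)
  qed
  have det0: "det (R t) = 0" for t unfolding R_def by (rule det_sum_rank_one_zero[OF n])
  note F = function_algebra_poly_functions
  have id: "(\<lambda>t. t) \<in> poly_functions" "(\<lambda>t. 1 - t) \<in> poly_functions"
  proof -
    have "(\<lambda>t. t) = poly [:0, 1 :: complex:]" "(\<lambda>t. 1 - t) = poly [:1, - 1 :: complex:]" by auto
    then show "(\<lambda>t. t) \<in> poly_functions" "(\<lambda>t. 1 - t) \<in> poly_functions" unfolding poly_functions_def by blast+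
  qed
  have lin: "coeffs_in poly_functions (\<lambda>t. smult (1 - t) p + smult t q)" for p q
    unfolding coeffs_in_def coeff_add coeff_smult
    by (intro allI function_algebra_add[OF F] function_algebra_mult[OF F] id function_algebra_const[OF F])
  have Rc: "coeffs_in poly_functions (\<lambda>t. R t $$ (i, j))" if ij: "i < n" "j < n" for i j
  proof -
    have "coeffs_in poly_functions (\<lambda>t. \<Sum>l<n - 1. ct t l i * st t l j)"
      unfolding ct_def st_def by (intro coeffs_in_sum[OF F] coeffs_in_mult[OF F] lin)
    then show ?thesis using ij by (simp add: R_def)
  qed
  have "(\<lambda>t. det (det_jacobian n k (R t))) \<in> poly_functions"
  proof (rule function_algebra_det[OF F])
    show "det_jacobian n k (R t) \<in> carrier_mat (Suc (k * n)) (Suc (k * n))" for t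
      by (simp add: det_jacobian_def)
    fix p m assume pm: "p < Suc (k * n)" "m < Suc (k * n)"
    then have ei: "entry_index n k m < n" using entry_index_exponent(1)[OF _ n k] by simp
    have "coeffs_in poly_functions (\<lambda>t. monom 1 (entry_exponent n k m) * cofactor (R t) (entry_index n k m) (entry_index n k m))"
      by (intro coeffs_in_mult[OF F] coeffs_in_const[OF F] coeffs_in_cofactor[OF F R Rc] ei)
    then show "(\<lambda>t. det_jacobian n k (R t) $$ (p, m)) \<in> poly_functions"
      using pm by (simp add: coeffs_in_def det_jacobian_def)
  qed
  moreover have "det (det_jacobian n k (R 1)) \<noteq> 0"
    unfolding R1 using det_jacobian_model_matrix[OF n k, of a b] a by (simp add: b_def)
  ultimately have ev1: "eventually (\<lambda>t. det (det_jacobian n k (R t)) \<noteq> 0) (at 0)"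
    using poly_function_nonzero_near[of "\<lambda>t. det (det_jacobian n k (R t))" 1 0] by simp
  have ev: "eventually (\<lambda>t. cmod (coeff (R t $$ (i, j) - Q $$ (i, j)) m) < \<epsilon>) (at 0)"
    if ij: "i < n" "j < n" for i j m
  proof -
    have "(\<lambda>t. coeff (R t $$ (i, j)) m) \<in> poly_functions" using Rc[OF ij] by (simp add: coeffs_in_def)
    from tendstoD[OF poly_function_tendsto[OF this, of 0] \<epsilon>] show ?thesis
      by (simp add: dist_norm R0)
  qed
  have "eventually (\<lambda>t. \<forall>i\<in>{..<n}. \<forall>j\<in>{..<n}. \<forall>m\<in>{..k}. cmod (coeff (R t $$ (i, j) - Q $$ (i, j)) m) < \<epsilon>) (at 0)"
    by (intro eventually_ball_finite finite_lessThan finite_atMost ballI ev) simp_all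
  from eventually_conj[OF ev1 this] obtain t where
    "det (det_jacobian n k (R t)) \<noteq> 0"
    "\<forall>i\<in>{..<n}. \<forall>j\<in>{..<n}. \<forall>m\<in>{..k}. cmod (coeff (R t $$ (i, j) - Q $$ (i, j)) m) < \<epsilon>"
    using eventually_happens'[OF at_neq_bot] by blast
  then show ?thesis using R deg det0 by (intro bexI[of _ "R t"]) auto
qed


section \<open>Singular matrix polynomials as limits\<close>

lemma coeff_mult_at_sum:
  fixes p q :: "'a :: comm_ring_1 poly"
  assumes "degree p \<le> d" "degree q \<le> e"
  shows "coeff (p * q) (d + e) = coeff p d * coeff q e"
proof -
  have "coeff (p * q) (d + e) = (\<Sum>i\<le>d + e. coeff p i * coeff q (d + e - i))" by (rule coeff_mult)
  also have "\<dots> = (\<Sum>i\<le>d + e. if i = d then coeff p d * coeff q e else 0)"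
  proof (rule sum.cong[OF refl])
    fix i assume "i \<in> {..d + e}"
    show "coeff p i * coeff q (d + e - i) = (if i = d then coeff p d * coeff q e else 0)"
    proof (cases "i = d")
      case False
      then have "i > d \<or> d + e - i > e" using \<open>i \<in> _\<close> by auto
      then show ?thesis using assms False by (auto simp: coeff_eq_0)
    qed simp
  qed
  also have "\<dots> = coeff p d * coeff q e" by simp
  finally show ?thesis .
qed

text \<open>In a Smith form of a singular matrix the last diagonal entry is \<open>0\<close>.\<close>

lemma singular_rank_one_sum:
  fixes Q :: "complex poly mat"
  assumes Q: "Q \<in> carrier_mat n n" and sing: "det Q = 0"
  shows "\<exists>c s. \<forall>i<n. \<forall>j<n. Q $$ (i, j) = (\<Sum>l<n - 1. c l i * s l j)"
proof -
  obtain E ds F where smith: "smith_form n Q E ds F" using smith_form_exists[OF Q] by blast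
  define D where "D = mat n n (\<lambda>(i, j). if i = j \<and> i < length ds then ds ! i else 0)"
  have E: "E \<in> carrier_mat n n" and F: "F \<in> carrier_mat n n" and Qeq: "Q = E * D * F"
    using smith by (auto simp: smith_form_def D_def)
  have D: "D \<in> carrier_mat n n" by (simp add: D_def)
  have l: "length ds \<le> n - 1" using smith_form_det_zero_iff[OF smith] sing by simp
  have "Q $$ (i, j) = (\<Sum>l<n - 1. (E $$ (i, l) * D $$ (l, l)) * F $$ (l, j))" if ij: "i < n" "j < n" for i j
  proof -
    have "(E * D) $$ (i, l) = E $$ (i, l) * D $$ (l, l)" if "l < n" for l
    proof -
      have "(E * D) $$ (i, l) = (\<Sum>m<n. if m = l then E $$ (i, l) * D $$ (l, l) else 0)"
        unfolding mult_mat_entry[OF E D ij(1) that] using that by (intro sum.cong) (auto simp: D_def)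
      then show ?thesis using that by simp
    qed
    then have "Q $$ (i, j) = (\<Sum>l<n. (E $$ (i, l) * D $$ (l, l)) * F $$ (l, j))"
      unfolding Qeq mult_mat_entry[OF mult_carrier_mat[OF E D] F ij] by (intro sum.cong) auto
    also have "\<dots> = (\<Sum>l<n - 1. (E $$ (i, l) * D $$ (l, l)) * F $$ (l, j))"
    proof (rule sum.mono_neutral_right)
      show "\<forall>m\<in>{..<n} - {..<n - 1}. E $$ (i, m) * D $$ (m, m) * F $$ (m, j) = 0"
        using l by (auto simp: D_def)
    qed auto
    finally show ?thesis .
  qed
  then show ?thesis
    by (intro exI[of _ "\<lambda>l i. E $$ (i, l) * D $$ (l, l)"] exI[of _ "\<lambda>l j. F $$ (l, j)"] allI impI)
qed

text \<open>One more than the degree of a nonzero row, and \<open>0\<close> for the zero row. Zero rows need no special treatment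
in the minimization below.\<close>

definition row_size :: "nat \<Rightarrow> (nat \<Rightarrow> complex poly) \<Rightarrow> nat" where
  "row_size n x = (LEAST m. \<forall>j<n. \<forall>i\<ge>m. coeff (x j) i = 0)"

lemma row_size_le: "(\<And>j i. j < n \<Longrightarrow> i \<ge> m \<Longrightarrow> coeff (x j) i = 0) \<Longrightarrow> row_size n x \<le> m"
  unfolding row_size_def by (rule Least_le) auto

lemma coeff_row_size:
  assumes "j < n" "i \<ge> row_size n x"
  shows "coeff (x j) i = 0"
proof -
  have "\<forall>j<n. \<forall>i \<ge> Suc (\<Sum>j<n. degree (x j)). coeff (x j) i = 0"
  proof (intro allI impI)
    fix j i assume "j < n" "Suc (\<Sum>j<n. degree (x j)) \<le> i"
    moreover have "degree (x j) \<le> (\<Sum>j<n. degree (x j))" by (rule member_le_sum) (use \<open>j < n\<close> in auto)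
    ultimately show "coeff (x j) i = 0" by (intro coeff_eq_0) simp
  qed
  then have "\<forall>j<n. \<forall>i \<ge> row_size n x. coeff (x j) i = 0"
    unfolding row_size_def by (rule LeastI)
  then show ?thesis using assms by blast
qed

lemma degree_row_size: "j < n \<Longrightarrow> row_size n x > 0 \<Longrightarrow> degree (x j) \<le> row_size n x - 1"
  by (rule degree_le) (auto intro: coeff_row_size)

text \<open>The predictable degree property. If the total size of the rows \<open>s\<^sub>l\<close> is minimal among all factorizations,
no cancellation of leading terms can occur in \<open>\<Sum>\<^sub>l c\<^sub>l s\<^sub>l\<close>: a cancellation is a linear relation between
the leading coefficient vectors of some rows, and using it to eliminate the leading term of the longest of
these rows shortens that row. So every summand obeys the degree bound of \<open>Q\<close>.\<close>

lemma row_reduced_degree_bound: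
  fixes c s :: "nat \<Rightarrow> nat \<Rightarrow> complex poly"
  assumes eq: "\<And>i j. i < n \<Longrightarrow> j < n \<Longrightarrow> Q $$ (i, j) = (\<Sum>l<q. c l i * s l j)"
    and deg: "\<And>i j. i < n \<Longrightarrow> j < n \<Longrightarrow> degree (Q $$ (i, j)) \<le> k"
    and minimal: "\<And>c' s'. (\<And>i j. i < n \<Longrightarrow> j < n \<Longrightarrow> Q $$ (i, j) = (\<Sum>l<q. c' l i * s' l j)) \<Longrightarrow>
       (\<Sum>l<q. row_size n (s l)) \<le> (\<Sum>l<q. row_size n (s' l))"
    and l: "l < q" and i: "i < n" and nz: "row_size n (s l) > 0" "c l i \<noteq> 0"
  shows "degree (c l i) + (row_size n (s l) - 1) \<le> k"
proof (rule ccontr)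
  assume big: "\<not> ?thesis"
  define A where "A = (\<lambda>l. row_size n (s l) - 1)"
  define L0 where "L0 = {l. l < q \<and> row_size n (s l) > 0 \<and> c l i \<noteq> 0}"
  define M where "M = Max ((\<lambda>l. degree (c l i) + A l) ` L0)"
  have fin: "finite L0" by (simp add: L0_def)
  have lL0: "l \<in> L0" using l nz by (simp add: L0_def)
  have Mle: "degree (c m i) + A m \<le> M" if "m \<in> L0" for m
    unfolding M_def using fin that by (intro Max_ge) auto
  have Mk: "M > k" using Mle[OF lL0] big by (simp add: A_def)
  \<comment> \<open>\<open>L\<close> collects the summands that contribute to degree \<open>M\<close>, and \<open>l0\<close> is a longest row among them.\<close>
  define L where "L = {m \<in> L0. degree (c m i) + A m = M}"
  have "M \<in> (\<lambda>l. degree (c l i) + A l) ` L0" unfolding M_def using fin lL0 by (intro Max_in) auto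
  then have "L \<noteq> {}" by (auto simp: L_def)
  have finL: "finite L" using fin by (simp add: L_def)
  obtain l0 where l0: "l0 \<in> L" and l0max: "\<And>m. m \<in> L \<Longrightarrow> A m \<le> A l0"
  proof -
    have "Max (A ` L) \<in> A ` L" using finL \<open>L \<noteq> {}\<close> by (intro Max_in) auto
    then obtain l0 where "l0 \<in> L" "A l0 = Max (A ` L)" by auto
    then show ?thesis using finL by (intro that[of l0]) auto
  qed
  have l0q: "l0 < q" and l0s: "row_size n (s l0) > 0" and l0c: "c l0 i \<noteq> 0"
    using l0 by (auto simp: L_def L0_def)
  have Lq: "L \<subseteq> {..<q}" by (auto simp: L_def L0_def)
  have dsA: "degree (s m j) \<le> A m" if "m \<in> L0" "j < n" for m j
    unfolding A_def using that by (intro degree_row_size) (auto simp: L0_def)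
  have rel: "(\<Sum>m\<in>L. lead_coeff (c m i) * coeff (s m j) (A m)) = 0" if j: "j < n" for j
  proof -
    have "coeff (Q $$ (i, j)) M = 0" using deg[OF i j] Mk by (intro coeff_eq_0) simp
    then have "0 = (\<Sum>m<q. coeff (c m i * s m j) M)" unfolding eq[OF i j] coeff_sum by simp
    also have "\<dots> = (\<Sum>m\<in>L. coeff (c m i * s m j) M)"
    proof (rule sum.mono_neutral_right)
      show "\<forall>m\<in>{..<q} - L. coeff (c m i * s m j) M = 0"
      proof
        fix m assume m: "m \<in> {..<q} - L"
        show "coeff (c m i * s m j) M = 0"
        proof (cases "m \<in> L0")
          case True
          then have "degree (c m i) + A m < M" using m Mle[OF True] by (auto simp: L_def)
          moreover have "degree (c m i * s m j) \<le> degree (c m i) + A m"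
            using degree_mult_le[of "c m i" "s m j"] dsA[OF True j] by linarith
          ultimately show ?thesis by (intro coeff_eq_0) simp
        next
          case False
          have "s m j = 0" if "row_size n (s m) = 0"
            using coeff_row_size[OF j, of "s m"] that by (intro poly_eqI) simp
          then show ?thesis using False m by (auto simp: L0_def)
        qed
      qed
    qed (use Lq in auto)
    also have "\<dots> = (\<Sum>m\<in>L. lead_coeff (c m i) * coeff (s m j) (A m))"
    proof (rule sum.cong[OF refl])
      fix m assume m: "m \<in> L"
      then have M: "M = degree (c m i) + A m" and m0: "m \<in> L0" by (auto simp: L_def)
      show "coeff (c m i * s m j) M = lead_coeff (c m i) * coeff (s m j) (A m)"
        unfolding M by (rule coeff_mult_at_sum[OF order_refl dsA[OF m0 j]])
    qed
    finally show ?thesis by simp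
  qed
  \<comment> \<open>Row \<open>l0\<close> absorbs shifted multiples of the other rows in \<open>L\<close>, and the columns of these rows compensate.\<close>
  define \<beta> where "\<beta> = (\<lambda>m. lead_coeff (c m i) / lead_coeff (c l0 i))"
  define \<mu> where "\<mu> = (\<lambda>m. monom (\<beta> m) (A l0 - A m))"
  define s' where "s' = s(l0 := \<lambda>j. s l0 j + (\<Sum>m\<in>L - {l0}. \<mu> m * s m j))"
  define c' where "c' = (\<lambda>m. if m \<in> L - {l0} then (\<lambda>i. c m i - \<mu> m * c l0 i) else c m)"
  have eq': "Q $$ (i', j) = (\<Sum>m<q. c' m i' * s' m j)" if ij: "i' < n" "j < n" for i' j
  proof -
    have "(\<Sum>m<q. c' m i' * s' m j) = (\<Sum>m<q. c m i' * s m j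
       + (if m = l0 then c l0 i' * (\<Sum>m\<in>L - {l0}. \<mu> m * s m j) else 0)
       - (if m \<in> L - {l0} then c l0 i' * (\<mu> m * s m j) else 0))"
      by (intro sum.cong) (auto simp: c'_def s'_def algebra_simps)
    also have "\<dots> = (\<Sum>m<q. c m i' * s m j) + c l0 i' * (\<Sum>m\<in>L - {l0}. \<mu> m * s m j)
       - (\<Sum>m<q. if m \<in> L - {l0} then c l0 i' * (\<mu> m * s m j) else 0)"
      using l0q by (simp add: sum.distrib sum_subtractf)
    also have "(\<Sum>m<q. if m \<in> L - {l0} then c l0 i' * (\<mu> m * s m j) else 0)
       = (\<Sum>m\<in>L - {l0}. c l0 i' * (\<mu> m * s m j))"
      using Lq by (intro sum.mono_neutral_cong_right) auto
    also have "\<dots> = c l0 i' * (\<Sum>m\<in>L - {l0}. \<mu> m * s m j)" by (rule sum_distrib_left[symmetric])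
    finally show ?thesis using eq[OF ij] by simp
  qed
  have "row_size n (s' l0) \<le> A l0"
  proof (rule row_size_le)
    fix j t assume j: "j < n" and t: "t \<ge> A l0"
    have shift: "coeff (\<mu> m * s m j) t = \<beta> m * coeff (s m j) (t - (A l0 - A m))" if "m \<in> L" for m
      unfolding \<mu>_def coeff_monom_mult using t by simp
    have "coeff (s' l0 j) t = coeff (s l0 j) t + (\<Sum>m\<in>L - {l0}. \<beta> m * coeff (s m j) (t - (A l0 - A m)))"
      using shift by (simp add: s'_def coeff_sum)
    also have "\<dots> = 0"
    proof (cases "t = A l0")
      case True
      have "coeff (s l0 j) t + (\<Sum>m\<in>L - {l0}. \<beta> m * coeff (s m j) (t - (A l0 - A m)))
         = coeff (s l0 j) (A l0) + (\<Sum>m\<in>L - {l0}. \<beta> m * coeff (s m j) (A m))"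
        using True l0max by (intro arg_cong2[where f = "(+)"] sum.cong) auto
      also have "\<dots> = \<beta> l0 * coeff (s l0 j) (A l0) + (\<Sum>m\<in>L - {l0}. \<beta> m * coeff (s m j) (A m))"
        using l0c by (simp add: \<beta>_def)
      also have "\<dots> = (\<Sum>m\<in>L. \<beta> m * coeff (s m j) (A m))"
        using finL l0 by (simp add: sum.remove)
      also have "\<dots> = (\<Sum>m\<in>L. lead_coeff (c m i) * coeff (s m j) (A m)) / lead_coeff (c l0 i)"
        by (simp add: \<beta>_def sum_divide_distrib)
      finally show ?thesis using rel[OF j] by simp
    next
      case False
      then have t: "t > A l0" using t by simp
      have z: "coeff (s m j) u = 0" if m: "m \<in> L" and u: "u > A m" for m u
      proof (rule coeff_eq_0)
        have "degree (s m j) \<le> A m" using m by (intro dsA j) (simp add: L_def)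
        then show "degree (s m j) < u" using u by simp
      qed
      have "coeff (s m j) (t - (A l0 - A m)) = 0" if m: "m \<in> L" for m
      proof (rule z[OF m])
        show "A m < t - (A l0 - A m)" using t l0max[OF m] by linarith
      qed
      then show ?thesis using z[OF l0 t] by simp
    qed
    finally show "coeff (s' l0 j) t = 0" .
  qed
  then have less: "row_size n (s' l0) < row_size n (s l0)" using l0s by (simp add: A_def)
  have "(\<Sum>m<q. row_size n (s' m)) < (\<Sum>m<q. row_size n (s m))"
  proof (rule sum_strict_mono_ex1)
    show "\<forall>m\<in>{..<q}. row_size n (s' m) \<le> row_size n (s m)" using less by (auto simp: s'_def)
    show "\<exists>m\<in>{..<q}. row_size n (s' m) < row_size n (s m)" using less l0q by blast
  qed simp
  then show False using minimal[of c' s', OF eq'] by simp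
qed

lemma singular_factorization:
  fixes Q :: "complex poly mat"
  assumes Q: "Q \<in> carrier_mat n n" and sing: "det Q = 0"
    and deg: "\<And>i j. i < n \<Longrightarrow> j < n \<Longrightarrow> degree (Q $$ (i, j)) \<le> k"
  shows "\<exists>a c s. (\<forall>l<n - 1. a l \<le> k \<and> (\<forall>j<n. degree (s l j) \<le> a l \<and> degree (c l j) \<le> k - a l)) \<and>
     Q = mat n n (\<lambda>(i, j). \<Sum>l<n - 1. c l i * s l j)"
proof -
  define S where "S = (\<lambda>cs. \<forall>i<n. \<forall>j<n. Q $$ (i, j) = (\<Sum>l<n - 1. fst cs l i * snd cs l j))"
  obtain c0 s0 where "\<forall>i<n. \<forall>j<n. Q $$ (i, j) = (\<Sum>l<n - 1. c0 l i * s0 l j)"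
    using singular_rank_one_sum[OF Q sing] by blast
  then have "S (c0, s0)" by (simp add: S_def)
  from ex_has_least_nat[of S, OF this, of "\<lambda>y. \<Sum>l<n - 1. row_size n (snd y l)"]
  obtain cs where cs: "S cs"
    and least: "\<And>y. S y \<Longrightarrow> (\<Sum>l<n - 1. row_size n (snd cs l)) \<le> (\<Sum>l<n - 1. row_size n (snd y l))"
    by (elim exE conjE) (erule that, erule allE, erule mp)
  define c s where "c = fst cs" and "s = snd cs"
  have eq: "\<And>i j. i < n \<Longrightarrow> j < n \<Longrightarrow> Q $$ (i, j) = (\<Sum>l<n - 1. c l i * s l j)"
    using cs by (simp add: S_def c_def s_def)
  have minimal: "(\<Sum>l<n - 1. row_size n (s l)) \<le> (\<Sum>l<n - 1. row_size n (s' l))"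
    if "\<And>i j. i < n \<Longrightarrow> j < n \<Longrightarrow> Q $$ (i, j) = (\<Sum>l<n - 1. c' l i * s' l j)" for c' s'
    using least[of "(c', s')"] that by (simp add: S_def s_def)
  \<comment> \<open>Summands that vanish identically are replaced by zero factors, for which the degree bound is trivial.\<close>
  define active where "active = (\<lambda>l. row_size n (s l) > 0 \<and> (\<exists>i<n. c l i \<noteq> 0))"
  define a where "a = (\<lambda>l. if active l then row_size n (s l) - 1 else 0)"
  define c' where "c' = (\<lambda>l. if active l then c l else (\<lambda>_. 0))"
  define s' where "s' = (\<lambda>l. if active l then s l else (\<lambda>_. 0))"
  have bound: "degree (c l i) + (row_size n (s l) - 1) \<le> k"
    if "l < n - 1" "i < n" "row_size n (s l) > 0" "c l i \<noteq> 0" for l i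
    by (rule row_reduced_degree_bound[where n = n and Q = Q and q = "n - 1" and c = c and s = s and k = k, OF eq deg minimal that(1,2,3,4)])
  have "a l \<le> k \<and> (\<forall>j<n. degree (s' l j) \<le> a l \<and> degree (c' l j) \<le> k - a l)" if l: "l < n - 1" for l
  proof (cases "active l")
    case True
    then obtain i where i: "i < n" "c l i \<noteq> 0" and r: "row_size n (s l) > 0" by (auto simp: active_def)
    have ak: "a l \<le> k" using bound[OF l i(1) r i(2)] True by (simp add: a_def)
    moreover have "degree (c l j) \<le> k - a l" if "j < n" for j
      using bound[OF l that r] True by (cases "c l j = 0") (auto simp: a_def)
    ultimately show ?thesis using True degree_row_size[OF _ r] by (auto simp: a_def c'_def s'_def)
  next
    case False
    then show ?thesis by (simp add: a_def c'_def s'_def)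
  qed
  moreover have "Q = mat n n (\<lambda>(i, j). \<Sum>l<n - 1. c' l i * s' l j)"
  proof (rule eq_matI)
    fix i j assume "i < dim_row (mat n n (\<lambda>(i, j). \<Sum>l<n - 1. c' l i * s' l j))"
      "j < dim_col (mat n n (\<lambda>(i, j). \<Sum>l<n - 1. c' l i * s' l j))"
    then have ij: "i < n" "j < n" by auto
    have "c l i * s l j = c' l i * s' l j" for l
    proof (cases "active l")
      case True
      then show ?thesis by (simp add: c'_def s'_def)
    next
      case False
      then have "row_size n (s l) = 0 \<or> c l i = 0" using ij by (auto simp: active_def)
      moreover have "s l j = 0" if "row_size n (s l) = 0"
        using coeff_row_size[OF ij(2), of "s l"] that by (intro poly_eqI) simp
      ultimately show ?thesis using False by (auto simp: c'_def)
    qed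
    then show "Q $$ (i, j) = mat n n (\<lambda>(i, j). \<Sum>l<n - 1. c' l i * s' l j) $$ (i, j)"
      using ij by (simp add: eq)
  qed (use Q in auto)
  ultimately show ?thesis by blast
qed

text \<open>The Jordan chain is a column of the adjugate of the approximating matrix \<open>R\<close>, since \<open>R adj R = det R\<close> is a
multiple of \<open>(\<lambda> - a)\<^sup>k\<^sup>n\<close>.\<close>

lemma singular_matrix_limit_of_elementary_divisor:
  assumes Q: "Q \<in> carrier_mat n n" and sing: "det Q = 0" and nk: "n > 0" "k > 0"
    and deg: "\<And>i j. i < n \<Longrightarrow> j < n \<Longrightarrow> degree (Q $$ (i, j)) \<le> k" and \<epsilon>: "\<epsilon> > 0"
  shows "\<exists>R \<in> carrier_mat n n. (\<forall>i<n. \<forall>j<n. degree (R $$ (i, j)) \<le> k \<and>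
       (\<forall>m\<le>k. cmod (coeff (R $$ (i, j) - Q $$ (i, j)) m) < \<epsilon>)) \<and>
     (\<exists>c\<ge>k * n. elementary_divisor n R a c)"
proof -
  obtain d c s where d: "\<And>l. l < n - 1 \<Longrightarrow> d l \<le> k"
    and s: "\<And>l j. l < n - 1 \<Longrightarrow> j < n \<Longrightarrow> degree (s l j) \<le> d l"
    and c: "\<And>l j. l < n - 1 \<Longrightarrow> j < n \<Longrightarrow> degree (c l j) \<le> k - d l"
    and Qeq: "Q = mat n n (\<lambda>(i, j). \<Sum>l<n - 1. c l i * s l j)"
    using singular_factorization[OF Q sing deg] by blast
  have \<epsilon>2: "\<epsilon> / 2 > 0" using \<epsilon> by simp
  obtain S where S: "S \<in> carrier_mat n n" and degS: "\<And>i j. i < n \<Longrightarrow> j < n \<Longrightarrow> degree (S $$ (i, j)) \<le> k"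
    and close: "\<And>i j m. i < n \<Longrightarrow> j < n \<Longrightarrow> m \<le> k \<Longrightarrow> cmod (coeff (S $$ (i, j) - Q $$ (i, j)) m) < \<epsilon> / 2"
    and detS: "det S = 0" and jac: "det (det_jacobian n k S) \<noteq> 0"
    using exists_nearby_surjective_point[OF nk d s c Qeq \<epsilon>2] by blast
  define \<tau> where "\<tau> = [:- a, 1:] ^ (k * n)"
  have deg\<tau>: "degree \<tau> \<le> k * n" unfolding \<tau>_def by (simp add: degree_power_eq)
  \<comment> \<open>Up to \<open>k n + 1\<close> directions meet in one entry, and half of \<open>\<epsilon>\<close> is already spent on \<open>S\<close>.\<close>
  define \<eta> where "\<eta> = \<epsilon> / (2 * real (Suc (k * n)))"
  have \<eta>: "\<eta> > 0" unfolding \<eta>_def using \<epsilon> by (simp del: of_nat_Suc)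
  obtain w e i where w: "\<And>m. m \<le> k * n \<Longrightarrow> cmod (w m) \<le> \<eta>" and e: "e \<noteq> 0"
    and detR: "det (perturb_diagonal n k S w) = smult e \<tau>"
    and i: "i < n" and cof: "poly (cofactor (perturb_diagonal n k S w) i i) a \<noteq> 0"
    using exists_perturbation_with_det[OF S nk degS detS jac deg\<tau> \<eta>, of a] by blast
  define R where "R = perturb_diagonal n k S w"
  have R: "R \<in> carrier_mat n n" unfolding R_def by (rule perturb_diagonal_carrier)
  have degR: "degree (R $$ (i, j)) \<le> k" if "i < n" "j < n" for i j
    unfolding R_def by (rule degree_perturb_diagonal_le[OF nk degS that])
  have near: "cmod (coeff (R $$ (i, j) - Q $$ (i, j)) m) < \<epsilon>" if ij: "i < n" "j < n" and m: "m \<le> k" for i j m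
  proof -
    have "cmod (coeff (\<Sum>m\<le>k * n. if entry_index n k m = i then monom (w m) (entry_exponent n k m) else 0) m)
       \<le> (\<Sum>m\<le>k * n. \<eta>)"
      unfolding coeff_sum using w \<eta> by (intro sum_norm_le) auto
    also have "\<dots> = real (Suc (k * n)) * \<eta>" by simp
    also have "\<dots> = \<epsilon> / 2" unfolding \<eta>_def by (simp only: times_divide_eq_right) (simp del: of_nat_Suc)
    finally have "cmod (coeff (R $$ (i, j) - S $$ (i, j)) m) \<le> \<epsilon> / 2"
      using ij \<epsilon> by (cases "i = j") (simp_all add: R_def perturb_diagonal_def)
    then have "cmod (coeff (R $$ (i, j) - S $$ (i, j)) m) + cmod (coeff (S $$ (i, j) - Q $$ (i, j)) m) < \<epsilon> / 2 + \<epsilon> / 2"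
      by (rule add_le_less_mono[OF _ close[OF ij m]])
    moreover have "coeff (R $$ (i, j) - Q $$ (i, j)) m =
        coeff (R $$ (i, j) - S $$ (i, j)) m + coeff (S $$ (i, j) - Q $$ (i, j)) m" by simp
    ultimately show ?thesis by (metis norm_triangle_ineq order_le_less_trans field_sum_of_halves)
  qed
  note adj = adj_mat[OF R]
  have "\<exists>c\<ge>k * n. elementary_divisor n R a c"
  proof (rule elementary_divisor_of_jordan_chain[OF R, where x = "\<lambda>j. adj_mat R $$ (j, i)"])
    show "det R \<noteq> 0" using e by (simp add: R_def detR \<tau>_def)
    show "1 \<le> k * n" using nk by simp
    show "i < n" by (rule i)
    show "poly (adj_mat R $$ (i, i)) a \<noteq> 0" using cof i R by (simp add: adj_mat_def R_def)
    fix i' assume i': "i' < n"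
    have "(\<Sum>j<n. R $$ (i', j) * adj_mat R $$ (j, i)) = (if i' = i then det R else 0)"
      unfolding mult_mat_entry[OF R adj(1) i' i, symmetric] adj(2) using i i' by simp
    also have "[:- a, 1:] ^ (k * n) dvd \<dots>" by (auto simp: R_def detR \<tau>_def intro: dvd_smult)
    finally show "[:- a, 1:] ^ (k * n) dvd (\<Sum>j<n. R $$ (i', j) * adj_mat R $$ (j, i))" .
  qed
  then show ?thesis using R degR near by blast
qed


section \<open>Singular values and norms\<close>

text \<open>The definition takes square roots of real parts of eigenvalues \<open>z\<close> of \<open>A\<^sup>* A\<close>. They are nonnegative by
\<open>z \<parallel>x\<parallel>\<^sup>2 = \<parallel>A x\<parallel>\<^sup>2\<close>.\<close>

lemma singular_value_nonneg:
  assumes A: "A \<in> carrier_mat m n" and i: "0 < i" "i \<le> n"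
  shows "singular_value i A \<ge> 0"
proof -
  define H where "H = mat_adjoint A * A"
  have Aa: "mat_adjoint A \<in> carrier_mat n m" using A by simp
  have H: "H \<in> carrier_mat n n" unfolding H_def by (rule mult_carrier_mat[OF Aa A])
  define MM where "MM = image_mset (\<lambda>z. sqrt (Re z)) (proots (char_poly H))"
  have sv: "singular_values A = rev (sorted_list_of_multiset MM)"
    by (simp add: singular_values_def MM_def H_def)
  have "size MM = n"
    by (simp add: MM_def size_proots_complex degree_monic_char_poly[OF H])
  then have "i - 1 < length (singular_values A)"
    using i unfolding sv length_rev size_mset[symmetric] mset_sorted_list_of_multiset by simp
  then have "singular_value i A \<in> set (singular_values A)" unfolding singular_value_def by (rule nth_mem)
  then have "singular_value i A \<in># MM" unfolding sv by simp
  then obtain z where z: "z \<in># proots (char_poly H)" and sz: "singular_value i A = sqrt (Re z)"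
    by (auto simp: MM_def)
  have "char_poly H \<noteq> 0" using degree_monic_char_poly[OF H] by auto
  then have "poly (char_poly H) z = 0" using z by simp
  then have "eigenvalue H z" using eigenvalue_root_char_poly[OF H] by simp
  then obtain x where x: "x \<in> carrier_vec n" "x \<noteq> 0\<^sub>v n" "H *\<^sub>v x = z \<cdot>\<^sub>v x"
    using H by (auto simp: eigenvalue_def eigenvector_def)
  define y where "y = A *\<^sub>v x"
  have y: "y \<in> carrier_vec m" unfolding y_def by (rule mult_mat_vec_carrier[OF A x(1)])
  have "mat_adjoint A *\<^sub>v y = z \<cdot>\<^sub>v x"
    unfolding y_def assoc_mult_mat_vec[OF Aa A x(1), symmetric] H_def[symmetric] by (rule x(3))
  then have zx: "z * x $ j = (\<Sum>l<m. mat_adjoint A $$ (j, l) * y $ l)" if "j < n" for j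
    using mult_mat_vec_entry[OF Aa y that] that x(1) by simp
  have adj: "mat_adjoint A $$ (j, l) = cnj (A $$ (l, j))" if "j < n" "l < m" for j l
    using that A by simp
  have "z * (\<Sum>j<n. cnj (x $ j) * x $ j) = (\<Sum>j<n. cnj (x $ j) * (z * x $ j))"
    by (simp add: sum_distrib_left mult_ac)
  also have "\<dots> = (\<Sum>j<n. \<Sum>l<m. cnj (A $$ (l, j) * x $ j) * y $ l)"
    using zx adj by (intro sum.cong refl) (simp add: sum_distrib_left mult_ac)
  also have "\<dots> = (\<Sum>l<m. cnj (\<Sum>j<n. A $$ (l, j) * x $ j) * y $ l)"
    by (subst sum.swap) (simp add: sum_distrib_right)
  also have "\<dots> = (\<Sum>l<m. cnj (y $ l) * y $ l)"
    unfolding y_def using mult_mat_vec_entry[OF A x(1)] by (intro sum.cong) auto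
  also have "\<dots> = complex_of_real (\<Sum>l<m. (cmod (y $ l))\<^sup>2)"
    unfolding of_real_sum by (intro sum.cong refl) (simp only: complex_norm_square mult.commute)
  also have "(\<Sum>j<n. cnj (x $ j) * x $ j) = complex_of_real (\<Sum>j<n. (cmod (x $ j))\<^sup>2)"
    unfolding of_real_sum by (intro sum.cong refl) (simp only: complex_norm_square mult.commute)
  finally have eq: "z * complex_of_real (\<Sum>j<n. (cmod (x $ j))\<^sup>2) = complex_of_real (\<Sum>l<m. (cmod (y $ l))\<^sup>2)" .
  have "Re z * (\<Sum>j<n. (cmod (x $ j))\<^sup>2) = (\<Sum>l<m. (cmod (y $ l))\<^sup>2)"
    using arg_cong[OF eq, of Re] by (simp del: of_real_sum of_real_power)
  moreover have "(\<Sum>j<n. (cmod (x $ j))\<^sup>2) > 0"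
  proof -
    obtain j where "j < n" "x $ j \<noteq> 0" using x(1,2) by (metis carrier_vecD eq_vecI index_zero_vec)
    then show ?thesis by (intro sum_pos2[of _ j]) auto
  qed
  moreover have "(\<Sum>l<m. (cmod (y $ l))\<^sup>2) \<ge> 0" by (simp add: sum_nonneg)
  ultimately have "Re z \<ge> 0" by (metis mult_neg_pos not_le)
  then show ?thesis unfolding sz by simp
qed

lemma vec_norm2_add_le:
  assumes "v \<in> carrier_vec m" "w \<in> carrier_vec m"
  shows "vec_norm2 (v + w) \<le> vec_norm2 v + vec_norm2 w"
proof -
  have "vec_norm2 (v + w) \<le> L2_set (\<lambda>i. cmod (v $ i) + cmod (w $ i)) {..<m}"
    unfolding vec_norm2_def using assms by (auto intro!: L2_set_mono norm_triangle_ineq)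
  also have "\<dots> \<le> vec_norm2 v + vec_norm2 w"
    unfolding vec_norm2_def using assms L2_set_triangle_ineq by auto
  finally show ?thesis .
qed

lemma vec_norm2_mult_le_entries:
  assumes A: "A \<in> carrier_mat m n" and x: "x \<in> carrier_vec n" "vec_norm2 x = 1"
  shows "vec_norm2 (A *\<^sub>v x) \<le> (\<Sum>i<m. \<Sum>j<n. cmod (A $$ (i, j)))"
proof -
  have x1: "cmod (x $ j) \<le> 1" if "j < n" for j
    using member_le_L2_set[of "{..<n}" j "\<lambda>i. cmod (x $ i)"] x that by (simp add: vec_norm2_def)
  have "vec_norm2 (A *\<^sub>v x) = L2_set (\<lambda>i. cmod ((A *\<^sub>v x) $ i)) {..<m}"
    using A by (simp add: vec_norm2_def)
  also have "\<dots> \<le> (\<Sum>i<m. cmod ((A *\<^sub>v x) $ i))" by (rule L2_set_le_sum) simp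
  also have "\<dots> \<le> (\<Sum>i<m. \<Sum>j<n. cmod (A $$ (i, j)))"
  proof (rule sum_mono)
    fix i assume "i \<in> {..<m}"
    then have i: "i < m" by simp
    show "cmod ((A *\<^sub>v x) $ i) \<le> (\<Sum>j<n. cmod (A $$ (i, j)))"
      unfolding mult_mat_vec_entry[OF A x(1) i]
      using x1 by (intro sum_norm_le) (simp add: norm_mult mult_left_le)
  qed
  finally show ?thesis .
qed

lemma bdd_above_spectral_norm:
  assumes A: "A \<in> carrier_mat m n"
  shows "bdd_above ((\<lambda>x. vec_norm2 (A *\<^sub>v x)) ` {x \<in> carrier_vec (dim_col A). vec_norm2 x = 1})"
  by (rule bdd_aboveI2[where M = "\<Sum>i<m. \<Sum>j<n. cmod (A $$ (i, j))"])
     (use A vec_norm2_mult_le_entries[OF A] in auto)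

lemma exists_unit_vector:
  assumes "n > 0"
  shows "{x \<in> carrier_vec n. vec_norm2 x = 1} \<noteq> {}"
proof -
  have "vec_norm2 (unit_vec n 0) = sqrt (\<Sum>i<n. if i = 0 then 1 else 0)"
    unfolding vec_norm2_def L2_set_def by (intro arg_cong[where f = sqrt] sum.cong) auto
  also have "\<dots> = 1" using assms by simp
  finally show ?thesis by (auto intro!: exI[of _ "unit_vec n 0"])
qed

lemma spectral_norm_le:
  assumes A: "A \<in> carrier_mat m n" and B: "B \<in> carrier_mat m n" and n: "n > 0"
  shows "spectral_norm A \<le> spectral_norm B + (\<Sum>i<m. \<Sum>j<n. cmod (A $$ (i, j) - B $$ (i, j)))"
  unfolding spectral_norm_def[of A]
proof (rule cSUP_least)
  show "{x \<in> carrier_vec (dim_col A). vec_norm2 x = 1} \<noteq> {}" using exists_unit_vector[OF n] A by simp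
  fix x assume "x \<in> {x \<in> carrier_vec (dim_col A). vec_norm2 x = 1}"
  then have x: "x \<in> carrier_vec n" "vec_norm2 x = 1" using A by auto
  have AB: "A - B \<in> carrier_mat m n" using minus_carrier_mat[OF B] .
  have "A *\<^sub>v x = B *\<^sub>v x + (A - B) *\<^sub>v x"
    unfolding minus_mult_distrib_mat_vec[OF A B x(1)] using A B by (intro eq_vecI) auto
  then have "vec_norm2 (A *\<^sub>v x) \<le> vec_norm2 (B *\<^sub>v x) + vec_norm2 ((A - B) *\<^sub>v x)"
    using vec_norm2_add_le[OF mult_mat_vec_carrier[OF B x(1)] mult_mat_vec_carrier[OF AB x(1)]] by simp
  also have "vec_norm2 (B *\<^sub>v x) \<le> spectral_norm B"
    unfolding spectral_norm_def using B x by (intro cSUP_upper bdd_above_spectral_norm[OF B]) auto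
  also have "vec_norm2 ((A - B) *\<^sub>v x) \<le> (\<Sum>i<m. \<Sum>j<n. cmod ((A - B) $$ (i, j)))"
    by (rule vec_norm2_mult_le_entries[OF AB x])
  also have "\<dots> = (\<Sum>i<m. \<Sum>j<n. cmod (A $$ (i, j) - B $$ (i, j)))"
    using A B by (intro sum.cong) auto
  finally show "vec_norm2 (A *\<^sub>v x) \<le> spectral_norm B + (\<Sum>i<m. \<Sum>j<n. cmod (A $$ (i, j) - B $$ (i, j)))"
    by simp
qed

lemma spectral_norm_scaled_le:
  assumes A: "A \<in> carrier_mat m n" and B: "B \<in> carrier_mat m n" and n: "n > 0"
    and eq: "\<And>i j. i < m \<Longrightarrow> j < n \<Longrightarrow> A $$ (i, j) = c * B $$ (i, j)"
  shows "spectral_norm A \<le> cmod c * spectral_norm B"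
  unfolding spectral_norm_def[of A]
proof (rule cSUP_least)
  show "{x \<in> carrier_vec (dim_col A). vec_norm2 x = 1} \<noteq> {}" using exists_unit_vector[OF n] A by simp
  fix x assume "x \<in> {x \<in> carrier_vec (dim_col A). vec_norm2 x = 1}"
  then have x: "x \<in> carrier_vec n" "vec_norm2 x = 1" using A by auto
  have "(A *\<^sub>v x) $ i = c * (B *\<^sub>v x) $ i" if i: "i < m" for i
    unfolding mult_mat_vec_entry[OF A x(1) i] mult_mat_vec_entry[OF B x(1) i]
    using eq[OF i] by (simp add: sum_distrib_left mult.assoc)
  then have "vec_norm2 (A *\<^sub>v x) = L2_set (\<lambda>i. cmod c * cmod ((B *\<^sub>v x) $ i)) {..<m}"
    unfolding vec_norm2_def using A by (intro L2_set_cong) (auto simp: norm_mult)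
  also have "\<dots> = cmod c * vec_norm2 (B *\<^sub>v x)"
    unfolding vec_norm2_def using B by (simp add: L2_set_right_distrib)
  also have "\<dots> \<le> cmod c * spectral_norm B"
    unfolding spectral_norm_def using B x
    by (intro mult_left_mono cSUP_upper bdd_above_spectral_norm[OF B]) auto
  finally show "vec_norm2 (A *\<^sub>v x) \<le> cmod c * spectral_norm B" .
qed

lemma sum_blocks:
  fixes h :: "nat \<Rightarrow> 'a :: comm_monoid_add"
  shows "(\<Sum>b<m * n. h b) = (\<Sum>i<m. \<Sum>y<n. h (i * n + y))"
proof -
  have "(\<Sum>b<m * n. h b) = (\<Sum>i<m. sum h {i * n..<i * n + n})" by (rule sum.nat_group[symmetric])
  also have "\<dots> = (\<Sum>i<m. \<Sum>y<n. h (i * n + y))"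
  proof (rule sum.cong[OF refl])
    fix i
    show "sum h {i * n..<i * n + n} = (\<Sum>y<n. h (i * n + y))"
      using sum.shift_bounds_nat_ivl[of h 0 "i * n" n] by (simp add: add.commute atLeast0LessThan)
  qed
  finally show ?thesis .
qed

lemma block_index:
  fixes i k y n :: nat
  assumes "i \<le> k" "y < n"
  shows "i * n + y < (k + 1) * n" "(i * n + y) div n = i" "(i * n + y) mod n = y"
proof -
  have "i * n + y < Suc i * n" using assms by simp
  also have "\<dots> \<le> (k + 1) * n" using assms by (intro mult_le_mono1) simp
  finally show "i * n + y < (k + 1) * n" .
qed (use assms in auto)

lemma block_row_entry:
  assumes "i \<le> k" "x < n" "y < n"
  shows "block_row n k D $$ (x, i * n + y) = D i $$ (x, y)"
  using assms(2) block_index[OF assms(1,3)] by (simp add: block_row_def)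

lemma block_row_carrier: "block_row n k D \<in> carrier_mat n ((k + 1) * n)"
  by (simp add: block_row_def)

lemma frobenius_norm_eq:
  assumes "A \<in> carrier_mat m n"
  shows "frobenius_norm A = sqrt (\<Sum>i<m. \<Sum>j<n. (cmod (A $$ (i, j)))\<^sup>2)"
  using assms by (simp add: frobenius_norm_def L2_set_def sum.cartesian_product split_def)

lemma poly_norm_Frobenius_eq:
  assumes "\<And>i. i \<le> k \<Longrightarrow> D i \<in> carrier_mat n n"
  shows "poly_norm Frobenius n k D = frobenius_norm (block_row n k D)"
proof -
  have "(\<Sum>i\<le>k. (frobenius_norm (D i))\<^sup>2) = (\<Sum>i<k + 1. \<Sum>x<n. \<Sum>y<n. (cmod (D i $$ (x, y)))\<^sup>2)"
    by (intro sum.cong) (auto simp: frobenius_norm_eq[OF assms] real_sqrt_pow2 sum_nonneg)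
  also have "\<dots> = (\<Sum>x<n. \<Sum>i<k + 1. \<Sum>y<n. (cmod (D i $$ (x, y)))\<^sup>2)" by (rule sum.swap)
  also have "\<dots> = (\<Sum>x<n. \<Sum>b<(k + 1) * n. (cmod (block_row n k D $$ (x, b)))\<^sup>2)"
    unfolding sum_blocks by (intro sum.cong refl) (simp add: block_row_entry)
  finally show ?thesis by (simp add: frobenius_norm_eq[OF block_row_carrier])
qed

lemma poly_norm_scaled_le:
  assumes D: "\<And>i. i \<le> k \<Longrightarrow> D i \<in> carrier_mat n n" and X: "X \<in> carrier_mat n ((k + 1) * n)" and n: "n > 0"
    and eq: "\<And>i x y. i \<le> k \<Longrightarrow> x < n \<Longrightarrow> y < n \<Longrightarrow> D i $$ (x, y) = c * X $$ (x, i * n + y)"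
  shows "poly_norm s n k D \<le> cmod c * mat_norm s X"
proof -
  have entry: "block_row n k D $$ (x, b) = c * X $$ (x, b)" if "x < n" "b < (k + 1) * n" for x b
  proof -
    have b: "b div n \<le> k" "b mod n < n" using that n by (auto simp: less_mult_imp_div_less less_Suc_eq_le[symmetric])
    have "block_row n k D $$ (x, b div n * n + b mod n) = c * X $$ (x, b div n * n + b mod n)"
      unfolding block_row_entry[OF b(1) that(1) b(2)] by (rule eq[OF b(1) that(1) b(2)])
    then show ?thesis by simp
  qed
  show ?thesis
  proof (cases s)
    case Spectral
    then show ?thesis using spectral_norm_scaled_le[OF block_row_carrier X _ entry] n by simp
  next
    case Frobenius
    have "frobenius_norm (block_row n k D) = sqrt (\<Sum>x<n. \<Sum>b<(k + 1) * n. (cmod c)\<^sup>2 * (cmod (X $$ (x, b)))\<^sup>2)"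
      unfolding frobenius_norm_eq[OF block_row_carrier]
      by (intro arg_cong[where f = sqrt] sum.cong refl) (simp add: entry norm_mult power_mult_distrib)
    also have "\<dots> = cmod c * frobenius_norm X"
      unfolding frobenius_norm_eq[OF X] sum_distrib_left[symmetric] real_sqrt_mult by simp
    finally show ?thesis using Frobenius poly_norm_Frobenius_eq[OF D] by simp
  qed
qed

lemma frobenius_norm_le:
  assumes A: "A \<in> carrier_mat m n" and B: "B \<in> carrier_mat m n"
  shows "frobenius_norm A \<le> frobenius_norm B + (\<Sum>i<m. \<Sum>j<n. cmod (A $$ (i, j) - B $$ (i, j)))"
proof -
  define S where "S = {..<m} \<times> {..<n}"
  have "frobenius_norm A = L2_set (\<lambda>ij. cmod (A $$ ij)) S" using A by (simp add: frobenius_norm_def S_def)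
  also have "\<dots> \<le> L2_set (\<lambda>ij. cmod (B $$ ij) + cmod (A $$ ij - B $$ ij)) S"
    by (rule L2_set_mono) (auto simp: norm_triangle_sub)
  also have "\<dots> \<le> L2_set (\<lambda>ij. cmod (B $$ ij)) S + L2_set (\<lambda>ij. cmod (A $$ ij - B $$ ij)) S"
    by (rule L2_set_triangle_ineq)
  also have "L2_set (\<lambda>ij. cmod (B $$ ij)) S = frobenius_norm B" using B by (simp add: frobenius_norm_def S_def)
  also have "L2_set (\<lambda>ij. cmod (A $$ ij - B $$ ij)) S \<le> (\<Sum>ij\<in>S. cmod (A $$ ij - B $$ ij))"
    by (rule L2_set_le_sum) simp
  also have "\<dots> = (\<Sum>i<m. \<Sum>j<n. cmod (A $$ (i, j) - B $$ (i, j)))"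
    by (simp add: S_def sum.cartesian_product split_def)
  finally show ?thesis by simp
qed

text \<open>A crude continuity estimate, with the number of all coefficients as the constant. It is used to let the
perturbation tend to \<open>0\<close>.\<close>

lemma poly_norm_perturb_le:
  assumes D: "\<And>i. i \<le> k \<Longrightarrow> D i \<in> carrier_mat n n" "\<And>i. i \<le> k \<Longrightarrow> D' i \<in> carrier_mat n n" and n: "n > 0"
    and close: "\<And>i x y. i \<le> k \<Longrightarrow> x < n \<Longrightarrow> y < n \<Longrightarrow> cmod (D i $$ (x, y) - D' i $$ (x, y)) \<le> \<epsilon>"
  shows "poly_norm s n k D \<le> poly_norm s n k D' + real (n * ((k + 1) * n)) * \<epsilon>"
proof -
  have "(\<Sum>x<n. \<Sum>b<(k + 1) * n. cmod (block_row n k D $$ (x, b) - block_row n k D' $$ (x, b)))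
     \<le> (\<Sum>x<n. \<Sum>b<(k + 1) * n. \<epsilon>)"
    unfolding sum_blocks by (intro sum_mono) (simp add: block_row_entry close)
  also have "\<dots> = real (n * ((k + 1) * n)) * \<epsilon>" by simp
  finally have *: "(\<Sum>x<n. \<Sum>b<(k + 1) * n. cmod (block_row n k D $$ (x, b) - block_row n k D' $$ (x, b)))
     \<le> real (n * ((k + 1) * n)) * \<epsilon>" .
  have n': "(k + 1) * n > 0" using n by simp
  show ?thesis
  proof (cases s)
    case Spectral
    then show ?thesis
      using spectral_norm_le[OF block_row_carrier[of n k D] block_row_carrier[of n k D'] n'] * by simp
  next
    case Frobenius
    then show ?thesis
      using frobenius_norm_le[OF block_row_carrier[of n k D] block_row_carrier[of n k D']] *
        poly_norm_Frobenius_eq[OF D(1)] poly_norm_Frobenius_eq[OF D(2)] by simp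
  qed
qed


section \<open>The upper bound for the distance\<close>

lemma coeff_pcompose_shift:
  fixes q :: "complex poly"
  shows "coeff (pcompose q [:a, 1:]) i = poly ((pderiv ^^ i) q) a / fact i"
proof -
  have shift: "(pderiv ^^ i) (pcompose q [:a, 1:]) = pcompose ((pderiv ^^ i) q) [:a, 1:]"
    by (induction i) (simp_all add: pderiv_pcompose pderiv_pCons)
  have "poly ((pderiv ^^ i) q) a = coeff ((pderiv ^^ i) (pcompose q [:a, 1:])) 0"
    unfolding shift by (simp add: poly_0_coeff_0[symmetric] poly_pcompose)
  also have "\<dots> = fact i * coeff (pcompose q [:a, 1:]) i"
    by (simp add: coeff_higher_pderiv pochhammer_fact[symmetric])
  finally show ?thesis by simp
qed

lemma linear_power_dvd_if_shift:
  fixes q :: "complex poly"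
  assumes "\<And>i. i < m \<Longrightarrow> coeff (pcompose q [:a, 1:]) i = 0"
  shows "[:- a, 1:] ^ m dvd q"
proof -
  have "monom 1 m dvd pcompose q [:a, 1:]" using assms by (simp add: monom_1_dvd_iff')
  then obtain w where w: "pcompose q [:a, 1:] = monom 1 m * w" by (elim dvdE)
  have lin: "pcompose [:a, 1:] [:- a, 1:] = [:0, 1:]" by (simp add: pcompose_pCons)
  have "q = pcompose (pcompose q [:a, 1:]) [:- a, 1:]"
    by (simp add: pcompose_assoc[symmetric] lin)
  also have "\<dots> = pcompose (monom 1 m) [:- a, 1:] * pcompose w [:- a, 1:]"
    unfolding w by (rule pcompose_mult)
  also have "pcompose (monom 1 m) [:- a, 1:] = [:- a, 1:] ^ m"
    by (simp add: x_as_monom[symmetric] monom_altdef pcompose_hom.hom_power pcompose_pCons)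
  finally show ?thesis by (rule dvdI)
qed

lemma coeff_mat_poly:
  assumes "x < n" "y < n"
  shows "coeff (mat_poly n k A $$ (x, y)) i = (if i \<le> k then A i $$ (x, y) else 0)"
  using assms by (auto simp: mat_poly_def coeff_sum)

lemma degree_mat_poly_le:
  assumes "x < n" "y < n"
  shows "degree (mat_poly n k A $$ (x, y)) \<le> k"
  using coeff_mat_poly[OF assms] by (intro degree_le) simp

lemma mat_poly_carrier: "mat_poly n k A \<in> carrier_mat n n"
  by (simp add: mat_poly_def)

lemma mat_poly_add:
  assumes "\<And>i. i \<le> k \<Longrightarrow> A i \<in> carrier_mat n n" "\<And>i. i \<le> k \<Longrightarrow> D i \<in> carrier_mat n n"
  shows "mat_poly n k A + mat_poly n k D = mat_poly n k (\<lambda>i. A i + D i)"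
proof (rule eq_matI)
  fix x y assume "x < dim_row (mat_poly n k (\<lambda>i. A i + D i))" "y < dim_col (mat_poly n k (\<lambda>i. A i + D i))"
  then have xy: "x < n" "y < n" by (auto simp: mat_poly_def)
  show "(mat_poly n k A + mat_poly n k D) $$ (x, y) = mat_poly n k (\<lambda>i. A i + D i) $$ (x, y)"
  proof (rule poly_eqI)
    fix i
    have "(mat_poly n k A + mat_poly n k D) $$ (x, y) = mat_poly n k A $$ (x, y) + mat_poly n k D $$ (x, y)"
      using xy mat_poly_carrier[of n k D] by simp
    moreover have "i \<le> k \<Longrightarrow> (A i + D i) $$ (x, y) = A i $$ (x, y) + D i $$ (x, y)"
      using assms(2)[of i] xy by simp
    ultimately show "coeff ((mat_poly n k A + mat_poly n k D) $$ (x, y)) i = coeff (mat_poly n k (\<lambda>i. A i + D i) $$ (x, y)) i"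
      by (simp add: coeff_mat_poly[OF xy])
  qed
qed (auto simp: mat_poly_def)

text \<open>The coefficient of \<open>(\<lambda> - a)\<^sup>i\<close> in the entry \<open>(x, y)\<close> of \<open>Q\<close>.\<close>

definition taylor_coeff :: "complex poly mat \<Rightarrow> complex \<Rightarrow> nat \<Rightarrow> nat \<Rightarrow> nat \<Rightarrow> complex" where
  "taylor_coeff Q a i x y = coeff (pcompose (Q $$ (x, y)) [:a, 1:]) i"

lemma M_V_carrier:
  "M_mat n k p a \<in> carrier_mat ((k + 1) * n) ((p + 1) * n)" "V_mat n r p g v \<in> carrier_mat ((p + 1) * n) (r + 1)"
  by (simp_all add: M_mat_def kronecker_def H_mat_def V_mat_def)

lemma block_row_mult_M_mat:
  assumes x: "x < n" and y: "y < n" and j: "j \<le> p"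
  shows "(block_row n k A * M_mat n k p a) $$ (x, j * n + y) = taylor_coeff (mat_poly n k A) a j x y"
proof -
  have Mentry: "M_mat n k p a $$ (i * n + z, j * n + y) = (if z = y then poly ((pderiv ^^ j) (monom 1 i)) a / fact j else 0)"
    if "i \<le> k" "z < n" for i z
    using block_index[OF that] block_index[OF j y] that y j by (simp add: M_mat_def kronecker_def H_mat_def)
  have "(block_row n k A * M_mat n k p a) $$ (x, j * n + y)
     = (\<Sum>i<k + 1. \<Sum>z<n. block_row n k A $$ (x, i * n + z) * M_mat n k p a $$ (i * n + z, j * n + y))"
    unfolding mult_mat_entry[OF block_row_carrier M_V_carrier(1) x block_index(1)[OF j y]] by (rule sum_blocks)
  also have "\<dots> = (\<Sum>i<k + 1. \<Sum>z<n. if z = y then A i $$ (x, y) * (poly ((pderiv ^^ j) (monom 1 i)) a / fact j) else 0)"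
    using x by (intro sum.cong refl) (simp add: block_row_entry Mentry)
  also have "\<dots> = (\<Sum>i\<le>k. A i $$ (x, y) * (poly ((pderiv ^^ j) (monom 1 i)) a / fact j))"
    using y by (simp add: lessThan_Suc_atMost[symmetric])
  also have "\<dots> = (\<Sum>i\<le>k. poly ((pderiv ^^ j) (smult (A i $$ (x, y)) (monom 1 i))) a) / fact j"
    by (simp add: higher_pderiv_smult sum_divide_distrib del: smult_monom)
  also have "\<dots> = poly ((pderiv ^^ j) (mat_poly n k A $$ (x, y))) a / fact j"
    using x y by (simp add: mat_poly_def higher_pderiv_sum poly_sum smult_monom)
  finally show ?thesis by (simp add: taylor_coeff_def coeff_pcompose_shift)
qed

text \<open>The sum runs to \<open>j\<close> although \<open>V\<close> has only \<open>p + 1\<close> block rows. If \<open>p = k\<close>, the Taylor coefficients beyond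
\<open>p\<close> vanish.\<close>

lemma block_row_mult_M_V:
  assumes x: "x < n" and j: "j \<le> r" and p: "p = min r k"
  shows "(block_row n k A * (M_mat n k p a * V_mat n r p g v)) $$ (x, j) =
     (\<Sum>i\<le>j. \<Sum>y<n. taylor_coeff (mat_poly n k A) a i x y * (gamma_prod g (j - i + 1) j * v $ ((j - i) * n + y)))"
proof -
  note MV = M_V_carrier
  have BM: "block_row n k A * M_mat n k p a \<in> carrier_mat n ((p + 1) * n)"
    by (rule mult_carrier_mat[OF block_row_carrier MV(1)])
  have jr: "j < r + 1" using j by simp
  define t where "t = (\<lambda>i. \<Sum>y<n. taylor_coeff (mat_poly n k A) a i x y * (gamma_prod g (j - i + 1) j * v $ ((j - i) * n + y)))"
  have V: "V_mat n r p g v $$ (i * n + y, j) = (if i \<le> j then gamma_prod g (j - i + 1) j * v $ ((j - i) * n + y) else 0)"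
    if "i \<le> p" "y < n" for i y
    using block_index[OF that] jr by (simp add: V_mat_def)
  have "(block_row n k A * (M_mat n k p a * V_mat n r p g v)) $$ (x, j) =
     (block_row n k A * M_mat n k p a * V_mat n r p g v) $$ (x, j)"
    using assoc_mult_mat[OF block_row_carrier MV(1) MV(2)] by simp
  also have "\<dots> = (\<Sum>i<p + 1. \<Sum>y<n. (block_row n k A * M_mat n k p a) $$ (x, i * n + y) * V_mat n r p g v $$ (i * n + y, j))"
    unfolding mult_mat_entry[OF BM MV(2) x jr] by (rule sum_blocks)
  also have "\<dots> = (\<Sum>i<p + 1. if i \<le> j then t i else 0)"
  proof (rule sum.cong[OF refl])
    fix i assume "i \<in> {..<p + 1}"
    then have i: "i \<le> p" by simp
    show "(\<Sum>y<n. (block_row n k A * M_mat n k p a) $$ (x, i * n + y) * V_mat n r p g v $$ (i * n + y, j))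
       = (if i \<le> j then t i else 0)"
      using i x by (auto simp: t_def block_row_mult_M_mat V simp del: index_mult_mat intro!: sum.cong)
  qed
  also have "\<dots> = (\<Sum>i\<le>j. t i)"
  proof -
    have "t i = 0" if i: "i \<le> j" "i \<notin> {..<p + 1}" for i
    proof -
      have "i > k" using i j p by auto
      have "taylor_coeff (mat_poly n k A) a i x y = 0" if y: "y < n" for y
      proof -
        have "degree (pcompose (mat_poly n k A $$ (x, y)) [:a, 1:]) \<le> k"
          using degree_mat_poly_le[OF x y] by simp
        then show ?thesis unfolding taylor_coeff_def using \<open>i > k\<close> by (intro coeff_eq_0) simp
      qed
      then show ?thesis by (simp add: t_def)
    qed
    then have "(\<Sum>i\<le>j. t i) = (\<Sum>i\<in>{..j} \<inter> {..<p + 1}. t i)"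
      by (intro sum.mono_neutral_right) auto
    also have "\<dots> = (\<Sum>i<p + 1. if i \<le> j then t i else 0)"
      by (subst Int_commute) (simp add: sum.inter_restrict)
    finally show ?thesis by simp
  qed
  finally show ?thesis by (simp add: t_def)
qed

lemma T_mat_mult_vec:
  assumes P: "P \<in> carrier_mat n n" and v: "v \<in> carrier_vec ((r + 1) * n)" and x: "x < n" and j: "j \<le> r"
  shows "(T_mat n r P a g *\<^sub>v v) $ (j * n + x) =
     (\<Sum>i\<le>j. \<Sum>y<n. taylor_coeff P a i x y * (gamma_prod g (j - i + 1) j * v $ ((j - i) * n + y)))"
proof -
  have T: "T_mat n r P a g \<in> carrier_mat ((r + 1) * n) ((r + 1) * n)" by (simp add: T_mat_def)
  have entry: "T_mat n r P a g $$ (j * n + x, i * n + y) =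
      (if i \<le> j then gamma_prod g (i + 1) j * taylor_coeff P a (j - i) x y else 0)" if "i \<le> r" "y < n" for i y
    using block_index[OF that] block_index[OF j x] P x that
    by (simp add: T_mat_def Let_def taylor_coeff_def coeff_pcompose_shift deriv_at_def)
  define t where "t = (\<lambda>i. \<Sum>y<n. gamma_prod g (i + 1) j * taylor_coeff P a (j - i) x y * v $ (i * n + y))"
  have "(T_mat n r P a g *\<^sub>v v) $ (j * n + x) =
     (\<Sum>i<r + 1. \<Sum>y<n. T_mat n r P a g $$ (j * n + x, i * n + y) * v $ (i * n + y))"
    unfolding mult_mat_vec_entry[OF T v block_index(1)[OF j x]] by (rule sum_blocks)
  also have "\<dots> = (\<Sum>i<r + 1. if i \<le> j then t i else 0)"
    by (intro sum.cong refl) (auto simp: t_def entry intro!: sum.cong)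
  also have "\<dots> = (\<Sum>i\<le>j. t i)"
    using j by (intro sum.mono_neutral_cong_right) auto
  also have "\<dots> = (\<Sum>i\<le>j. t (j - i))"
    using sum.nat_diff_reindex[of t "Suc j"] by (simp add: lessThan_Suc_atMost)
  also have "\<dots> = (\<Sum>i\<le>j. \<Sum>y<n. taylor_coeff P a i x y * (gamma_prod g (j - i + 1) j * v $ ((j - i) * n + y)))"
    unfolding t_def by (intro sum.cong refl) (auto simp: mult_ac)
  finally show ?thesis .
qed

lemma gamma_prod_split:
  assumes "i \<le> j"
  shows "gamma_prod g 1 j = gamma_prod g 1 (j - i) * gamma_prod g (j - i + 1) j"
proof -
  have "(\<Prod>l = 1..j. g $ (l - 1)) = (\<Prod>l = 1..j - i. g $ (l - 1)) * (\<Prod>l = j - i + 1..j. g $ (l - 1))"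
    using prod.ub_add_nat[of 1 "j - i" "\<lambda>l. g $ (l - 1)" i] assms by simp
  then show ?thesis by (simp add: gamma_prod_def)
qed

lemma gamma_prod_nonzero:
  assumes "g \<in> Gamma_set r" "j \<le> r"
  shows "gamma_prod g 1 j \<noteq> 0"
proof -
  have "(\<Prod>l = 1..j. g $ (l - 1)) > 0"
    using assms by (intro prod_pos) (auto simp: Gamma_set_def)
  then show ?thesis unfolding gamma_prod_def of_real_eq_0_iff by (rule less_imp_neq[symmetric])
qed

text \<open>Dividing \<open>v\<^sub>m\<close> by \<open>\<gamma>\<^sub>1 \<cdots> \<gamma>\<^sub>m\<close> turns column \<open>j\<close> of the block row times \<open>M V\<close> into \<open>\<gamma>\<^sub>1 \<cdots> \<gamma>\<^sub>j\<close> times the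
coefficient of \<open>(\<lambda> - a)\<^sup>j\<close> in the product of the matrix polynomial and \<open>x\<close>.\<close>

lemma jordan_chain_of_null_block_row:
  assumes g: "g \<in> Gamma_set r" and p: "p = min r k"
    and null: "block_row n k A * (M_mat n k p a * V_mat n r p g v) = 0\<^sub>m n (r + 1)"
  defines "x \<equiv> (\<lambda>y. \<Sum>m\<le>r. smult (v $ (m * n + y) / gamma_prod g 1 m) ([:- a, 1:] ^ m))"
  assumes z: "z < n"
  shows "[:- a, 1:] ^ (r + 1) dvd (\<Sum>y<n. mat_poly n k A $$ (z, y) * x y)"
proof (rule linear_power_dvd_if_shift)
  fix j assume "j < r + 1"
  then have j: "j \<le> r" by simp
  have xc: "coeff (pcompose (x y) [:a, 1:]) i = v $ (i * n + y) / gamma_prod g 1 i" if i: "i \<le> r" for y i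
  proof -
    have "pcompose [:- a, 1:] [:a, 1:] = [:0, 1:]" by (simp add: pcompose_pCons)
    then have "pcompose ([:- a, 1:] ^ m) [:a, 1:] = monom 1 m" for m
      by (simp add: pcompose_hom.hom_power monom_altdef)
    then have "pcompose (x y) [:a, 1:] = (\<Sum>m\<le>r. monom (v $ (m * n + y) / gamma_prod g 1 m) m)"
      by (simp add: x_def pcompose_sum pcompose_smult smult_monom)
    then show ?thesis using i by (simp add: coeff_sum)
  qed
  have "coeff (pcompose (\<Sum>y<n. mat_poly n k A $$ (z, y) * x y) [:a, 1:]) j
     = (\<Sum>y<n. \<Sum>i\<le>j. taylor_coeff (mat_poly n k A) a i z y * (v $ ((j - i) * n + y) / gamma_prod g 1 (j - i)))"
    unfolding pcompose_sum pcompose_mult coeff_sum coeff_mult taylor_coeff_def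
    using j by (intro sum.cong refl) (simp add: xc)
  also have "\<dots> = (\<Sum>i\<le>j. \<Sum>y<n. taylor_coeff (mat_poly n k A) a i z y * (v $ ((j - i) * n + y) / gamma_prod g 1 (j - i)))"
    by (rule sum.swap)
  also have "\<dots> = (\<Sum>i\<le>j. \<Sum>y<n. taylor_coeff (mat_poly n k A) a i z y * (gamma_prod g (j - i + 1) j * v $ ((j - i) * n + y)))
     / gamma_prod g 1 j"
    unfolding sum_divide_distrib
  proof (intro sum.cong refl)
    fix i y assume "i \<in> {..j}"
    then have i: "i \<le> j" by simp
    have "gamma_prod g 1 (j - i) \<noteq> 0" "gamma_prod g 1 j \<noteq> 0" using gamma_prod_nonzero[OF g] j by auto
    then show "taylor_coeff (mat_poly n k A) a i z y * (v $ ((j - i) * n + y) / gamma_prod g 1 (j - i))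
       = taylor_coeff (mat_poly n k A) a i z y * (gamma_prod g (j - i + 1) j * v $ ((j - i) * n + y)) / gamma_prod g 1 j"
      using gamma_prod_split[OF i, of g] by (simp add: field_simps)
  qed
  also have "\<dots> = (block_row n k A * (M_mat n k p a * V_mat n r p g v)) $$ (z, j) / gamma_prod g 1 j"
    using block_row_mult_M_V[OF z j p, of A a g v] by simp
  also have "\<dots> = 0" unfolding null using z j by simp
  finally show "coeff (pcompose (\<Sum>y<n. mat_poly n k A $$ (z, y) * x y) [:a, 1:]) j = 0" .
qed

lemma delta_le:
  assumes D: "\<And>i. i \<le> k \<Longrightarrow> D i \<in> carrier_mat n n"
    and "c \<ge> m" "elementary_divisor n (P + mat_poly n k D) a c"
  shows "delta s n k P a m \<le> ereal (poly_norm s n k D)"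
  unfolding delta_def using assms by (intro INF_lower) blast

text \<open>A regular perturbed polynomial is itself a competitor in the infimum. A singular one is replaced by
competitors at arbitrarily small distance.\<close>

lemma delta_le_of_jordan_chain:
  fixes A D :: "nat \<Rightarrow> complex mat" and x :: "nat \<Rightarrow> complex poly"
  assumes A: "\<And>i. i \<le> k \<Longrightarrow> A i \<in> carrier_mat n n" and D: "\<And>i. i \<le> k \<Longrightarrow> D i \<in> carrier_mat n n"
    and m: "1 \<le> m" "m \<le> k * n"
    and chain: "\<And>i. i < n \<Longrightarrow> [:- a, 1:] ^ m dvd (\<Sum>j<n. mat_poly n k (\<lambda>i. A i + D i) $$ (i, j) * x j)"
    and start: "j < n" "poly (x j) a \<noteq> 0"
  shows "delta s n k (mat_poly n k A) a m \<le> ereal (poly_norm s n k D)"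
proof -
  define Q where "Q = mat_poly n k (\<lambda>i. A i + D i)"
  have Q: "Q \<in> carrier_mat n n" unfolding Q_def by (rule mat_poly_carrier)
  have PD: "mat_poly n k A + mat_poly n k D = Q" unfolding Q_def by (rule mat_poly_add[OF A D])
  have nk: "n > 0" "k > 0" using m by (auto intro: Nat.gr0I)
  show ?thesis
  proof (cases "det Q = 0")
    case False
    obtain c where c: "c \<ge> m" "elementary_divisor n Q a c"
      using elementary_divisor_of_jordan_chain[OF Q False m(1) chain[folded Q_def] start] by blast
    show ?thesis by (rule delta_le[OF D c(1) c(2)[folded PD]])
  next
    case True
    show ?thesis
    proof (rule ereal_le_epsilon2)
      fix e :: real assume e: "e > 0"
      define C where "C = real (n * ((k + 1) * n))"
      have C: "C > 0" unfolding C_def of_nat_0_less_iff using nk by simp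
      have deg: "degree (Q $$ (i, j)) \<le> k" if "i < n" "j < n" for i j
        unfolding Q_def by (rule degree_mat_poly_le[OF that])
      have eC: "e / C > 0" using e C by simp
      obtain R c where R: "R \<in> carrier_mat n n"
        and degR: "\<And>i j. i < n \<Longrightarrow> j < n \<Longrightarrow> degree (R $$ (i, j)) \<le> k"
        and close: "\<And>i j l. i < n \<Longrightarrow> j < n \<Longrightarrow> l \<le> k \<Longrightarrow> cmod (coeff (R $$ (i, j) - Q $$ (i, j)) l) < e / C"
        and c: "c \<ge> k * n" "elementary_divisor n R a c"
        using singular_matrix_limit_of_elementary_divisor[OF Q True nk deg eC, of a] by blast
      define D' where "D' = (\<lambda>i. mat n n (\<lambda>(x, y). coeff (R $$ (x, y)) i - A i $$ (x, y)))"
      have D': "D' i \<in> carrier_mat n n" for i by (simp add: D'_def)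
      have "mat_poly n k A + mat_poly n k D' = mat_poly n k (\<lambda>i. A i + D' i)"
        by (rule mat_poly_add) (use A D' in auto)
      also have "\<dots> = R"
      proof (rule eq_matI)
        fix x y assume "x < dim_row R" "y < dim_col R"
        then have xy: "x < n" "y < n" using R by auto
        show "mat_poly n k (\<lambda>i. A i + D' i) $$ (x, y) = R $$ (x, y)"
          using degR[OF xy] xy
          by (intro poly_eqI) (auto simp: coeff_mat_poly[OF xy] D'_def coeff_eq_0)
      qed (use R in \<open>auto simp: mat_poly_def\<close>)
      finally have PD': "mat_poly n k A + mat_poly n k D' = R" .
      have "delta s n k (mat_poly n k A) a m \<le> ereal (poly_norm s n k D')"
        by (rule delta_le[OF D' _ c(2)[folded PD']]) (use c(1) m in simp)
      also have "poly_norm s n k D' \<le> poly_norm s n k D + C * (e / C)"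
        unfolding C_def
      proof (rule poly_norm_perturb_le[OF D' D nk(1)])
        fix i x y assume i: "i \<le> k" and xy: "x < n" "y < n"
        have "D' i $$ (x, y) - D i $$ (x, y) = coeff (R $$ (x, y) - Q $$ (x, y)) i"
          using i xy A[OF i] D[OF i] by (simp add: D'_def Q_def coeff_mat_poly)
        then show "cmod (D' i $$ (x, y) - D i $$ (x, y)) \<le> e / real (n * ((k + 1) * n))"
          using close[OF xy i] by (simp add: C_def)
      qed
      also have "C * (e / C) = e" using C by simp
      finally show "delta s n k (mat_poly n k A) a m \<le> ereal (poly_norm s n k D) + ereal e" by simp
    qed
  qed
qed

text \<open>The perturbation with coefficient row \<open>- f U Y\<^sup>\<dagger>\<close> maps \<open>Y = M V\<close> to \<open>- B Y\<close>, because \<open>f U = B Y\<close> and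
\<open>Y Y\<^sup>\<dagger> Y = Y\<close>.\<close>

lemma delta_le_singular_bound:
  fixes A :: "nat \<Rightarrow> complex mat"
  assumes A: "\<And>i. i \<le> k \<Longrightarrow> A i \<in> carrier_mat n n"
    and r: "r < k * n" and p: "p = min r k" and g: "g \<in> Gamma_set r"
    and pair: "singular_vector_pair (T_mat n r (mat_poly n k A) a g) f v u"
    and f: "f \<ge> 0" and v0: "vec_first v n \<noteq> 0\<^sub>v n"
  shows "delta s n k (mat_poly n k A) a (r + 1) \<le>
    ereal (f * mat_norm s (U_mat n r u * pinv (M_mat n k p a * V_mat n r p g v)))"
proof -
  let ?f = "complex_of_real f"
  define T where "T = T_mat n r (mat_poly n k A) a g"
  define Y where "Y = M_mat n k p a * V_mat n r p g v"
  define B where "B = block_row n k A"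
  define U where "U = U_mat n r u"
  define X where "X = U * pinv Y"
  have nk: "n > 0" "k > 0" using r by (auto intro: Nat.gr0I)
  have Y: "Y \<in> carrier_mat ((k + 1) * n) (r + 1)" unfolding Y_def by (rule mult_carrier_mat[OF M_V_carrier])
  have Yp: "pinv Y \<in> carrier_mat (r + 1) ((k + 1) * n)" by (rule pinv_carrier[OF Y])
  have B: "B \<in> carrier_mat n ((k + 1) * n)" unfolding B_def by (rule block_row_carrier)
  have U: "U \<in> carrier_mat n (r + 1)" by (simp add: U_def U_mat_def)
  have X: "X \<in> carrier_mat n ((k + 1) * n)" unfolding X_def by (rule mult_carrier_mat[OF U Yp])
  have v: "v \<in> carrier_vec ((r + 1) * n)" and u: "u \<in> carrier_vec ((r + 1) * n)"
    and Tv: "T *\<^sub>v v = ?f \<cdot>\<^sub>v u"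
    using pair by (auto simp: singular_vector_pair_def T_mat_def T_def)
  have BY: "B * Y = ?f \<cdot>\<^sub>m U"
  proof (rule eq_matI)
    fix x j assume "x < dim_row (?f \<cdot>\<^sub>m U)" "j < dim_col (?f \<cdot>\<^sub>m U)"
    then have x: "x < n" and j: "j \<le> r" using U by auto
    have "(B * Y) $$ (x, j) = (T *\<^sub>v v) $ (j * n + x)"
      unfolding B_def Y_def T_def block_row_mult_M_V[OF x j p] T_mat_mult_vec[OF mat_poly_carrier v x j] ..
    also have "\<dots> = ?f * u $ (j * n + x)" unfolding Tv using block_index(1)[OF j x] u by simp
    finally show "(B * Y) $$ (x, j) = (?f \<cdot>\<^sub>m U) $$ (x, j)"
      using x j by (simp add: U_def U_mat_def)
  qed (use B Y U in auto)
  define D where "D = (\<lambda>i. mat n n (\<lambda>(x, y). - ?f * X $$ (x, i * n + y)))"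
  have D: "D i \<in> carrier_mat n n" for i by (simp add: D_def)
  have BD: "block_row n k (\<lambda>i. A i + D i) = B + (- ?f) \<cdot>\<^sub>m X"
  proof (rule eq_matI)
    fix x b assume "x < dim_row (B + (- ?f) \<cdot>\<^sub>m X)" "b < dim_col (B + (- ?f) \<cdot>\<^sub>m X)"
    then have x: "x < n" and b: "b < (k + 1) * n" using X by auto
    have i: "b div n \<le> k" and y: "b mod n < n" using b nk by (auto simp: less_mult_imp_div_less less_Suc_eq_le[symmetric])
    have "block_row n k (\<lambda>i. A i + D i) $$ (x, b div n * n + b mod n) = (A (b div n) + D (b div n)) $$ (x, b mod n)"
      by (rule block_row_entry[OF i x y])
    also have "\<dots> = B $$ (x, b div n * n + b mod n) + D (b div n) $$ (x, b mod n)"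
      unfolding B_def block_row_entry[OF i x y] using x y D[of "b div n"] by simp
    also have "D (b div n) $$ (x, b mod n) = - ?f * X $$ (x, b)"
      using x y by (simp add: D_def)
    finally show "block_row n k (\<lambda>i. A i + D i) $$ (x, b) = (B + (- ?f) \<cdot>\<^sub>m X) $$ (x, b)"
      using x b X by simp
  qed (use B X in \<open>auto simp: block_row_def\<close>)
  have UYY: "?f \<cdot>\<^sub>m (X * Y) = ?f \<cdot>\<^sub>m U"
  proof -
    have YpY: "pinv Y * Y \<in> carrier_mat (r + 1) (r + 1)" by (rule mult_carrier_mat[OF Yp Y])
    have "?f \<cdot>\<^sub>m (X * Y) = ?f \<cdot>\<^sub>m (U * (pinv Y * Y))"
      unfolding X_def assoc_mult_mat[OF U Yp Y] ..
    also have "\<dots> = (?f \<cdot>\<^sub>m U) * (pinv Y * Y)"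
      by (rule mult_smult_assoc_mat[OF U YpY, symmetric])
    also have "\<dots> = B * Y * (pinv Y * Y)" unfolding BY ..
    also have "\<dots> = B * (Y * (pinv Y * Y))" by (rule assoc_mult_mat[OF B Y YpY])
    also have "Y * (pinv Y * Y) = Y * pinv Y * Y" by (rule assoc_mult_mat[OF Y Yp Y, symmetric])
    also have "\<dots> = Y" by (rule mult_pinv_mult)
    finally show ?thesis unfolding BY .
  qed
  have fX: "(- ?f) \<cdot>\<^sub>m X \<in> carrier_mat n ((k + 1) * n)" using X by simp
  have "block_row n k (\<lambda>i. A i + D i) * Y = B * Y + ((- ?f) \<cdot>\<^sub>m X) * Y"
    unfolding BD by (rule add_mult_distrib_mat[OF B fX Y])
  also have "((- ?f) \<cdot>\<^sub>m X) * Y = (- ?f) \<cdot>\<^sub>m (X * Y)"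
    by (rule mult_smult_assoc_mat[OF X Y])
  also have "B * Y + \<dots> = 0\<^sub>m n (r + 1)"
  proof (rule eq_matI)
    fix x j assume "x < dim_row (0\<^sub>m n (r + 1) :: complex mat)" "j < dim_col (0\<^sub>m n (r + 1) :: complex mat)"
    then have xj: "x < n" "j < r + 1" by auto
    have XY: "X * Y \<in> carrier_mat n (r + 1)" by (rule mult_carrier_mat[OF X Y])
    have "(?f \<cdot>\<^sub>m (X * Y)) $$ (x, j) = (?f \<cdot>\<^sub>m U) $$ (x, j)" unfolding UYY ..
    then have "?f * (X * Y) $$ (x, j) = ?f * U $$ (x, j)"
      using xj U carrier_matD[OF XY] by (simp del: index_mult_mat)
    then show "(B * Y + (- ?f) \<cdot>\<^sub>m (X * Y)) $$ (x, j) = 0\<^sub>m n (r + 1) $$ (x, j)"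
      unfolding BY using xj U carrier_matD[OF XY] by (auto simp del: index_mult_mat)
  qed (use X Y in auto)
  finally have null: "block_row n k (\<lambda>i. A i + D i) * (M_mat n k p a * V_mat n r p g v) = 0\<^sub>m n (r + 1)"
    unfolding Y_def .
  obtain y where y: "y < n" "v $ y \<noteq> 0"
  proof -
    have "\<exists>y<n. vec_first v n $ y \<noteq> 0"
    proof (rule ccontr)
      assume "\<not> ?thesis"
      then have "vec_first v n = 0\<^sub>v n" by (intro eq_vecI) (auto simp: vec_first_def)
      then show False using v0 by simp
    qed
    then show ?thesis using that by (auto simp: vec_first_def)
  qed
  define x where "x = (\<lambda>y. \<Sum>m\<le>r. smult (v $ (m * n + y) / gamma_prod g 1 m) ([:- a, 1:] ^ m))"
  have "poly (x y) a = (\<Sum>m\<le>r. if m = 0 then v $ y else 0)"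
    unfolding x_def poly_sum by (intro sum.cong) (auto simp: gamma_prod_def)
  then have xy: "poly (x y) a \<noteq> 0" using y by simp
  have "delta s n k (mat_poly n k A) a (r + 1) \<le> ereal (poly_norm s n k D)"
  proof (rule delta_le_of_jordan_chain[OF A D _ _ _ y(1), where m = "r + 1" and a = a and x = x])
    show "[:- a, 1:] ^ (r + 1) dvd (\<Sum>j<n. mat_poly n k (\<lambda>i. A i + D i) $$ (i, j) * x j)" if "i < n" for i
      unfolding x_def by (rule jordan_chain_of_null_block_row[OF g p null that])
  qed (use r xy in auto)
  also have "poly_norm s n k D \<le> cmod (- ?f) * mat_norm s X"
    by (rule poly_norm_scaled_le[OF D X nk(1)]) (simp add: D_def)
  finally show ?thesis using f by (simp add: X_def U_def Y_def)
qed

theorem theorem8p1: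
  fixes n k r p :: nat
    and A :: "nat \<Rightarrow> complex mat"
    and P :: "complex poly mat"
    and lambda0 :: complex
    and s :: norm_kind
    and f :: "real vec \<Rightarrow> real"
    and v u :: "real vec \<Rightarrow> complex vec"
    and Gamma0 :: "real vec set"
  assumes "\<And>i. i \<le> k \<Longrightarrow> A i \<in> carrier_mat n n"
    and "A k \<noteq> 0\<^sub>m n n"
    and "P = mat_poly n k A"
    and "0 < r" and "r < k * n"
    and "p = min r k"
    and "\<And>g. g \<in> Gamma_set r \<Longrightarrow>
           f g = singular_value ((r + 1) * n - r) (T_mat n r P lambda0 g)"
    and "\<And>g. g \<in> Gamma_set r \<Longrightarrow>
           singular_vector_pair (T_mat n r P lambda0 g) (f g) (v g) (u g)"
    and "Gamma0 = {g \<in> Gamma_set r. vec_first (v g) n \<noteq> 0\<^sub>v n}"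
  shows "delta s n k P lambda0 (r + 1) \<le>
           (INF g \<in> Gamma0. ereal (f g *
              mat_norm s (U_mat n r (u g) * pinv (M_mat n k p lambda0 * V_mat n r p g (v g)))))"
proof (rule INF_greatest)
  fix g assume "g \<in> Gamma0"
  then have g: "g \<in> Gamma_set r" and v0: "vec_first (v g) n \<noteq> 0\<^sub>v n" using assms(9) by auto
  have "n > 0" using assms(5) by (auto intro: Nat.gr0I)
  then have "r < (r + 1) * n" by (cases n) auto
  then have "singular_value ((r + 1) * n - r) (T_mat n r P lambda0 g) \<ge> 0"
    by (intro singular_value_nonneg[of _ "(r + 1) * n" "(r + 1) * n"]) (auto simp: T_mat_def)
  then have fg: "f g \<ge> 0" using assms(7)[OF g] by simp
  show "delta s n k P lambda0 (r + 1) \<le> ereal (f g *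
      mat_norm s (U_mat n r (u g) * pinv (M_mat n k p lambda0 * V_mat n r p g (v g))))"
    unfolding assms(3)
    by (rule delta_le_singular_bound[OF assms(1,5,6) g assms(8)[OF g, unfolded assms(3)] fg v0])
qed

end
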